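(* Let $g=(\mathfrak a,g_{fi},g_\infty)$ and $g'=(\mathfrak a',g'_{fi},g'_\infty)$ be matrix pairs over $K$ of respective ranks $r$ and $r'$. Then: 1. $\mathrm{rep}(\det(g))=\det(\mathrm{rep}(g))$. 2. $\deg(g)=\deg(\mathrm{rep}(g))$. 3. $\mathrm{rep}(g\otimes g')=\mathrm{rep}(g)\otimes\mathrm{rep}(g')$. 4. $\mathrm{rep}(g\oplus g')=\mathrm{rep}(g)\oplus\mathrm{rep}(g')$. 5. $\mathrm{rep}(g^\vee)=\mathrm{rep}(g)^\vee$.
   Context: Setting. $k$ is a perfect field, $K$ is a finite separable extension of the rational function field $k(x)$; $k(x)_\infty$ is the valuation ring of the valuation $-\deg$ of $k(x)$; $A_{fi}$ (resp. $A_\infty$) is the integral closure of $k[x]$ (resp. $k(x)_\infty$) in $K$. $M$ is the set of places of $K/k$, $M^{fi}$ the finite places (corresponding to the maximal ideals of $A_{fi}$), $M^\infty$ the infinite ones (corresponding to the maximal ideals of $A_\infty$). For $P\in M$: $A_P$ is the valuation ring, $v_P$ the normalized valuation, $k_P$ the residue field, $\deg P=[k_P:k]$, and $\pi_P$ is a fixed uniformizer. $v_P(I)$ for a fractional ideal $I$ of $A_{fi}$ is the exponent of $P$ in $I$. Répartitions. $R$ is the restricted product of copies of $K$ indexed by $M$: families $(r_P)_{P\in M}\in\prod_{P}K$ with $r_P\in A_P$ for all but finitely many $P$. For $r\in R^\times$, $\deg(r)=\sum_{P\in M}v_P(r_P)\deg(P)$. For $h\in GL_r(R)$, $\deg(h):=\deg(\det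 h)$ and $h^\vee:={}^th^{-1}$. For matrices $h=(h_{ij})$ and $h'$, $h\otimes h'$ is the Kronecker product (block matrix with blocks $h_{ij}h'$) and $h\oplus h'$ is the block-diagonal matrix with blocks $h,h'$. Matrix pairs. A matrix pair of rank $r$ is $g=(\mathfrak a,g_{fi},g_\infty)$ where $\mathfrak a=(\mathfrak a_1,\dots,\mathfrak a_r)$ are (nonzero) fractional ideals of $A_{fi}$ and $g_{fi},g_\infty\in GL_r(K)$. If $x_1,\dots,x_r$ are the columns of $g_{fi}$, the répartition matrix $\mathrm{rep}(g)=(g_P)_{P\in M}\in GL_r(R)$ is given by $g_P=g_\infty$ for $P\in M^\infty$ and $g_P=\begin{pmatrix}\pi_P^{v_P(\mathfrak a_1)}x_1&\cdots&\pi_P^{v_P(\mathfrak a_r)}x_r\end{pmatrix}$ for $P\in M^{fi}$. Operations on matrix pairs. - $\det(g)=\left(\prod_{i=1}^r\mathfrak a_i,\det(g_{fi}),\det(g_\infty)\right)$. - For a fractional ideal $I$ of $A_{fi}$, $\deg(I)=\sum_{P\in M^{fi}}v_P(I)\deg(P)$; for $a\in K^\times$, $\deg_{fi}(a)=\deg(aA_{fi})$ and $\deg_\infty(a)=-\deg_{fi}(a)=\sum_{P\in M^\infty}v_P(a)\deg(P)$. If $r=1$, $\deg(g)=\deg(\mathfrak a)+\deg_{fi}(g_{fi})+\deg_\infty(g_\infty)$; if $r>1$, $\deg(g)=\deg(\det(g))$. - $g\otimes g'=\left((\mathfrak a_1\mathfrak a'_1,\mathfrak a_1\mathfrak a'_2,\dots,\mathfrak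 a_1\mathfrak a'_{r'},\mathfrak a_2\mathfrak a'_1,\dots,\mathfrak a_r\mathfrak a'_{r'}),\,g_{fi}\otimes g'_{fi},\,g_\infty\otimes g'_\infty\right)$. - $g\oplus g'=\left((\mathfrak a_1,\dots,\mathfrak a_r,\mathfrak a'_1,\dots,\mathfrak a'_{r'}),\,g_{fi}\oplus g'_{fi},\,g_\infty\oplus g'_\infty\right)$. - $g^\vee=\left((\mathfrak a_1^{-1},\dots,\mathfrak a_r^{-1}),\,({}^tg_{fi})^{-1},\,({}^tg_\infty)^{-1}\right)$. *)

theory Defs
  imports
    "HOL-Algebra.Embedded_Algebras"
    "HOL-Algebra.Ideal_Product"
    "HOL-Algebra.QuotRing"
    "HOL-Computational_Algebra.Computational_Algebra"
    "Jordan_Normal_Form.Gauss_Jordan_Elimination"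
    "Jordan_Normal_Form.Determinant"
    "Jordan_Normal_Form.VS_Connect"
begin

section \<open>The function field\<close>

text \<open>
  The rational function field over \<open>k\<close> is \<^typ>\<open>'k::field poly fract\<close>, and the extension is a field
  type \<open>'K\<close> together with an embedding \<open>\<iota>\<close> of the rational function field into it. Subrings of the
  extension, their ideals and residue rings are treated with HOL-Algebra, as subsets of the ring
  \<^term>\<open>class_ring\<close> of all elements.
\<close>

definition separable_poly :: "'a::field poly \<Rightarrow> bool" where
  "separable_poly p \<longleftrightarrow> coprime p (pderiv p)"

definition perfect_field :: "'k::field itself \<Rightarrow> bool" where
  "perfect_field _ \<longleftrightarrow> (\<forall>p :: 'k poly. irreducible p \<longrightarrow> separable_poly p)"

definition finite_extension :: "('F::field \<Rightarrow> 'K::field) \<Rightarrow> bool" where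
  "finite_extension \<iota> \<longleftrightarrow> (\<exists>B. finite B \<and> (\<forall>y. \<exists>c. y = (\<Sum>b\<in>B. \<iota> (c b) * b)))"

definition separable_extension :: "('F::field \<Rightarrow> 'K::field) \<Rightarrow> bool" where
  "separable_extension \<iota> \<longleftrightarrow>
     (\<forall>y. \<exists>p. irreducible p \<and> separable_poly p \<and> poly (map_poly \<iota> p) y = 0)"

definition const_field :: "('k::field poly fract \<Rightarrow> 'K::field) \<Rightarrow> 'K set" where
  "const_field \<iota> = range (\<lambda>c. \<iota> (to_fract [:c:]))"

definition integral_closure :: "'K::field set \<Rightarrow> 'K set" where
  "integral_closure S =
     {y. \<exists>p. lead_coeff p = 1 \<and> (\<forall>i. coeff p i \<in> S) \<and> poly p y = 0}"

text \<open>The fractions \<open>f / h\<close> whose valuation \<open>degree h - degree f\<close> is nonnegative (or that vanish).\<close>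

definition infinite_valuation_ring :: "'k::field poly fract set" where
  "infinite_valuation_ring = {Fract f h | f h. h \<noteq> 0 \<and> degree f \<le> degree h}"

definition A_fin :: "('k::field poly fract \<Rightarrow> 'K::field) \<Rightarrow> 'K set" where
  "A_fin \<iota> = integral_closure (\<iota> ` range to_fract)"

definition A_inf :: "('k::field poly fract \<Rightarrow> 'K::field) \<Rightarrow> 'K set" where
  "A_inf \<iota> = integral_closure (\<iota> ` infinite_valuation_ring)"

section \<open>Places\<close>

abbreviation ring_on :: "'K::field set \<Rightarrow> 'K ring" where
  "ring_on S \<equiv> class_ring\<lparr>carrier := S\<rparr>"

text \<open>
  A place is represented by its valuation ring. Those containing the integral closure of
  \<open>k[x]\<close> are the finite ones.
\<close>

definition places :: "('k::field poly fract \<Rightarrow> 'K::field) \<Rightarrow> 'K set set" where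
  "places \<iota> = {P. subring P class_ring \<and> const_field \<iota> \<subseteq> P \<and> P \<noteq> UNIV \<and>
                    (\<forall>z. z \<in> P \<or> inverse z \<in> P)}"

definition fin_places :: "('k::field poly fract \<Rightarrow> 'K::field) \<Rightarrow> 'K set set" where
  "fin_places \<iota> = {P \<in> places \<iota>. A_fin \<iota> \<subseteq> P}"

definition inf_places :: "('k::field poly fract \<Rightarrow> 'K::field) \<Rightarrow> 'K set set" where
  "inf_places \<iota> = {P \<in> places \<iota>. A_inf \<iota> \<subseteq> P}"

definition max_ideal :: "'K::field set \<Rightarrow> 'K set" where
  "max_ideal P = {z \<in> P. z = 0 \<or> inverse z \<notin> P}"

definition residue_ring_at :: "'K::field set \<Rightarrow> 'K set ring" where
  "residue_ring_at P = ring_on P Quot max_ideal P"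

text \<open>The dimension of the residue field over the image of \<open>k\<close> in it.\<close>

definition place_degree :: "('k::field poly fract \<Rightarrow> 'K::field) \<Rightarrow> 'K set \<Rightarrow> nat" where
  "place_degree \<iota> P =
     ring.dim (residue_ring_at P)
       ((\<lambda>c. max_ideal P +>\<^bsub>ring_on P\<^esub> c) ` const_field \<iota>) (carrier (residue_ring_at P))"

text \<open>
  The normalized discrete valuation with valuation ring \<open>P\<close>. It is only meaningful on nonzero
  elements; the value at \<open>0\<close> is fixed to \<open>0\<close> so that it is unique as an integer-valued function.
\<close>

definition normalized_valuation :: "'K::field set \<Rightarrow> ('K \<Rightarrow> int) \<Rightarrow> bool" where
  "normalized_valuation P v \<longleftrightarrow>
     v 0 = 0 \<and>
     (\<forall>a b. a \<noteq> 0 \<longrightarrow> b \<noteq> 0 \<longrightarrow> v (a * b) = v a + v b) \<and>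
     (\<forall>a b. a \<noteq> 0 \<longrightarrow> b \<noteq> 0 \<longrightarrow> a + b \<noteq> 0 \<longrightarrow> min (v a) (v b) \<le> v (a + b)) \<and>
     v ` (UNIV - {0}) = UNIV \<and>
     P = {z. z = 0 \<or> 0 \<le> v z}"

definition val :: "'K::field set \<Rightarrow> 'K \<Rightarrow> int" where
  "val P = (THE v. normalized_valuation P v)"

section \<open>Fractional ideals\<close>

definition fractional_ideal :: "'K::field set \<Rightarrow> 'K set \<Rightarrow> bool" where
  "fractional_ideal A I \<longleftrightarrow>
     (\<forall>a\<in>I. \<forall>b\<in>I. a + b \<in> I) \<and> (\<forall>c\<in>A. \<forall>a\<in>I. c * a \<in> I) \<and>
     (\<exists>a\<in>I. a \<noteq> 0) \<and> (\<exists>d\<in>A. d \<noteq> 0 \<and> (\<forall>a\<in>I. d * a \<in> A))"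

definition frac_ideals :: "'K::field set \<Rightarrow> 'K set monoid" where
  "frac_ideals A = \<lparr>carrier = {I. fractional_ideal A I}, monoid.mult = ideal_prod class_ring, one = A\<rparr>"

definition ideal_factorization :: "'K::field set \<Rightarrow> 'K set \<Rightarrow> ('K set \<Rightarrow> int) \<Rightarrow> bool" where
  "ideal_factorization A I e \<longleftrightarrow>
     (\<forall>p. e p \<noteq> 0 \<longrightarrow> maximalideal p (ring_on A)) \<and> finite {p. e p \<noteq> 0} \<and>
     I = finprod (frac_ideals A) (\<lambda>p. p [^]\<^bsub>frac_ideals A\<^esub> e p) {p. e p \<noteq> 0}"

text \<open>
  A finite place \<open>P\<close> corresponds to the maximal ideal \<open>max_ideal P \<inter> A_fin \<iota>\<close>; its valuation of a
  fractional ideal is the exponent of this maximal ideal in the factorization.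
\<close>

definition ideal_val :: "('k::field poly fract \<Rightarrow> 'K::field) \<Rightarrow> 'K set \<Rightarrow> 'K set \<Rightarrow> int" where
  "ideal_val \<iota> P I = (THE e. ideal_factorization (A_fin \<iota>) I e) (max_ideal P \<inter> A_fin \<iota>)"

definition ideal_deg :: "('k::field poly fract \<Rightarrow> 'K::field) \<Rightarrow> 'K set \<Rightarrow> int" where
  "ideal_deg \<iota> I =
     (\<Sum>P | P \<in> fin_places \<iota> \<and> ideal_val \<iota> P I \<noteq> 0. ideal_val \<iota> P I * int (place_degree \<iota> P))"

definition deg_fin :: "('k::field poly fract \<Rightarrow> 'K::field) \<Rightarrow> 'K \<Rightarrow> int" where
  "deg_fin \<iota> a = ideal_deg \<iota> ((\<lambda>y. a * y) ` A_fin \<iota>)"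

text \<open>By the product formula, this is also \<open>- deg_fin \<iota> a\<close> for nonzero \<open>a\<close>.\<close>

definition deg_inf :: "('k::field poly fract \<Rightarrow> 'K::field) \<Rightarrow> 'K \<Rightarrow> int" where
  "deg_inf \<iota> a =
     (\<Sum>P | P \<in> inf_places \<iota> \<and> val P a \<noteq> 0. val P a * int (place_degree \<iota> P))"

section \<open>Matrices\<close>

definition kronecker :: "'K::field mat \<Rightarrow> 'K mat \<Rightarrow> 'K mat" where
  "kronecker A B = mat (dim_row A * dim_row B) (dim_col A * dim_col B)
     (\<lambda>(i, j). A $$ (i div dim_row B, j div dim_col B) * B $$ (i mod dim_row B, j mod dim_col B))"

definition direct_sum_mat :: "'K::field mat \<Rightarrow> 'K mat \<Rightarrow> 'K mat" where
  "direct_sum_mat A B = diag_block_mat [A, B]"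

definition dual_mat :: "'K::field mat \<Rightarrow> 'K mat" where
  "dual_mat A = the (mat_inverse (transpose_mat A))"

definition scalar_mat :: "'K::field \<Rightarrow> 'K mat" where
  "scalar_mat a = mat 1 1 (\<lambda>_. a)"

section \<open>Repartitions\<close>

text \<open>
  Families indexed by the places are functions restricted to \<^term>\<open>places \<iota>\<close>, so that equality of
  families is equality of functions. A matrix with repartition entries is identified with the
  corresponding family of matrices over \<open>K\<close>.
\<close>

definition rep_deg :: "('k::field poly fract \<Rightarrow> 'K::field) \<Rightarrow> ('K set \<Rightarrow> 'K) \<Rightarrow> int" where
  "rep_deg \<iota> s =
     (\<Sum>P | P \<in> places \<iota> \<and> val P (s P) \<noteq> 0. val P (s P) * int (place_degree \<iota> P))"

definition rep_det ::
    "('k::field poly fract \<Rightarrow> 'K::field) \<Rightarrow> ('K set \<Rightarrow> 'K mat) \<Rightarrow> 'K set \<Rightarrow> 'K" where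
  "rep_det \<iota> h = (\<lambda>P\<in>places \<iota>. det (h P))"

definition rep_mat_deg ::
    "('k::field poly fract \<Rightarrow> 'K::field) \<Rightarrow> ('K set \<Rightarrow> 'K mat) \<Rightarrow> int" where
  "rep_mat_deg \<iota> h = rep_deg \<iota> (rep_det \<iota> h)"

definition rep_scalar_mat ::
    "('k::field poly fract \<Rightarrow> 'K::field) \<Rightarrow> ('K set \<Rightarrow> 'K) \<Rightarrow> 'K set \<Rightarrow> 'K mat" where
  "rep_scalar_mat \<iota> s = (\<lambda>P\<in>places \<iota>. scalar_mat (s P))"

definition rep_tensor ::
    "('k::field poly fract \<Rightarrow> 'K::field) \<Rightarrow> ('K set \<Rightarrow> 'K mat) \<Rightarrow> ('K set \<Rightarrow> 'K mat) \<Rightarrow>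
     'K set \<Rightarrow> 'K mat" where
  "rep_tensor \<iota> h h' = (\<lambda>P\<in>places \<iota>. kronecker (h P) (h' P))"

definition rep_sum ::
    "('k::field poly fract \<Rightarrow> 'K::field) \<Rightarrow> ('K set \<Rightarrow> 'K mat) \<Rightarrow> ('K set \<Rightarrow> 'K mat) \<Rightarrow>
     'K set \<Rightarrow> 'K mat" where
  "rep_sum \<iota> h h' = (\<lambda>P\<in>places \<iota>. direct_sum_mat (h P) (h' P))"

definition rep_dual ::
    "('k::field poly fract \<Rightarrow> 'K::field) \<Rightarrow> ('K set \<Rightarrow> 'K mat) \<Rightarrow> 'K set \<Rightarrow> 'K mat" where
  "rep_dual \<iota> h = (\<lambda>P\<in>places \<iota>. dual_mat (h P))"

section \<open>Matrix pairs\<close>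

record 'K matrix_pair =
  ideals :: "'K set list"
  fin_mat :: "'K mat"
  inf_mat :: "'K mat"

definition matrix_pair_of_rank ::
    "('k::field poly fract \<Rightarrow> 'K::field) \<Rightarrow> nat \<Rightarrow> 'K matrix_pair \<Rightarrow> bool" where
  "matrix_pair_of_rank \<iota> r g \<longleftrightarrow>
     length (ideals g) = r \<and> (\<forall>I\<in>set (ideals g). fractional_ideal (A_fin \<iota>) I) \<and>
     fin_mat g \<in> carrier_mat r r \<and> invertible_mat (fin_mat g) \<and>
     inf_mat g \<in> carrier_mat r r \<and> invertible_mat (inf_mat g)"

text \<open>The argument \<open>\<pi>\<close> is the chosen family of uniformizers.\<close>

definition rep ::
    "('k::field poly fract \<Rightarrow> 'K::field) \<Rightarrow> ('K set \<Rightarrow> 'K) \<Rightarrow> 'K matrix_pair \<Rightarrow>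
     'K set \<Rightarrow> 'K mat" where
  "rep \<iota> \<pi> g = (\<lambda>P\<in>places \<iota>.
     if P \<in> inf_places \<iota> then inf_mat g
     else mat_of_cols (dim_row (fin_mat g))
       (map2 (\<lambda>I x. (\<pi> P powi ideal_val \<iota> P I) \<cdot>\<^sub>v x) (ideals g) (cols (fin_mat g))))"

definition mp_det ::
    "('k::field poly fract \<Rightarrow> 'K::field) \<Rightarrow> 'K matrix_pair \<Rightarrow> 'K matrix_pair" where
  "mp_det \<iota> g =
     \<lparr>ideals = [finprod (frac_ideals (A_fin \<iota>)) (\<lambda>i. ideals g ! i) {..<length (ideals g)}],
      fin_mat = scalar_mat (det (fin_mat g)),
      inf_mat = scalar_mat (det (inf_mat g))\<rparr>"

definition mp_deg1 :: "('k::field poly fract \<Rightarrow> 'K::field) \<Rightarrow> 'K matrix_pair \<Rightarrow> int" where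
  "mp_deg1 \<iota> g =
     ideal_deg \<iota> (ideals g ! 0) + deg_fin \<iota> (fin_mat g $$ (0, 0)) + deg_inf \<iota> (inf_mat g $$ (0, 0))"

definition mp_deg :: "('k::field poly fract \<Rightarrow> 'K::field) \<Rightarrow> 'K matrix_pair \<Rightarrow> int" where
  "mp_deg \<iota> g = (if length (ideals g) = 1 then mp_deg1 \<iota> g else mp_deg1 \<iota> (mp_det \<iota> g))"

definition mp_tensor ::
    "'K::field matrix_pair \<Rightarrow> 'K matrix_pair \<Rightarrow> 'K matrix_pair" where
  "mp_tensor g g' =
     \<lparr>ideals = [ideal_prod class_ring I J. I \<leftarrow> ideals g, J \<leftarrow> ideals g'],
      fin_mat = kronecker (fin_mat g) (fin_mat g'),
      inf_mat = kronecker (inf_mat g) (inf_mat g')\<rparr>"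

definition mp_sum ::
    "'K::field matrix_pair \<Rightarrow> 'K matrix_pair \<Rightarrow> 'K matrix_pair" where
  "mp_sum g g' =
     \<lparr>ideals = ideals g @ ideals g',
      fin_mat = direct_sum_mat (fin_mat g) (fin_mat g'),
      inf_mat = direct_sum_mat (inf_mat g) (inf_mat g')\<rparr>"

definition mp_dual ::
    "('k::field poly fract \<Rightarrow> 'K::field) \<Rightarrow> 'K matrix_pair \<Rightarrow> 'K matrix_pair" where
  "mp_dual \<iota> g =
     \<lparr>ideals = map (\<lambda>I. inv\<^bsub>frac_ideals (A_fin \<iota>)\<^esub> I) (ideals g),
      fin_mat = dual_mat (fin_mat g),
      inf_mat = dual_mat (inf_mat g)\<rparr>"

end

theory Submission
  imports Defs "Jordan_Normal_Form.Char_Poly"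
begin

text \<open>
  At a place \<open>P\<close>, the matrix of the repartition attached to \<open>g\<close> is the infinite matrix of \<open>g\<close>,
  or the finite one with its columns multiplied by the powers \<open>\<pi>\<^sub>P\<^bsup>v(\<aa>\<^sub>i)\<^esup>\<close>, where \<open>v\<close> is the
  exponent of \<open>P\<close> in fractional ideals. Multiplying columns is multiplication by a diagonal matrix
  on the right, so it is compatible with determinants, Kronecker products, direct sums and
  inverse transposes as soon as the exponents behave like valuations:
  \<open>v(IJ) = v(I) + v(J)\<close> and \<open>v(I\<^sup>-\<^sup>1) = - v(I)\<close>. For degrees one needs moreover
  \<open>v(aA) = v\<^sub>P(a)\<close>, that every place is either finite or infinite but not both, and that only finitely
  many places contribute to a sum; in particular there are finitely many infinite places. So the
  substance is that the integral closure \<open>A\<close> of \<open>k[x]\<close> is a Dedekind domain whose maximal ideals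
  are the centres of the finite places. This is proved without showing that \<open>A\<close> is a finitely
  generated module over \<open>k[x]\<close>.

  The argument rests on linear dependence. There is an \<open>n\<close> such that any \<open>n + 1\<close> elements of the
  extension satisfy a linear relation over \<open>k[y]\<close> in which, for a given nonconstant \<open>q\<close>, some
  coefficient is not divisible by \<open>q\<close> (\<open>reduced_dependence\<close>). For powers of one element \<open>u\<close>, this
  gives the following.
  \<^item> If \<open>q(y)\<close> generates the contraction of the maximal ideal of a place, the \<open>n\<close>-th power of every
    nonunit is a multiple of \<open>q(y)\<close> (\<open>power_in_uniform_multiple\<close>). Hence the place is discrete
    (\<open>valuation_exists\<close>).
  \<^item> If \<open>\<Sum> a\<^sub>i u\<^sup>i = 0\<close>, there are integral elements \<open>b\<^sub>i\<close> with \<open>u b\<^sub>i\<close> integral and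
    \<open>a\<^sub>i = b\<^sub>i - u b\<^sub>i\<^sub>+\<^sub>1\<close> (\<open>integral_quotient_coeffs\<close>). Hence the localization of \<open>A\<close> at a maximal
    ideal is a valuation ring, and every finite place arises in this way
    (\<open>place_of_maximalideal\<close>, \<open>localization\<close>).

  \<^noindent> Elements of \<open>A\<close> separating \<open>n + 1\<close> places above the same irreducible \<open>q\<close> would violate
  linear dependence, which gives the finiteness statements (\<open>finite_places_above\<close>). With these
  facts, a fractional ideal is cut out by the inequalities \<open>v\<^sub>P(z) \<ge> v\<^sub>P(I)\<close>, where \<open>v\<^sub>P(I)\<close> is the
  minimum of \<open>v\<^sub>P\<close> on \<open>I\<close> (\<open>fractional_ideal_mem_iff\<close>), and all exponents of finite support occur
  (\<open>approximation\<close>). Thus fractional ideals form a group isomorphic to the finitely supported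
  integer-valued functions on finite places, and \<open>v\<^sub>P(I)\<close> is the exponent in the factorization
  (\<open>factorization_exponent\<close>). The infinite places are treated by the same lemmas with \<open>y = 1/x\<close>
  instead of \<open>y = x\<close>.
\<close>

section \<open>Subrings of fields and integral closure\<close>

text \<open>
  A subring of a field. It is the same as \<^term>\<open>subring R class_ring\<close>, in the notation of the
  type class.
\<close>

locale field_subring =
  fixes R :: "'K::field set"
  assumes zero_mem [simp, intro]: "0 \<in> R"
    and one_mem [simp, intro]: "1 \<in> R"
    and add_mem [intro]: "a \<in> R \<Longrightarrow> b \<in> R \<Longrightarrow> a + b \<in> R"
    and mult_mem [intro]: "a \<in> R \<Longrightarrow> b \<in> R \<Longrightarrow> a * b \<in> R"
    and uminus_mem [intro]: "a \<in> R \<Longrightarrow> - a \<in> R"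
begin

lemma sum_mem: "(\<And>i. i \<in> I \<Longrightarrow> f i \<in> R) \<Longrightarrow> sum f I \<in> R"
  by (induction I rule: infinite_finite_induct) auto

lemma prod_mem: "(\<And>i. i \<in> I \<Longrightarrow> f i \<in> R) \<Longrightarrow> prod f I \<in> R"
  by (induction I rule: infinite_finite_induct) auto

lemma power_mem: "a \<in> R \<Longrightarrow> a ^ n \<in> R"
  by (induction n) auto

end

lemma field_subring_iff: "field_subring R \<longleftrightarrow> subring R class_ring"
proof
  assume "field_subring R"
  then interpret field_subring R .
  show "subring R class_ring"
    by (rule ring.subringI[OF class_ring.ring_axioms]) (auto simp: class_ring_simps)
next
  assume "subring R class_ring"
  from subringE[OF this] show "field_subring R"
    by unfold_locales (auto simp: class_ring_simps)
qed

text \<open>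
  The \<open>R\<close>-submodule generated by the finite family \<open>g\<close> indexed by \<open>I\<close>.
\<close>

definition lin_span :: "'K::field set \<Rightarrow> ('i \<Rightarrow> 'K) \<Rightarrow> 'i set \<Rightarrow> 'K set" where
  "lin_span R g I = {\<Sum>j\<in>I. c j * g j | c. \<forall>j\<in>I. c j \<in> R}"

context field_subring
begin

lemma lin_span_base:
  assumes "finite I" "i \<in> I"
  shows "g i \<in> lin_span R g I"
proof -
  have "(\<Sum>j\<in>I. (if j = i then 1 else 0) * g j) = (\<Sum>j\<in>I. if j = i then g j else 0)"
    by (rule sum.cong) auto
  then have "g i = (\<Sum>j\<in>I. (if j = i then 1 else 0) * g j)"
    using assms by simp
  then show ?thesis
    unfolding lin_span_def by (intro CollectI exI[of _ "\<lambda>j. if j = i then 1 else 0"]) simp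
qed

lemma lin_span_scale:
  assumes "a \<in> R" "z \<in> lin_span R g I"
  shows "a * z \<in> lin_span R g I"
proof -
  obtain c where "\<forall>j\<in>I. c j \<in> R" "z = (\<Sum>j\<in>I. c j * g j)"
    using assms by (auto simp: lin_span_def)
  then show ?thesis
    using assms unfolding lin_span_def
    by (intro CollectI exI[of _ "\<lambda>j. a * c j"]) (auto simp: sum_distrib_left mult.assoc)
qed

lemma lin_span_add:
  assumes "z \<in> lin_span R g I" "w \<in> lin_span R g I"
  shows "z + w \<in> lin_span R g I"
proof -
  obtain c d where "\<forall>j\<in>I. c j \<in> R" "z = (\<Sum>j\<in>I. c j * g j)"
      "\<forall>j\<in>I. d j \<in> R" "w = (\<Sum>j\<in>I. d j * g j)"
    using assms by (auto simp: lin_span_def)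
  then show ?thesis
    unfolding lin_span_def
    by (intro CollectI exI[of _ "\<lambda>j. c j + d j"]) (auto simp: sum.distrib distrib_right)
qed

lemma lin_span_zero: "0 \<in> lin_span R g I"
  unfolding lin_span_def by (intro CollectI exI[of _ "\<lambda>_. 0"]) simp

lemma lin_span_uminus: "z \<in> lin_span R g I \<Longrightarrow> - z \<in> lin_span R g I"
  using lin_span_scale[of "-1" z] by auto

lemma lin_span_sum: "(\<And>j. j \<in> J \<Longrightarrow> f j \<in> lin_span R g I) \<Longrightarrow> sum f J \<in> lin_span R g I"
  by (induction J rule: infinite_finite_induct) (auto intro: lin_span_add lin_span_zero)

lemma lin_span_stable:
  assumes "\<And>i. i \<in> I \<Longrightarrow> z * g i \<in> lin_span R g I" "w \<in> lin_span R g I"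
  shows "z * w \<in> lin_span R g I"
proof -
  obtain c where c: "\<forall>j\<in>I. c j \<in> R" "w = (\<Sum>j\<in>I. c j * g j)"
    using assms by (auto simp: lin_span_def)
  have "z * w = (\<Sum>j\<in>I. c j * (z * g j))"
    by (simp add: c sum_distrib_left algebra_simps)
  also have "\<dots> \<in> lin_span R g I"
  proof (rule lin_span_sum)
    fix j assume "j \<in> I"
    then show "c j * (z * g j) \<in> lin_span R g I" using assms(1) c by (auto intro!: lin_span_scale[of "c j"])
  qed
  finally show ?thesis .
qed

lemma coeffs_det_mem:
  fixes M :: "'K poly mat"
  assumes M: "M \<in> carrier_mat n n" and c: "\<And>i j. i < n \<Longrightarrow> j < n \<Longrightarrow> \<forall>l. coeff (M $$ (i,j)) l \<in> R"
  shows "coeff (det M) l \<in> R"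
proof -
  define S where "S = {p. \<forall>l. coeff p l \<in> R}"
  have S0: "0 \<in> S" "1 \<in> S" by (auto simp: S_def coeff_pCons one_pCons split: nat.splits)
  have Sa: "p + q \<in> S" if "p \<in> S" "q \<in> S" for p q using that by (auto simp: S_def)
  have Su: "- p \<in> S" if "p \<in> S" for p using that by (auto simp: S_def)
  have Sm: "p * q \<in> S" if "p \<in> S" "q \<in> S" for p q
    using that by (auto simp: S_def coeff_mult intro!: sum_mem)
  have Sprod: "prod f J \<in> S" if "\<And>j. j \<in> J \<Longrightarrow> f j \<in> S" for f and J :: "nat set"
    using that by (induction J rule: infinite_finite_induct) (auto intro: Sm S0)
  have Ssum: "sum f J \<in> S" if "\<And>j. j \<in> J \<Longrightarrow> f j \<in> S" for f and J :: "(nat \<Rightarrow> nat) set"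
    using that by (induction J rule: infinite_finite_induct) (auto intro: Sa S0)
  have "det M \<in> S"
    unfolding det_def'[OF M]
  proof (intro Ssum Sm Sprod)
    fix p :: "nat \<Rightarrow> nat"
    assume p: "p \<in> {p. p permutes {0..<n}}"
    show "signof p \<in> S" by (auto simp: sign_def intro: Su S0)
    fix i assume "i \<in> {0..<n}"
    then show "M $$ (i, p i) \<in> S" using p c permutes_in_image[of p "{0..<n}" i] by (auto simp: S_def)
  qed
  then show ?thesis by (simp add: S_def)
qed

lemma char_poly_coeffs_mem:
  assumes M: "M \<in> carrier_mat n n" and c: "\<And>i j. i < n \<Longrightarrow> j < n \<Longrightarrow> M $$ (i,j) \<in> R"
  shows "coeff (char_poly M) l \<in> R"
  unfolding char_poly_def
proof (rule coeffs_det_mem)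
  show "char_poly_matrix M \<in> carrier_mat n n" using M by simp
  fix i j assume "i < n" "j < n"
  then show "\<forall>l. coeff (char_poly_matrix M $$ (i,j)) l \<in> R"
    using M c[of i j]
    by (auto simp: char_poly_matrix_def coeff_pCons split: nat.splits)
qed

text \<open>
  If multiplication by \<open>z\<close> maps a nonzero finitely generated module into itself, then \<open>z\<close> is an
  eigenvalue of a matrix over \<open>R\<close>, hence a root of its characteristic polynomial.
\<close>

lemma integral_if_stable:
  assumes fin: "finite I" and nz: "\<exists>i\<in>I. g i \<noteq> 0"
    and st: "\<And>i. i \<in> I \<Longrightarrow> z * g i \<in> lin_span R g I"
  shows "z \<in> integral_closure R"
proof -
  define n where "n = card I"
  obtain h where h: "bij_betw h {0..<n} I"
    using ex_bij_betw_nat_finite[OF fin] n_def by blast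
  have "\<forall>i\<in>I. \<exists>c. (\<forall>j\<in>I. c j \<in> R) \<and> z * g i = (\<Sum>j\<in>I. c j * g j)"
    using st by (auto simp: lin_span_def)
  then obtain c where c: "\<And>i j. i \<in> I \<Longrightarrow> j \<in> I \<Longrightarrow> c i j \<in> R"
      "\<And>i. i \<in> I \<Longrightarrow> z * g i = (\<Sum>j\<in>I. c i j * g j)"
    by metis
  define M where "M = mat n n (\<lambda>(i,j). c (h i) (h j))"
  define v where "v = vec n (\<lambda>i. g (h i))"
  have hI: "h i \<in> I" if "i < n" for i using h that by (auto simp: bij_betw_def)
  have M: "M \<in> carrier_mat n n" by (simp add: M_def)
  obtain i where i: "i < n" "g (h i) \<noteq> 0"
    using nz h by (force simp: bij_betw_def)
  have "v \<noteq> 0\<^sub>v n"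
  proof
    assume "v = 0\<^sub>v n"
    then have "v $ i = 0\<^sub>v n $ i" by simp
    with i show False by (simp add: v_def)
  qed
  moreover have "M *\<^sub>v v = z \<cdot>\<^sub>v v"
  proof (rule eq_vecI)
    show "dim_vec (M *\<^sub>v v) = dim_vec (z \<cdot>\<^sub>v v)" by (simp add: M_def v_def)
    fix i assume "i < dim_vec (z \<cdot>\<^sub>v v)"
    then have i: "i < n" by (simp add: v_def)
    have "(M *\<^sub>v v) $ i = (\<Sum>j = 0..<n. c (h i) (h j) * g (h j))"
      using i by (simp add: M_def v_def scalar_prod_def)
    also have "\<dots> = (\<Sum>j\<in>I. c (h i) j * g j)"
      by (rule sum.reindex_bij_betw[OF h])
    also have "\<dots> = (z \<cdot>\<^sub>v v) $ i" using c(2)[of "h i"] hI i by (simp add: v_def)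
    finally show "(M *\<^sub>v v) $ i = (z \<cdot>\<^sub>v v) $ i" .
  qed
  ultimately have "eigenvalue M z"
    unfolding eigenvalue_def eigenvector_def using M by (intro exI[of _ v]) (auto simp: v_def)
  then have "poly (char_poly M) z = 0"
    using eigenvalue_root_char_poly[OF M] by blast
  moreover have "lead_coeff (char_poly M) = 1"
    using degree_monic_char_poly[OF M] by simp
  moreover have "coeff (char_poly M) l \<in> R" for l
    by (rule char_poly_coeffs_mem[OF M]) (auto simp: M_def intro: c hI)
  ultimately show ?thesis unfolding integral_closure_def by blast
qed

lemma subset_integral_closure: "R \<subseteq> integral_closure R"
proof
  fix a assume "a \<in> R"
  then show "a \<in> integral_closure R"
    unfolding integral_closure_def
    by (intro CollectI exI[of _ "[:- a, 1:]"]) (auto simp: coeff_pCons split: nat.splits)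
qed

lemma integral_power_reduce:
  assumes "z \<in> integral_closure R"
  obtains n a where "0 < n" "\<And>i. a i \<in> R" "z ^ n = (\<Sum>i<n. a i * z ^ i)"
proof -
  obtain p where p: "lead_coeff p = 1" "\<And>i. coeff p i \<in> R" "poly p z = 0"
    using assms by (auto simp: integral_closure_def)
  define n where "n = degree p"
  have "n \<noteq> 0"
  proof
    assume "n = 0"
    then obtain a where "p = [:a:]" by (metis degree_eq_zeroE n_def)
    with p show False by simp
  qed
  have "0 = (\<Sum>i\<le>n. coeff p i * z ^ i)" using p by (simp add: poly_altdef n_def)
  also have "\<dots> = (\<Sum>i<n. coeff p i * z ^ i) + z ^ n"
    using p by (simp add: n_def lessThan_Suc_atMost[symmetric])
  finally have "z ^ n = (\<Sum>i<n. (- coeff p i) * z ^ i)"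
    by (simp add: sum_negf eq_neg_iff_add_eq_0 add.commute)
  then show ?thesis using that[of n "\<lambda>i. - coeff p i"] \<open>n \<noteq> 0\<close> p by auto
qed

lemma integral_closure_add_mult:
  assumes "z \<in> integral_closure R" "w \<in> integral_closure R"
  shows "z + w \<in> integral_closure R \<and> z * w \<in> integral_closure R"
proof -
  obtain n a where a: "0 < n" "\<And>i. a i \<in> R" "z ^ n = (\<Sum>i<n. a i * z ^ i)"
    using integral_power_reduce[OF assms(1)] by metis
  obtain m b where b: "0 < m" "\<And>i. b i \<in> R" "w ^ m = (\<Sum>i<m. b i * w ^ i)"
    using integral_power_reduce[OF assms(2)] by metis
  define I where "I = {..<n} \<times> {..<m}"
  define g where "g = (\<lambda>(i::nat, j::nat). z ^ i * w ^ j)"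
  let ?S = "lin_span R g I"
  have fin: "finite I" by (simp add: I_def)
  have base: "z ^ i * w ^ j \<in> ?S" if "i < n" "j < m" for i j
    using lin_span_base[OF fin, of "(i,j)" g] that by (simp add: I_def g_def)
  have sz: "z * g i \<in> ?S" if iI: "i \<in> I" for i
  proof -
    obtain k j where kj: "i = (k,j)" "k < n" "j < m" using iI by (auto simp: I_def)
    show ?thesis
    proof (cases "Suc k < n")
      case True
      then show ?thesis using base[of "Suc k" j] kj by (simp add: g_def mult.assoc)
    next
      case False
      then have "n = Suc k" using kj by simp
      then have "z * g i = z ^ n * w ^ j" by (simp add: g_def kj mult.assoc)
      also have "\<dots> = (\<Sum>l<n. a l * (z ^ l * w ^ j))"
        by (simp add: a(3) sum_distrib_right mult.assoc)
      also have "\<dots> \<in> ?S"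
      proof (rule lin_span_sum)
        fix l assume "l \<in> {..<n}"
        then show "a l * (z ^ l * w ^ j) \<in> ?S" using kj by (intro lin_span_scale[OF a(2)] base) auto
      qed
      finally show ?thesis .
    qed
  qed
  have sw: "w * g i \<in> ?S" if iI: "i \<in> I" for i
  proof -
    obtain k j where kj: "i = (k,j)" "k < n" "j < m" using iI by (auto simp: I_def)
    show ?thesis
    proof (cases "Suc j < m")
      case True
      then show ?thesis using base[of k "Suc j"] kj by (simp add: g_def mult_ac)
    next
      case False
      then have "m = Suc j" using kj by simp
      then have "w * g i = z ^ k * w ^ m" by (simp add: g_def kj mult_ac)
      also have "\<dots> = (\<Sum>l<m. b l * (z ^ k * w ^ l))"
        by (simp add: b(3) sum_distrib_left mult_ac)
      also have "\<dots> \<in> ?S"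
      proof (rule lin_span_sum)
        fix l assume "l \<in> {..<m}"
        then show "b l * (z ^ k * w ^ l) \<in> ?S" using kj by (intro lin_span_scale[OF b(2)] base) auto
      qed
      finally show ?thesis .
    qed
  qed
  have nz: "\<exists>i\<in>I. g i \<noteq> 0"
    using a b by (intro bexI[of _ "(0,0)"]) (auto simp: I_def g_def)
  have "z + w \<in> integral_closure R"
    using sz sw by (intro integral_if_stable[OF fin nz]) (auto simp: distrib_right intro: lin_span_add)
  moreover have "z * w \<in> integral_closure R"
    using sz sw by (intro integral_if_stable[OF fin nz]) (auto simp: mult.assoc intro: lin_span_stable)
  ultimately show ?thesis by blast
qed

lemma field_subring_integral_closure: "field_subring (integral_closure R)"
proof
  have R: "a \<in> R \<Longrightarrow> a \<in> integral_closure R" for a using subset_integral_closure by blast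
  show "0 \<in> integral_closure R" "1 \<in> integral_closure R" by (auto intro: R)
  fix a b assume "a \<in> integral_closure R"
  moreover have "- 1 \<in> integral_closure R" by (auto intro: R)
  ultimately show "- a \<in> integral_closure R" using integral_closure_add_mult[of "-1" a] by auto
qed (use integral_closure_add_mult in auto)

text \<open>
  Coefficients of the quotient of a relation by \<open>T - u\<close>, in the manner of Horner's scheme. They and
  their multiples by \<open>u\<close> are integral because multiplication by them preserves the module
  generated by \<open>1, u, \<dots>, u\<^sup>n\<^sup>-\<^sup>1\<close>.
\<close>

lemma integral_quotient_coeffs:
  assumes a: "\<And>i. i \<le> n \<Longrightarrow> a i \<in> R" and rel: "(\<Sum>i\<le>n. a i * u ^ i) = 0"
  obtains b where "\<And>i. b i \<in> integral_closure R" "\<And>i. u * b i \<in> integral_closure R"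
    "\<And>i. i \<le> n \<Longrightarrow> a i = b i - u * b (Suc i)"
proof -
  define b where "b i = (if i = 0 then 0 else \<Sum>j = i..n. a j * u ^ (j - i))" for i
  interpret IC: field_subring "integral_closure R" by (rule field_subring_integral_closure)
  have step: "(\<Sum>j = i..n. a j * u ^ (j - i)) = a i + u * (\<Sum>j = Suc i..n. a j * u ^ (j - Suc i))"
    if "i \<le> n" for i
  proof -
    have "(\<Sum>j = i..n. a j * u ^ (j - i)) = a i + (\<Sum>j = Suc i..n. a j * u ^ (j - i))"
      using that by (simp add: sum.atLeast_Suc_atMost)
    also have "(\<Sum>j = Suc i..n. a j * u ^ (j - i)) = u * (\<Sum>j = Suc i..n. a j * u ^ (j - Suc i))"
      unfolding sum_distrib_left
    proof (rule sum.cong)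
      fix j assume "j \<in> {Suc i..n}"
      then have "j - i = Suc (j - Suc i)" by auto
      then show "a j * u ^ (j - i) = u * (a j * u ^ (j - Suc i))" by simp
    qed simp
    finally show ?thesis .
  qed
  have eq: "a i = b i - u * b (Suc i)" if "i \<le> n" for i
    using step[OF that] rel by (cases i) (simp_all add: b_def atLeast0AtMost eq_neg_iff_add_eq_0)
  have mem: "b i \<in> integral_closure R \<and> u * b i \<in> integral_closure R" for i
  proof (cases "1 \<le> i \<and> i \<le> n")
    case False
    then have "b i = 0" by (auto simp: b_def)
    then show ?thesis by auto
  next
    case True
    let ?S = "lin_span R (\<lambda>k. u ^ k) {..<n}"
    have base: "u ^ k \<in> ?S" if "k < n" for k
      using lin_span_base[of "{..<n}" k "\<lambda>k. u ^ k"] that by simp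
    have st: "b i * u ^ k \<in> ?S" if k: "k \<le> n" for k
    proof (cases "k < i")
      case True
      have "b i * u ^ k = (\<Sum>j = i..n. a j * u ^ (j - i + k))"
        using True by (auto simp: b_def sum_distrib_right power_add mult.assoc simp del: add_diff_assoc2 add_diff_assoc intro!: sum.cong)
      also have "\<dots> \<in> ?S"
      proof (rule lin_span_sum)
        fix j assume "j \<in> {i..n}"
        then show "a j * u ^ (j - i + k) \<in> ?S" using True by (intro lin_span_scale[OF a] base) auto
      qed
      finally show ?thesis .
    next
      case False
      \<comment> \<open>The relation is used to replace high powers of \<open>u\<close> by low ones.\<close>
      have "0 = (\<Sum>j\<le>n. a j * u ^ j)" using rel by simp
      also have "{..n} = {..<i} \<union> {i..n}" using True by auto
      also have "(\<Sum>j\<in>{..<i} \<union> {i..n}. a j * u ^ j) = (\<Sum>j<i. a j * u ^ j) + (\<Sum>j=i..n. a j * u ^ j)"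
        by (rule sum.union_disjoint) auto
      also have "(\<Sum>j=i..n. a j * u ^ j) = b i * u ^ i"
        using True by (auto simp: b_def sum_distrib_right mult.assoc simp flip: power_add)
      finally have bi: "b i * u ^ i = - (\<Sum>j<i. a j * u ^ j)"
        by (simp add: eq_neg_iff_add_eq_0 add.commute)
      have "b i * u ^ k = b i * u ^ i * u ^ (k - i)"
        using False by (simp add: mult.assoc flip: power_add)
      also have "\<dots> = - (\<Sum>j<i. a j * u ^ (j + (k - i)))"
        unfolding bi by (simp add: sum_distrib_right power_add mult.assoc)
      also have "\<dots> \<in> ?S"
      proof (intro lin_span_uminus lin_span_sum)
        fix j assume "j \<in> {..<i}"
        then show "a j * u ^ (j + (k - i)) \<in> ?S"
          using False True k by (intro lin_span_scale[OF a] base) auto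
      qed
      finally show ?thesis .
    qed
    have nz: "\<exists>k\<in>{..<n}. u ^ k \<noteq> 0" using True by (intro bexI[of _ 0]) auto
    have "b i \<in> integral_closure R"
      using st by (intro integral_if_stable[OF _ nz]) auto
    moreover have "u * b i \<in> integral_closure R"
      using st[of "Suc _"] by (intro integral_if_stable[OF _ nz]) (auto simp: mult_ac)
    ultimately show ?thesis by blast
  qed
  from that[of b] mem eq show ?thesis by blast
qed

end

section \<open>Valuation rings\<close>

text \<open>
  A valuation ring of a field, other than the field itself. Its maximal ideal is
  \<^term>\<open>max_ideal P\<close>.
\<close>

locale valuation_subring = field_subring P for P :: "'K::field set" +
  assumes total: "z \<in> P \<or> inverse z \<in> P"
    and proper: "P \<noteq> UNIV"
begin

lemma max_ideal_subset: "z \<in> max_ideal P \<Longrightarrow> z \<in> P"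
  by (simp add: max_ideal_def)

lemma zero_mem_max [simp]: "0 \<in> max_ideal P"
  by (simp add: max_ideal_def)

lemma one_notin_max [simp]: "1 \<notin> max_ideal P"
  by (simp add: max_ideal_def)

lemma inverse_mem_max: "z \<notin> P \<Longrightarrow> inverse z \<in> max_ideal P"
  using total[of z] by (auto simp: max_ideal_def)

lemma unit_inverse_mem: "z \<in> P \<Longrightarrow> z \<notin> max_ideal P \<Longrightarrow> inverse z \<in> P"
  by (auto simp: max_ideal_def)

lemma max_inverse_notin: "z \<in> max_ideal P \<Longrightarrow> z \<noteq> 0 \<Longrightarrow> inverse z \<notin> P"
  by (auto simp: max_ideal_def)

lemma max_mult: 
  assumes "z \<in> max_ideal P" "w \<in> P" shows "z * w \<in> max_ideal P"
proof (rule ccontr)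
  assume n: "z * w \<notin> max_ideal P"
  have "z * w \<in> P" using assms max_ideal_subset by blast
  with n have "inverse (z * w) \<in> P" "z * w \<noteq> 0" by (auto simp: max_ideal_def)
  then have "w * inverse (z * w) \<in> P" using assms by blast
  moreover have "w * inverse (z * w) = inverse z" using \<open>z * w \<noteq> 0\<close> by (simp add: field_simps)
  ultimately have "inverse z \<in> P" by metis
  then show False using assms(1) \<open>z * w \<noteq> 0\<close> by (auto simp: max_ideal_def)
qed

lemma max_mult': "z \<in> P \<Longrightarrow> w \<in> max_ideal P \<Longrightarrow> z * w \<in> max_ideal P"
  using max_mult[of w z] by (simp add: mult.commute)

lemma max_uminus: "z \<in> max_ideal P \<Longrightarrow> - z \<in> max_ideal P"
  using max_mult[of z "-1"] by auto

lemma max_add: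
  assumes "z \<in> max_ideal P" "w \<in> max_ideal P" shows "z + w \<in> max_ideal P"
proof -
  have *: "a + b \<in> max_ideal P" if "a \<in> max_ideal P" "b \<noteq> 0" "b \<in> max_ideal P" "a / b \<in> P" for a b
  proof -
    have "b * (a / b + 1) \<in> max_ideal P" using that by (intro max_mult) auto
    moreover have "b * (a / b + 1) = a + b" using that by (simp add: distrib_left)
    ultimately show ?thesis by simp
  qed
  show ?thesis
  proof (cases "z = 0 \<or> w = 0")
    case False
    then show ?thesis
      using total[of "z / w"] *[of z w] *[of w z] assms by (auto simp: field_simps add.commute)
  qed (use assms in auto)
qed

lemma max_diff: "z \<in> max_ideal P \<Longrightarrow> w \<in> max_ideal P \<Longrightarrow> z - w \<in> max_ideal P"
  using max_add[of z "- w"] max_uminus by simp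

lemma max_sum: "(\<And>i. i \<in> I \<Longrightarrow> f i \<in> max_ideal P) \<Longrightarrow> sum f I \<in> max_ideal P"
  by (induction I rule: infinite_finite_induct) (auto intro: max_add)

lemma max_prime:
  assumes "z \<in> P" "w \<in> P" "z * w \<in> max_ideal P"
  shows "z \<in> max_ideal P \<or> w \<in> max_ideal P"
proof (rule ccontr)
  assume n: "\<not> ?thesis"
  then have "inverse z \<in> P" "z \<noteq> 0" using assms by (auto simp: max_ideal_def)
  then have "inverse z * (z * w) \<in> max_ideal P" using assms max_mult' by blast
  moreover have "inverse z * (z * w) = w" using \<open>z \<noteq> 0\<close> by (simp flip: mult.assoc)
  ultimately show False using n by metis
qed

lemma notin_max_prod:
  assumes "finite I" "\<And>i. i \<in> I \<Longrightarrow> f i \<in> P \<and> f i \<notin> max_ideal P"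
  shows "prod f I \<in> P \<and> prod f I \<notin> max_ideal P"
  using assms by (induction I) (use max_prime in auto)

text \<open>Valuation rings are integrally closed.\<close>

lemma integral_closure_subset:
  assumes "R \<subseteq> P" shows "integral_closure R \<subseteq> P"
proof
  fix u assume "u \<in> integral_closure R"
  then obtain p where p: "lead_coeff p = 1" "\<And>i. coeff p i \<in> R" "poly p u = 0"
    by (auto simp: integral_closure_def)
  show "u \<in> P"
  proof (rule ccontr)
    assume "u \<notin> P"
    then have u: "inverse u \<in> max_ideal P" "u \<noteq> 0" using inverse_mem_max by auto
    define n where "n = degree p"
    have "0 = inverse u ^ n * (\<Sum>i\<le>n. coeff p i * u ^ i)" using p by (simp add: poly_altdef n_def)
    also have "\<dots> = (\<Sum>i\<le>n. coeff p i * inverse u ^ (n - i))"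
      unfolding sum_distrib_left
    proof (rule sum.cong)
      fix i assume "i \<in> {..n}"
      then have "inverse u ^ n = inverse u ^ (n - i) * inverse u ^ i" by (simp flip: power_add)
      then show "inverse u ^ n * (coeff p i * u ^ i) = coeff p i * inverse u ^ (n - i)"
        using u by (simp add: field_simps)
    qed simp
    also have "\<dots> = (\<Sum>i<n. coeff p i * inverse u ^ (n - i)) + 1"
      using p by (simp add: n_def lessThan_Suc_atMost[symmetric])
    finally have "- 1 = (\<Sum>i<n. coeff p i * inverse u ^ (n - i))"
      by (metis add.commute add_eq_0_iff2 minus_unique)
    also have "\<dots> \<in> max_ideal P"
    proof (rule max_sum)
      fix i assume "i \<in> {..<n}"
      then have "inverse u ^ (n - i) = inverse u * inverse u ^ (n - Suc i)"
        by (simp add: Suc_diff_Suc flip: power_Suc)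
      then have "inverse u ^ (n - i) \<in> max_ideal P"
        using u max_mult power_mem max_ideal_subset by metis
      then show "coeff p i * inverse u ^ (n - i) \<in> max_ideal P"
        using p assms by (intro max_mult') auto
    qed
    finally show False using max_uminus[of "-1"] by simp
  qed
qed

text \<open>
  A valuation ring whose maximal ideal is generated by one element \<open>t\<close>, and in which denominators
  are bounded by powers of \<open>t\<close>, has a normalized discrete valuation: \<open>v z\<close> is the exponent
  \<open>k\<close> for which \<open>z / t\<^sup>k\<close> is a unit.
\<close>

lemma normalized_valuation_exists:
  assumes t: "t \<in> max_ideal P" "t \<noteq> 0"
    and gen: "\<And>u. u \<in> max_ideal P \<Longrightarrow> u / t \<in> P"
    and arch: "\<And>w. \<exists>N. w * t ^ N \<in> P"
  shows "\<exists>v. normalized_valuation P v"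
proof -
  define unit where "unit z \<longleftrightarrow> z \<in> P \<and> z \<notin> max_ideal P" for z
  have unit0: "z \<noteq> 0" if "unit z" for z using that by (auto simp: unit_def)
  have unit_mult: "unit (z * w)" if "unit z" "unit w" for z w
    using that max_prime by (auto simp: unit_def)
  have unit_inv: "unit (inverse z)" if "unit z" for z
  proof -
    have "z \<noteq> 0" "inverse z \<in> P" "inverse (inverse z) \<in> P"
      using that unit_inverse_mem by (auto simp: unit_def)
    then show ?thesis unfolding unit_def by (auto simp: max_ideal_def)
  qed
  have tpos: "t ^ n \<in> max_ideal P" if "n > 0" for n
  proof -
    have "t * t ^ (n - 1) \<in> max_ideal P"
      by (rule max_mult[OF t(1) power_mem[OF max_ideal_subset[OF t(1)]]])
    moreover have "t * t ^ (n - 1) = t ^ n"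
      using that by (simp add: power_eq_if)
    ultimately show ?thesis by simp
  qed
  have tpow: "t powi k \<in> max_ideal P" if "k > 0" for k
    using tpos[of "nat k"] that by (simp add: power_int_def)
  have unit_powi: "k = 0" if "unit (t powi k)" for k
  proof (rule ccontr)
    assume "k \<noteq> 0"
    then consider "k > 0" | "- k > 0" by linarith
    then show False
    proof cases
      case 1 then show False using tpow that by (auto simp: unit_def)
    next
      case 2
      then have "t powi (- k) \<in> max_ideal P" using tpow by blast
      moreover have "unit (t powi (- k))" using unit_inv[OF that] by (simp add: power_int_minus)
      ultimately show False by (auto simp: unit_def)
    qed
  qed
  have ex_nonneg: "\<exists>k. 0 \<le> k \<and> unit (z * t powi (- k))" if "z \<in> P" "z \<noteq> 0" for z
  proof -
    have "\<exists>N. z / t ^ N \<notin> P"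
    proof (rule ccontr)
      assume "\<nexists>N. z / t ^ N \<notin> P"
      then have all: "z / t ^ N \<in> P" for N by blast
      obtain N where "inverse (z * t) * t ^ N \<in> P" using arch by blast
      then have "inverse (z * t) * t ^ N * (z / t ^ N) \<in> P" using all by blast
      then have "inverse t \<in> P" using that t by (simp add: field_simps)
      then show False using max_inverse_notin t by blast
    qed
    then obtain N where N: "z / t ^ N \<notin> P" "\<And>M. M < N \<Longrightarrow> z / t ^ M \<in> P"
      using exists_least_iff[of "\<lambda>N. z / t ^ N \<notin> P"] by blast
    have "N \<noteq> 0" using N(1) that(1) by (metis div_by_1 power_0)
    then obtain M where M: "N = Suc M" using not0_implies_Suc by blast
    have "z / t ^ M \<in> P" by (rule N(2)) (simp add: M)
    moreover have "z / t ^ M \<notin> max_ideal P"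
      using gen[of "z / t ^ M"] N(1) by (auto simp: M mult.commute)
    ultimately have "unit (z * t powi (- int M))"
      by (simp add: unit_def power_int_minus divide_inverse)
    then show ?thesis by (intro exI[of _ "int M"]) simp
  qed
  have ex: "\<exists>k. unit (z * t powi (- k))" if "z \<noteq> 0" for z
  proof -
    obtain N where N: "z * t ^ N \<in> P" using arch by blast
    moreover have "z * t ^ N \<noteq> 0" using that t(2) by simp
    ultimately obtain k where "unit (z * t ^ N * t powi (- k))"
      using ex_nonneg by blast
    also have "z * t ^ N * t powi (- k) = z * t powi (- (k - int N))"
      using t by (simp add: power_int_diff power_int_minus field_simps)
    finally show ?thesis by blast
  qed
  define v where "v z = (if z = 0 then 0 else SOME k. unit (z * t powi (- k)))" for z
  have v: "unit (z * t powi (- v z))" if "z \<noteq> 0" for z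
    using someI_ex[OF ex[OF that]] that by (simp add: v_def)
  have v_unique: "v z = k" if "unit (z * t powi (- k))" for z k
  proof -
    have z: "z \<noteq> 0" using that by (auto simp: unit_def)
    have "unit (z * t powi (- v z) * inverse (z * t powi (- k)))"
      using v[OF z] that unit_mult unit_inv by blast
    also have "z * t powi (- v z) * inverse (z * t powi (- k)) = t powi (k - v z)"
      using z t by (simp add: power_int_minus power_int_diff field_simps)
    finally show ?thesis using unit_powi by fastforce
  qed
  have v_pos: "0 \<le> v z" if "z \<in> P" "z \<noteq> 0" for z
    using ex_nonneg[OF that] v_unique by auto
  have memP: "z \<in> P" if "0 \<le> v z" "z \<noteq> 0" for z
  proof -
    have "z * t powi (- v z) * t ^ nat (v z) \<in> P"
      using v[OF that(2)] t max_ideal_subset power_mem by (auto simp: unit_def)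
    moreover have "t ^ nat (v z) = t powi (v z)" using that by (simp add: power_int_def)
    ultimately show ?thesis using t by (simp add: power_int_minus field_simps)
  qed
  have v_mult: "v (a * b) = v a + v b" if "a \<noteq> 0" "b \<noteq> 0" for a b
  proof (rule v_unique)
    have "unit (a * t powi (- v a) * (b * t powi (- v b)))"
      using unit_mult v that by blast
    also have "a * t powi (- v a) * (b * t powi (- v b)) = a * b * t powi (- (v a + v b))"
      using t power_int_add[of t "- v a" "- v b"] by (simp add: algebra_simps)
    finally show "unit (a * b * t powi (- (v a + v b)))" .
  qed
  have v_t: "v (t powi k) = k" for k
    using t by (intro v_unique) (simp add: unit_def power_int_minus)
  \<comment> \<open>Factoring out the summand of smaller valuation reduces to \<open>a / b + 1\<close>, an element of \<open>P\<close>.\<close>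
  have add: "v b \<le> v (a + b)" if "a \<noteq> 0" "b \<noteq> 0" "a + b \<noteq> 0" "v b \<le> v a" for a b
  proof -
    have "v (a / b) = v a - v b"
      using v_mult[of "a / b" b] that by simp
    then have "a / b \<in> P" using that by (intro memP) auto
    then have "a / b + 1 \<in> P" by auto
    moreover have "a / b + 1 \<noteq> 0" using that by (simp add: field_simps)
    ultimately have "0 \<le> v (a / b + 1)" by (rule v_pos)
    moreover have "v (b * (a / b + 1)) = v b + v (a / b + 1)"
      using v_mult that \<open>a / b + 1 \<noteq> 0\<close> by blast
    moreover have "b * (a / b + 1) = a + b" using that by (simp add: field_simps)
    ultimately show ?thesis by simp
  qed
  have "normalized_valuation P v"
    unfolding normalized_valuation_def
  proof (intro conjI allI impI)
    show "v 0 = 0" by (simp add: v_def)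
    show "v (a * b) = v a + v b" if "a \<noteq> 0" "b \<noteq> 0" for a b using that by (rule v_mult)
    show "min (v a) (v b) \<le> v (a + b)" if "a \<noteq> 0" "b \<noteq> 0" "a + b \<noteq> 0" for a b
      using add[of a b] add[of b a] that by (auto simp: add.commute min_def)
    show "v ` (UNIV - {0}) = UNIV"
    proof -
      have "k \<in> v ` (UNIV - {0})" for k
        using v_t[of k] t by (intro image_eqI[of _ _ "t powi k"]) auto
      then show ?thesis by auto
    qed
    show "P = {z. z = 0 \<or> 0 \<le> v z}" using memP v_pos by auto
  qed
  then show ?thesis by blast
qed

end

lemma normalized_valuation_unique:
  assumes v: "normalized_valuation P v" and w: "normalized_valuation P w"
  shows "v = w"
proof
  have vm: "v (a * b) = v a + v b" and wm: "w (a * b) = w a + w b" if "a \<noteq> 0" "b \<noteq> 0" for a b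
    using v w that by (auto simp: normalized_valuation_def)
  have iff: "0 \<le> v z \<longleftrightarrow> 0 \<le> w z" if "z \<noteq> 0" for z
    using v w that unfolding normalized_valuation_def by blast
  have vinv: "v (inverse z) = - v z" "w (inverse z) = - w z" if "z \<noteq> 0" for z
    using vm[of z "inverse z"] wm[of z "inverse z"] vm[of 1 1] wm[of 1 1] that by auto
  have vzero: "v z = 0 \<longleftrightarrow> w z = 0" if "z \<noteq> 0" for z
    using iff[of z] iff[of "inverse z"] vinv[of z] that by auto
  have pv: "v (t ^ n) = int n * v t" "w (t ^ n) = int n * w t" if "t \<noteq> 0" for t n
    using that vm[of 1 1] wm[of 1 1] by (induction n) (auto simp: vm wm algebra_simps)
  have powi: "v (t powi k) = k * v t" "w (t powi k) = k * w t" if "t \<noteq> 0" for t k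
    using that pv[of t "nat k"] pv[of "inverse t" "nat (- k)"] vinv[of t] by (auto simp: power_int_def)
  have "\<exists>t. t \<noteq> 0 \<and> v t = 1" "\<exists>t. t \<noteq> 0 \<and> w t = 1"
  proof -
    have "1 \<in> v ` (UNIV - {0})" "1 \<in> w ` (UNIV - {0})"
      using v w unfolding normalized_valuation_def by blast+
    then show "\<exists>t. t \<noteq> 0 \<and> v t = 1" "\<exists>t. t \<noteq> 0 \<and> w t = 1" by auto
  qed
  then obtain t s where t: "t \<noteq> 0" "v t = 1" and s: "s \<noteq> 0" "w s = 1" by blast
  have wz: "w z = v z * w t" if "z \<noteq> 0" for z
  proof -
    have "v (z * t powi (- v z)) = 0" using that t powi[of t] by (simp add: vm)
    then have "w (z * t powi (- v z)) = 0" using that t vzero[of "z * t powi (- v z)"] by simp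
    then show ?thesis using that t powi(2)[of t] by (simp add: wm)
  qed
  have "1 = v s * w t" using wz[of s] s by simp
  moreover have "0 \<le> w t" using iff[of t] t by simp
  ultimately have "w t = 1" by (metis pos_zmult_eq_1_iff_lemma zmult_eq_1_iff neg_0_le_iff_le not_one_le_zero)
  fix z
  show "v z = w z"
  proof (cases "z = 0")
    case True
    then show ?thesis using v w by (simp add: normalized_valuation_def)
  next
    case False
    then show ?thesis using wz \<open>w t = 1\<close> by simp
  qed
qed

lemma normalized_valuation_val:
  assumes "\<exists>v. normalized_valuation P v"
  shows "normalized_valuation P (val P)"
  unfolding val_def using assms normalized_valuation_unique by (metis theI)

lemma place_valuation_subring:
  assumes "P \<in> places \<iota>" shows "valuation_subring P"
proof -
  interpret field_subring P using assms by (simp add: field_subring_iff places_def)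
  show ?thesis using assms by unfold_locales (auto simp: places_def)
qed

section \<open>Linear dependence and places\<close>

text \<open>
  An embedding \<open>\<phi>\<close> of a polynomial ring \<open>k[y]\<close> into the finite extension, identical to \<open>\<iota>\<close> on
  constants and with fraction field \<open>k(x)\<close>. The cases of interest are \<open>y = x\<close> and \<open>y = 1/x\<close>.
\<close>

locale affine_chart = hom_i: field_hom \<iota> + phi: inj_comm_ring_hom \<phi>
  for \<iota> :: "'k::field poly fract \<Rightarrow> 'K::field" and \<phi> :: "'k poly \<Rightarrow> 'K" +
  assumes finite_ext: "finite_extension \<iota>"
    and phi_const: "\<phi> [:c:] = \<iota> (to_fract [:c:])"
    and phi_frac: "\<exists>a b. b \<noteq> 0 \<and> \<phi> b * \<iota> f = \<phi> a"
begin

text \<open>Elements of the extension satisfy linear relations of bounded length.\<close>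

lemma iota_dependence:
  obtains n where "\<And>z :: nat \<Rightarrow> 'K. \<exists>c. (\<exists>i\<le>n. c i \<noteq> 0) \<and> (\<Sum>i\<le>n. \<iota> (c i) * z i) = 0"
proof -
  interpret V: vector_space "\<lambda>c x. \<iota> c * x"
    by unfold_locales (auto simp: hom_i.hom_add hom_i.hom_mult algebra_simps)
  obtain B where B: "finite B" "\<And>y. \<exists>c. y = (\<Sum>b\<in>B. \<iota> (c b) * b)"
    using finite_ext by (auto simp: finite_extension_def)
  have span: "y \<in> V.span B" for y
  proof -
    obtain c where "y = (\<Sum>b\<in>B. \<iota> (c b) * b)" using B by blast
    then show ?thesis by (simp add: V.span_sum V.span_scale V.span_base)
  qed
  have "\<exists>c. (\<exists>i\<le>card B. c i \<noteq> 0) \<and> (\<Sum>i\<le>card B. \<iota> (c i) * z i) = 0" for z :: "nat \<Rightarrow> 'K"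
  proof (cases "inj_on z {..card B}")
    case True
    let ?S = "z ` {..card B}"
    have "\<not> card ?S \<le> card B" using True by (simp add: card_image)
    then have "V.dependent ?S"
      using V.independent_span_bound[OF B(1), of ?S] span by auto
    then obtain u where u: "\<exists>v\<in>?S. u v \<noteq> 0" "(\<Sum>v\<in>?S. \<iota> (u v) * v) = 0"
      using V.dependent_finite[of ?S] by auto
    then show ?thesis
      by (intro exI[of _ "\<lambda>i. u (z i)"]) (auto simp: sum.reindex[OF True])
  next
    case False
    then obtain i j where ij: "i \<le> card B" "j \<le> card B" "i \<noteq> j" "z i = z j"
      by (auto simp: inj_on_def)
    have "(\<Sum>k\<le>card B. \<iota> (if k = i then 1 else if k = j then - 1 else 0) * z k)
        = (\<Sum>k\<le>card B. (if k = i then z i else 0) - (if k = j then z i else 0))"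
      using ij by (intro sum.cong) (auto simp: hom_i.hom_uminus)
    also have "\<dots> = 0" using ij by (simp add: sum_subtractf)
    finally show ?thesis
      using ij by (intro exI[of _ "\<lambda>k. if k = i then 1 else if k = j then - 1 else 0"]) auto
  qed
  then show ?thesis using that by blast
qed

lemma dependence:
  obtains n where "\<And>z :: nat \<Rightarrow> 'K. \<exists>c. (\<exists>i\<le>n. c i \<noteq> 0) \<and> (\<Sum>i\<le>n. \<phi> (c i) * z i) = 0"
proof -
  obtain n where n: "\<And>z :: nat \<Rightarrow> 'K. \<exists>c. (\<exists>i\<le>n. c i \<noteq> 0) \<and> (\<Sum>i\<le>n. \<iota> (c i) * z i) = 0"
    using iota_dependence by blast
  have "\<exists>c. (\<exists>i\<le>n. c i \<noteq> 0) \<and> (\<Sum>i\<le>n. \<phi> (c i) * z i) = 0" for z :: "nat \<Rightarrow> 'K"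
  proof -
    obtain c where c: "\<exists>i\<le>n. c i \<noteq> 0" "(\<Sum>i\<le>n. \<iota> (c i) * z i) = 0" using n by blast
    have "\<forall>i. \<exists>a b. b \<noteq> 0 \<and> \<phi> b * \<iota> (c i) = \<phi> a" using phi_frac by blast
    then obtain a b where ab: "\<And>i. b i \<noteq> 0" "\<And>i. \<phi> (b i) * \<iota> (c i) = \<phi> (a i)" by metis
    define d where "d i = a i * (\<Prod>j\<in>{..n} - {i}. b j)" for i
    have d: "\<phi> (d i) = \<phi> (\<Prod>j\<le>n. b j) * \<iota> (c i)" if "i \<le> n" for i
    proof -
      have "(\<Prod>j\<le>n. b j) = b i * (\<Prod>j\<in>{..n} - {i}. b j)" using that by (simp add: prod.remove)
      then show ?thesis using ab(2)[of i] by (simp add: d_def phi.hom_mult mult_ac flip: ab(2))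
    qed
    have nz: "\<phi> (\<Prod>j\<le>n. b j) \<noteq> 0" using ab by simp
    have "(\<Sum>i\<le>n. \<phi> (d i) * z i) = \<phi> (\<Prod>j\<le>n. b j) * (\<Sum>i\<le>n. \<iota> (c i) * z i)"
      unfolding sum_distrib_left by (intro sum.cong) (auto simp: d mult_ac)
    moreover have "\<exists>i\<le>n. d i \<noteq> 0"
    proof -
      obtain i where i: "i \<le> n" "c i \<noteq> 0" using c by blast
      then have "\<phi> (d i) \<noteq> 0" using d nz by simp
      then show ?thesis using i by auto
    qed
    ultimately show ?thesis using c by auto
  qed
  then show ?thesis using that by blast
qed

text \<open>Dividing out common factors \<open>q\<close>, the coefficients need not all be divisible by \<open>q\<close>.\<close>

lemma reduced_dependence:
  obtains n where "\<And>(q :: 'k poly) (z :: nat \<Rightarrow> 'K). degree q > 0 \<Longrightarrow>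
    \<exists>c. (\<exists>i\<le>n. \<not> q dvd c i) \<and> (\<Sum>i\<le>n. \<phi> (c i) * z i) = 0"
proof -
  obtain n where n: "\<And>z :: nat \<Rightarrow> 'K. \<exists>c. (\<exists>i\<le>n. c i \<noteq> 0) \<and> (\<Sum>i\<le>n. \<phi> (c i) * z i) = 0"
    using dependence by blast
  have "\<exists>c. (\<exists>i\<le>n. \<not> q dvd c i) \<and> (\<Sum>i\<le>n. \<phi> (c i) * z i) = 0"
    if q: "degree q > 0" for q and z :: "nat \<Rightarrow> 'K"
  proof -
    let ?R = "\<lambda>c. (\<exists>i\<le>n. c i \<noteq> 0) \<and> (\<Sum>i\<le>n. \<phi> (c i) * z i) = 0"
    let ?m = "\<lambda>c :: nat \<Rightarrow> 'k poly. \<Sum>i\<le>n. degree (c i)"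
    obtain c where c: "?R c" "\<And>d. ?R d \<Longrightarrow> ?m c \<le> ?m d"
      using ex_has_least_nat[of ?R _ ?m] n[of z] by blast
    have "\<exists>i\<le>n. \<not> q dvd c i"
    proof (rule ccontr)
      assume "\<not> ?thesis"
      then have "\<forall>i. \<exists>d. i \<le> n \<longrightarrow> c i = q * d" by (auto simp: dvd_def)
      then obtain d where d: "\<And>i. i \<le> n \<Longrightarrow> c i = q * d i" by metis
      have q0: "q \<noteq> 0" using q by auto
      have "(\<Sum>i\<le>n. \<phi> (c i) * z i) = \<phi> q * (\<Sum>i\<le>n. \<phi> (d i) * z i)"
        unfolding sum_distrib_left by (intro sum.cong) (auto simp: d phi.hom_mult mult.assoc)
      then have "?R d" using c d q0 by auto
      then have "?m c \<le> ?m d" using c by blast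
      moreover have "?m d < ?m c"
      proof (rule sum_strict_mono_ex1)
        show "\<forall>i\<in>{..n}. degree (d i) \<le> degree (c i)"
          using d q0 by (metis atMost_iff degree_mult_eq degree_0 le_add2 mult_zero_right order_refl)
        obtain i where i: "i \<le> n" "c i \<noteq> 0" using c by blast
        then have "d i \<noteq> 0" using d by auto
        then show "\<exists>i\<in>{..n}. degree (d i) < degree (c i)"
          using d[OF i(1)] q0 q i by (intro bexI[of _ i]) (auto simp: degree_mult_eq)
      qed simp
      ultimately show False by simp
    qed
    with c show ?thesis by blast
  qed
  then show ?thesis using that by blast
qed

text \<open>
  Every nonzero \<open>w\<close> divides a nonzero element of \<open>k[y]\<close> in \<open>k[y][w]\<close>.
\<close>

lemma nonzero_multiple:
  assumes w: "w \<noteq> 0"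
  obtains a n d where "a \<noteq> 0" "\<phi> a = w * (\<Sum>i\<le>n. \<phi> (d i) * w ^ i)"
proof -
  obtain n where n: "\<And>z :: nat \<Rightarrow> 'K. \<exists>c. (\<exists>i\<le>n. c i \<noteq> 0) \<and> (\<Sum>i\<le>n. \<phi> (c i) * z i) = 0"
    using dependence by blast
  obtain c where c: "\<exists>i\<le>n. c i \<noteq> 0" "(\<Sum>i\<le>n. \<phi> (c i) * w ^ i) = 0"
    using n[of "\<lambda>i. w ^ i"] by blast
  obtain k where k: "k \<le> n" "c k \<noteq> 0" "\<And>i. i < k \<Longrightarrow> c i = 0"
    using exists_least_iff[of "\<lambda>i. i \<le> n \<and> c i \<noteq> 0"] c(1) by (metis less_le_trans less_imp_le)
  define e where "e i = (if k + Suc i \<le> n then - c (k + Suc i) else 0)" for i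
  have "0 = (\<Sum>i\<in>{..n}. \<phi> (c i) * w ^ i)" using c by simp
  also have "\<dots> = (\<Sum>i\<in>{k..n}. \<phi> (c i) * w ^ i)"
    using k by (intro sum.mono_neutral_right) (auto simp: not_le)
  also have "\<dots> = (\<Sum>i\<le>n - k. \<phi> (c (k + i)) * w ^ (k + i))"
    using k(1) sum.shift_bounds_cl_nat_ivl[of "\<lambda>i. \<phi> (c i) * w ^ i" 0 k "n - k"]
    by (simp add: atLeast0AtMost add.commute)
  also have "\<dots> = w ^ k * (\<Sum>i\<le>n - k. \<phi> (c (k + i)) * w ^ i)"
    by (simp add: sum_distrib_left power_add mult_ac)
  finally have "(\<Sum>i\<le>n - k. \<phi> (c (k + i)) * w ^ i) = 0" using w by simp
  moreover have "(\<Sum>i\<le>n. \<phi> (- e i) * w ^ Suc i) = (\<Sum>i<n - k. \<phi> (c (k + Suc i)) * w ^ Suc i)"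
    by (rule sum.mono_neutral_cong_right) (auto simp: e_def)
  moreover have "(\<Sum>i\<le>n - k. \<phi> (c (k + i)) * w ^ i)
      = \<phi> (c k) + (\<Sum>i<n - k. \<phi> (c (k + Suc i)) * w ^ Suc i)"
    by (simp add: sum.atMost_shift)
  ultimately have "\<phi> (c k) = - (\<Sum>i\<le>n. \<phi> (- e i) * w ^ Suc i)"
    by (simp add: eq_neg_iff_add_eq_0)
  also have "\<dots> = w * (\<Sum>i\<le>n. \<phi> (e i) * w ^ i)"
    by (simp add: phi.hom_uminus sum_negf sum_distrib_left mult_ac)
  finally show ?thesis using that[of "c k" e n] k by blast
qed

lemma field_subring_range: "field_subring (range \<phi>)"
proof
  show "0 \<in> range \<phi>" "1 \<in> range \<phi>" using phi.hom_zero phi.hom_one by (metis rangeI)+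
  show "a + b \<in> range \<phi>" "a * b \<in> range \<phi>" if "a \<in> range \<phi>" "b \<in> range \<phi>" for a b
    using that by (auto simp flip: phi.hom_add phi.hom_mult)
  show "- a \<in> range \<phi>" if "a \<in> range \<phi>" for a
    using that by (auto simp flip: phi.hom_uminus)
qed

end

text \<open>A place at which all elements of \<open>k[y]\<close> are regular.\<close>

locale chart_place = affine_chart \<iota> \<phi>
  for \<iota> :: "'k::field poly fract \<Rightarrow> 'K::field" and \<phi> :: "'k poly \<Rightarrow> 'K" +
  fixes P :: "'K set"
  assumes place: "P \<in> places \<iota>" and range_subset: "range \<phi> \<subseteq> P"
begin

sublocale valuation_subring P by (rule place_valuation_subring[OF place])

lemma phi_mem [simp, intro]: "\<phi> a \<in> P"
  using range_subset by blast

lemma nonzero_multiple_mem: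
  obtains a where "a \<noteq> 0" "\<phi> a * w \<in> P"
proof (cases "w \<in> P")
  case True
  then show ?thesis using that[of 1] by simp
next
  case False
  then have iw: "inverse w \<in> P" "w \<noteq> 0" using inverse_mem_max max_ideal_subset by auto
  obtain a n d where a: "a \<noteq> 0" "\<phi> a = inverse w * (\<Sum>i\<le>n. \<phi> (d i) * inverse w ^ i)"
    using nonzero_multiple[of "inverse w"] iw by (metis inverse_nonzero_iff_nonzero)
  have "(\<Sum>i\<le>n. \<phi> (d i) * inverse w ^ i) \<in> P"
    by (rule sum_mem) (intro mult_mem power_mem iw phi_mem)
  moreover have "\<phi> a * w = (\<Sum>i\<le>n. \<phi> (d i) * inverse w ^ i)"
    using a iw by (simp add: field_simps)
  ultimately show ?thesis using that a by metis
qed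

text \<open>
  The contraction of the maximal ideal of a place to \<open>k[y]\<close> is a nonzero principal ideal.
\<close>

lemma max_generator:
  obtains q where "degree q > 0" "\<And>a. \<phi> a \<in> max_ideal P \<longleftrightarrow> q dvd a"
proof -
  obtain w where w: "w \<notin> P" using proper by auto
  then have iw: "inverse w \<in> max_ideal P" "w \<noteq> 0" using inverse_mem_max by auto
  obtain a where a: "a \<noteq> 0" "\<phi> a * w \<in> P" using nonzero_multiple_mem by blast
  have "\<phi> a * w * inverse w \<in> max_ideal P" using a iw max_mult' by blast
  then have "\<phi> a \<in> max_ideal P" using iw(2) by (simp add: mult.assoc)
  with a have "a \<noteq> 0 \<and> \<phi> a \<in> max_ideal P" by blast
  from ex_has_least_nat[of "\<lambda>a. a \<noteq> 0 \<and> \<phi> a \<in> max_ideal P", OF this, of degree]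
  obtain q where q: "q \<noteq> 0" "\<phi> q \<in> max_ideal P"
      "\<And>a. a \<noteq> 0 \<Longrightarrow> \<phi> a \<in> max_ideal P \<Longrightarrow> degree q \<le> degree a"
    by auto
  have deg: "degree q > 0"
  proof (rule ccontr)
    assume "\<not> degree q > 0"
    then obtain c where c: "q = [:c:]" by (metis degree_eq_zeroE gr0I)
    then have "\<phi> q * \<phi> [:inverse c:] = 1"
      using q(1) by (simp flip: phi.hom_mult add: pCons_one)
    moreover have "\<phi> q * \<phi> [:inverse c:] \<in> max_ideal P" using max_mult q(2) by blast
    ultimately show False by simp
  qed
  have "\<phi> a \<in> max_ideal P \<longleftrightarrow> q dvd a" for a
  proof
    assume "q dvd a"
    then show "\<phi> a \<in> max_ideal P" using q(2) max_mult by (auto simp: dvd_def phi.hom_mult)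
  next
    assume a: "\<phi> a \<in> max_ideal P"
    have "a mod q = a - q * (a div q)" by (simp add: minus_mult_div_eq_mod)
    then have "\<phi> (a mod q) = \<phi> a - \<phi> q * \<phi> (a div q)"
      by (simp add: phi.hom_minus phi.hom_mult)
    then have "\<phi> (a mod q) \<in> max_ideal P" using a q(2) max_mult max_diff by auto
    then have "a mod q = 0" using q(3) degree_mod_less[OF q(1), of a] by force
    then show "q dvd a" by (simp add: dvd_eq_mod_eq_0)
  qed
  with deg that show ?thesis by blast
qed

lemma power_multiple:
  assumes q: "degree q > 0" "\<And>a. \<phi> a \<in> max_ideal P \<longleftrightarrow> q dvd a" and "a \<noteq> 0"
  shows "\<exists>k s. s \<in> P \<and> \<phi> a * s = \<phi> q ^ k"
  using \<open>a \<noteq> 0\<close>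
proof (induction "degree a" arbitrary: a rule: less_induct)
  case less
  show ?case
  proof (cases "q dvd a")
    case False
    then have "inverse (\<phi> a) \<in> P" using q unit_inverse_mem by blast
    then show ?thesis using less.prems
      by (intro exI[of _ 0] exI[of _ "inverse (\<phi> a)"]) simp
  next
    case True
    then obtain b where b: "a = q * b" by (auto simp: dvd_def)
    then have "b \<noteq> 0" "degree b < degree a" using less.prems q(1) by (auto simp: degree_mult_eq)
    then obtain k s where "s \<in> P" "\<phi> b * s = \<phi> q ^ k" using less.hyps by blast
    then show ?thesis
      by (intro exI[of _ "Suc k"] exI[of _ s]) (simp add: b phi.hom_mult mult.assoc)
  qed
qed

text \<open>
  The exponent \<open>n\<close> does not depend on the nonunit \<open>u\<close>. In a relation between the powers of \<open>u\<close>, let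
  \<open>k\<close> be the first index whose coefficient is not divisible by \<open>q\<close>: the terms from \<open>k\<close> on add up to
  \<open>u\<^sup>k\<close> times a unit, and those before \<open>k\<close> are divisible by \<open>q\<close>.
\<close>

lemma power_in_uniform_multiple:
  assumes q: "degree q > 0" "\<And>a. \<phi> a \<in> max_ideal P \<longleftrightarrow> q dvd a"
  obtains n where "\<And>u. u \<in> max_ideal P \<Longrightarrow> u ^ n / \<phi> q \<in> P"
proof -
  obtain n where n: "\<And>(q :: 'k poly) (z :: nat \<Rightarrow> 'K). degree q > 0 \<Longrightarrow>
    \<exists>c. (\<exists>i\<le>n. \<not> q dvd c i) \<and> (\<Sum>i\<le>n. \<phi> (c i) * z i) = 0"
    using reduced_dependence by blast
  have q0: "\<phi> q \<noteq> 0" using q by auto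
  have "u ^ n / \<phi> q \<in> P" if u: "u \<in> max_ideal P" for u
  proof -
    have uP: "u \<in> P" using u max_ideal_subset by blast
    obtain c where c: "\<exists>i\<le>n. \<not> q dvd c i" "(\<Sum>i\<le>n. \<phi> (c i) * u ^ i) = 0"
      using n[OF q(1), of "\<lambda>i. u ^ i"] by blast
    obtain k where k: "k \<le> n" "\<not> q dvd c k" "\<And>i. i < k \<Longrightarrow> q dvd c i"
      using exists_least_iff[of "\<lambda>i. i \<le> n \<and> \<not> q dvd c i"] c(1) by (metis less_le_trans less_imp_le)
    have "\<forall>i. \<exists>d. i < k \<longrightarrow> c i = q * d" using k(3) by (auto simp: dvd_def)
    then obtain d where d: "\<And>i. i < k \<Longrightarrow> c i = q * d i" by metis
    define e where "e = (\<Sum>i\<le>n - k. \<phi> (c (k + i)) * u ^ i)"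
    define l where "l = (\<Sum>i<k. \<phi> (d i) * u ^ i)"
    have lP: "l \<in> P" unfolding l_def by (rule sum_mem) (intro mult_mem power_mem uP phi_mem)
    have e_eq: "e = \<phi> (c k) + u * (\<Sum>i<n - k. \<phi> (c (k + Suc i)) * u ^ i)"
      by (simp add: e_def sum.atMost_shift sum_distrib_left mult_ac)
    have "(\<Sum>i<n - k. \<phi> (c (k + Suc i)) * u ^ i) \<in> P"
      by (rule sum_mem) (intro mult_mem power_mem uP phi_mem)
    then have ur: "u * (\<Sum>i<n - k. \<phi> (c (k + Suc i)) * u ^ i) \<in> max_ideal P" using u max_mult by blast
    have eP: "e \<in> P" unfolding e_def by (rule sum_mem) (intro mult_mem power_mem uP phi_mem)
    have "e \<notin> max_ideal P"
    proof
      assume "e \<in> max_ideal P"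
      then have "e - u * (\<Sum>i<n - k. \<phi> (c (k + Suc i)) * u ^ i) \<in> max_ideal P"
        using ur max_diff by blast
      then show False using q(2) k(2) by (simp add: e_eq)
    qed
    then have ie: "inverse e \<in> P" "e \<noteq> 0" using eP unit_inverse_mem by auto
    have "{..n} = {..<k} \<union> {k..n}" using k(1) by auto
    moreover have "(\<Sum>i\<in>{..<k} \<union> {k..n}. \<phi> (c i) * u ^ i)
        = (\<Sum>i<k. \<phi> (c i) * u ^ i) + (\<Sum>i=k..n. \<phi> (c i) * u ^ i)"
      by (rule sum.union_disjoint) auto
    ultimately have "(\<Sum>i\<le>n. \<phi> (c i) * u ^ i)
        = (\<Sum>i<k. \<phi> (c i) * u ^ i) + (\<Sum>i=k..n. \<phi> (c i) * u ^ i)" by simp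
    moreover have "(\<Sum>i<k. \<phi> (c i) * u ^ i) = \<phi> q * l"
      by (simp add: l_def sum_distrib_left d phi.hom_mult mult.assoc)
    moreover have "(\<Sum>i=k..n. \<phi> (c i) * u ^ i) = u ^ k * e"
      using k(1) sum.shift_bounds_cl_nat_ivl[of "\<lambda>i. \<phi> (c i) * u ^ i" 0 k "n - k"]
      by (simp add: e_def atLeast0AtMost add.commute sum_distrib_left power_add mult_ac)
    ultimately have "u ^ k * e = - (\<phi> q * l)" using c(2) by (simp add: add_eq_0_iff)
    then have "u ^ k / \<phi> q = - l * inverse e" using q0 ie by (simp add: field_simps)
    then have "u ^ k / \<phi> q \<in> P" using lP ie by auto
    moreover have "u ^ n / \<phi> q = u ^ (n - k) * (u ^ k / \<phi> q)" using k(1) by (simp flip: power_add)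
    ultimately show ?thesis using power_mem[OF uP] mult_mem by metis
  qed
  with that show ?thesis by blast
qed

lemma archimedean:
  assumes u: "u \<in> max_ideal P"
  shows "\<exists>N. w * u ^ N \<in> P"
proof -
  obtain q where q: "degree q > 0" "\<And>a. \<phi> a \<in> max_ideal P \<longleftrightarrow> q dvd a" using max_generator by blast
  obtain n where n: "\<And>u. u \<in> max_ideal P \<Longrightarrow> u ^ n / \<phi> q \<in> P"
    using power_in_uniform_multiple[OF q] by blast
  obtain a where a: "a \<noteq> 0" "\<phi> a * w \<in> P" using nonzero_multiple_mem by blast
  obtain k s where s: "s \<in> P" "\<phi> a * s = \<phi> q ^ k" using power_multiple[OF q a(1)] by blast
  have "\<phi> a * w * s \<in> P" using a s by blast
  then have "\<phi> q ^ k * w \<in> P" by (simp add: mult_ac flip: s(2))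
  then have "(u ^ n / \<phi> q) ^ k * (\<phi> q ^ k * w) \<in> P" using power_mem[OF n[OF u]] by blast
  moreover have "\<phi> q \<noteq> 0" using q by auto
  ultimately have "w * u ^ (n * k) \<in> P" by (simp add: power_divide mult_ac flip: power_mult)
  then show ?thesis by blast
qed

text \<open>
  If no element generated the maximal ideal, each nonzero nonunit would be divisible by the square
  of another one, and \<open>q(y)\<close> by the \<open>2\<^sup>n\<close>-th power of a nonunit \<open>s\<close>. As \<open>s\<^sup>n\<close> is a multiple of
  \<open>q(y)\<close> by \<open>power_in_uniform_multiple\<close> and \<open>n < 2\<^sup>n\<close>, this is impossible.
\<close>

lemma valuation_exists: "\<exists>v. normalized_valuation P v"
proof -
  obtain q where q: "degree q > 0" "\<And>a. \<phi> a \<in> max_ideal P \<longleftrightarrow> q dvd a" using max_generator by blast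
  obtain n where n: "\<And>u. u \<in> max_ideal P \<Longrightarrow> u ^ n / \<phi> q \<in> P"
    using power_in_uniform_multiple[OF q] by blast
  have q0: "\<phi> q \<noteq> 0" using q by auto
  have qm: "\<phi> q \<in> max_ideal P" by (simp add: q(2))
  have "\<exists>t. t \<in> max_ideal P \<and> t \<noteq> 0 \<and> (\<forall>u\<in>max_ideal P. u / t \<in> P)"
  proof (rule ccontr)
    assume no: "\<not> ?thesis"
    have half: "\<exists>s. s \<in> max_ideal P \<and> s \<noteq> 0 \<and> t / s ^ 2 \<in> P" if t: "t \<in> max_ideal P" "t \<noteq> 0" for t
    proof -
      obtain u where u: "u \<in> max_ideal P" "u / t \<notin> P" using no t by blast
      then have u0: "u \<noteq> 0" by auto
      have tu: "t / u \<in> max_ideal P" "t / u \<noteq> 0" using inverse_mem_max[OF u(2)] u0 t by auto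
      consider "u / (t / u) \<in> P" | "(t / u) / u \<in> P" using total[of "u / (t / u)"] by (auto simp: field_simps)
      then show ?thesis
      proof cases
        case 1
        then have "t / (t / u) ^ 2 \<in> P" using t u0 by (simp add: field_simps power2_eq_square)
        then show ?thesis using tu by blast
      next
        case 2
        then have "t / u ^ 2 \<in> P" by (simp add: power2_eq_square field_simps)
        then show ?thesis using u u0 by blast
      qed
    qed
    have "\<exists>s. s \<in> max_ideal P \<and> s \<noteq> 0 \<and> \<phi> q / s ^ (2 ^ k) \<in> P" for k
    proof (induction k)
      case 0
      then show ?case using qm q0 by (intro exI[of _ "\<phi> q"]) simp
    next
      case (Suc k)
      then obtain t where t: "t \<in> max_ideal P" "t \<noteq> 0" "\<phi> q / t ^ (2 ^ k) \<in> P" by blast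
      then obtain s where s: "s \<in> max_ideal P" "s \<noteq> 0" "t / s ^ 2 \<in> P" using half by blast
      have "(\<phi> q / t ^ (2 ^ k)) * (t / s ^ 2) ^ (2 ^ k) \<in> P" using t s power_mem by blast
      also have "(\<phi> q / t ^ (2 ^ k)) * (t / s ^ 2) ^ (2 ^ k) = \<phi> q / s ^ (2 ^ Suc k)"
        using t by (simp add: power_divide flip: power_mult)
      finally show ?case using s by blast
    qed
    then obtain s where s: "s \<in> max_ideal P" "s \<noteq> 0" "\<phi> q / s ^ (2 ^ n) \<in> P" by blast
    have "(\<phi> q / s ^ (2 ^ n)) * (s ^ n / \<phi> q) \<in> P" using s n by blast
    also have "(\<phi> q / s ^ (2 ^ n)) * (s ^ n / \<phi> q) = s ^ n / s ^ (2 ^ n)" using q0 by simp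
    finally have "s ^ (2 ^ n - Suc n) * (s ^ n / s ^ (2 ^ n)) \<in> P"
      using power_mem[OF max_ideal_subset[OF s(1)]] by blast
    moreover have "s ^ (2 ^ n) = s ^ (2 ^ n - Suc n) * s ^ n * s"
    proof -
      have "n < 2 ^ n" by (rule less_exp)
      then have "2 ^ n = Suc (2 ^ n - Suc n + n)" by linarith
      then have "s ^ (2 ^ n) = s ^ Suc (2 ^ n - Suc n + n)" by metis
      then show ?thesis by (simp add: power_add)
    qed
    ultimately have "inverse s \<in> P" using s(2) by (simp add: field_simps)
    then show False using max_inverse_notin s by blast
  qed
  then show ?thesis using normalized_valuation_exists archimedean by blast
qed

lemma normalized_valuation_val: "normalized_valuation P (val P)"
  using valuation_exists by (rule normalized_valuation_val)

lemma integral_subset: "integral_closure (range \<phi>) \<subseteq> P"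
  by (rule integral_closure_subset[OF range_subset])

text \<open>A valuation ring is the localization of the integral closure at its centre.\<close>

lemma localization:
  assumes u: "u \<in> P"
  obtains b where "b \<in> integral_closure (range \<phi>)" "b \<notin> max_ideal P" "u * b \<in> integral_closure (range \<phi>)"
proof -
  obtain q where q: "degree q > 0" "\<And>a. \<phi> a \<in> max_ideal P \<longleftrightarrow> q dvd a" using max_generator by blast
  obtain n where n: "\<And>(q :: 'k poly) (z :: nat \<Rightarrow> 'K). degree q > 0 \<Longrightarrow>
    \<exists>c. (\<exists>i\<le>n. \<not> q dvd c i) \<and> (\<Sum>i\<le>n. \<phi> (c i) * z i) = 0"
    using reduced_dependence by blast
  obtain c where c: "\<exists>i\<le>n. \<not> q dvd c i" "(\<Sum>i\<le>n. \<phi> (c i) * u ^ i) = 0"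
    using n[OF q(1), of "\<lambda>i. u ^ i"] by blast
  then obtain k where k: "k \<le> n" "\<phi> (c k) \<notin> max_ideal P" using q(2) by blast
  interpret R: field_subring "range \<phi>" by (rule field_subring_range)
  obtain b where b: "\<And>i. b i \<in> integral_closure (range \<phi>)" "\<And>i. u * b i \<in> integral_closure (range \<phi>)"
      "\<And>i. i \<le> n \<Longrightarrow> \<phi> (c i) = b i - u * b (Suc i)"
    using R.integral_quotient_coeffs[of n "\<lambda>i. \<phi> (c i)" u] c(2) by blast
  have "b k \<notin> max_ideal P \<or> b (Suc k) \<notin> max_ideal P"
    using b(3)[OF k(1)] k(2) max_diff max_mult'[OF u] by metis
  then show ?thesis using that b by blast
qed

end

context affine_chart
begin

lemma chart_placeI: "P \<in> places \<iota> \<Longrightarrow> range \<phi> \<subseteq> P \<Longrightarrow> chart_place \<iota> \<phi> P"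
  by unfold_locales

lemma places_incomparable:
  assumes "chart_place \<iota> \<phi> P" "chart_place \<iota> \<phi> Q" "P \<subseteq> Q"
  shows "P = Q"
proof (rule ccontr)
  assume "P \<noteq> Q"
  interpret P: chart_place \<iota> \<phi> P by fact
  interpret Q: chart_place \<iota> \<phi> Q by fact
  obtain z where z: "z \<in> Q" "z \<notin> P" using \<open>P \<noteq> Q\<close> assms by blast
  have "w \<in> Q" for w
  proof -
    obtain N where "w * inverse z ^ N \<in> P" using P.archimedean P.inverse_mem_max z by blast
    then have "w * inverse z ^ N * z ^ N \<in> Q" using Q.power_mem z assms by blast
    moreover have "z \<noteq> 0" using z by auto
    ultimately show ?thesis by (simp add: field_simps)
  qed
  then show False using Q.proper by blast
qed

text \<open>
  Distinct places have incomparable centres on the integral closure of \<open>k[y]\<close>.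
\<close>

lemma separating_element:
  assumes "chart_place \<iota> \<phi> P" "chart_place \<iota> \<phi> Q" "P \<noteq> Q"
  shows "\<exists>b\<in>integral_closure (range \<phi>). b \<in> max_ideal Q \<and> b \<notin> max_ideal P"
proof (rule ccontr)
  assume nt: "\<not> ?thesis"
  then have sub: "b \<in> max_ideal P" if "b \<in> integral_closure (range \<phi>)" "b \<in> max_ideal Q" for b
    using that nt by blast
  interpret P: chart_place \<iota> \<phi> P by fact
  interpret Q: chart_place \<iota> \<phi> Q by fact
  have "P \<subseteq> Q"
  proof
    fix u assume "u \<in> P"
    then obtain b where b: "b \<in> integral_closure (range \<phi>)" "b \<notin> max_ideal P"
        "u * b \<in> integral_closure (range \<phi>)" using P.localization by blast
    then have "b \<in> Q" "b \<notin> max_ideal Q" "u * b \<in> Q" using sub Q.integral_subset by blast+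
    then have "u * b * inverse b \<in> Q" using Q.unit_inverse_mem by blast
    moreover have "b \<noteq> 0" using b by auto
    ultimately show "u \<in> Q" by (simp add: mult.assoc)
  qed
  then show False using places_incomparable assms by blast
qed

text \<open>
  Above an irreducible polynomial there are only finitely many places. The products \<open>z\<^sub>i\<close> of
  separating elements are units at the \<open>i\<close>-th place and nonunits at the others, so that a relation
  with a coefficient \<open>c\<^sub>k\<close> not divisible by \<open>q\<close> is impossible at the \<open>k\<close>-th place.
\<close>

lemma finite_places_above_irreducible:
  assumes q: "irreducible q" "degree q > 0"
  shows "finite {P. chart_place \<iota> \<phi> P \<and> \<phi> q \<in> max_ideal P}" (is "finite ?S")
proof (rule ccontr)
  assume inf: "infinite ?S"
  obtain n where n: "\<And>(q :: 'k poly) (z :: nat \<Rightarrow> 'K). degree q > 0 \<Longrightarrow>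
    \<exists>c. (\<exists>i\<le>n. \<not> q dvd c i) \<and> (\<Sum>i\<le>n. \<phi> (c i) * z i) = 0"
    using reduced_dependence by blast
  obtain T where T: "finite T" "card T = Suc n" "T \<subseteq> ?S"
    using infinite_arbitrarily_large[OF inf] by blast
  obtain f where f: "bij_betw f {0..<Suc n} T" using ex_bij_betw_nat_finite[OF T(1)] T(2) by metis
  have fS: "chart_place \<iota> \<phi> (f i)" "\<phi> q \<in> max_ideal (f i)" if "i \<le> n" for i
  proof -
    have "f i \<in> T" using f that by (auto simp: bij_betw_def)
    then show "chart_place \<iota> \<phi> (f i)" "\<phi> q \<in> max_ideal (f i)" using T(3) by auto
  qed
  have fne: "f i \<noteq> f j" if "i \<le> n" "j \<le> n" "i \<noteq> j" for i j
    using f that by (auto simp: bij_betw_def inj_on_def)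
  have "\<forall>i j. \<exists>b. i \<le> n \<longrightarrow> j \<le> n \<longrightarrow> i \<noteq> j \<longrightarrow>
      b \<in> integral_closure (range \<phi>) \<and> b \<in> max_ideal (f j) \<and> b \<notin> max_ideal (f i)"
    using separating_element fS fne by metis
  then obtain w where w: "\<And>i j. i \<le> n \<Longrightarrow> j \<le> n \<Longrightarrow> i \<noteq> j \<Longrightarrow>
      w i j \<in> integral_closure (range \<phi>) \<and> w i j \<in> max_ideal (f j) \<and> w i j \<notin> max_ideal (f i)"
    by metis
  define z where "z i = (\<Prod>j\<in>{..n} - {i}. w i j)" for i
  obtain c where c: "\<exists>i\<le>n. \<not> q dvd c i" "(\<Sum>i\<le>n. \<phi> (c i) * z i) = 0" using n[OF q(2)] by blast
  then obtain k where k: "k \<le> n" "\<not> q dvd c k" by blast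
  interpret P: chart_place \<iota> \<phi> "f k" by (rule fS(1)[OF k(1)])
  obtain p where p: "degree p > 0" "\<And>a. \<phi> a \<in> max_ideal (f k) \<longleftrightarrow> p dvd a"
    using P.max_generator by blast
  have "\<not> p dvd c k"
  proof
    assume "p dvd c k"
    have "p dvd q" using fS(2)[OF k(1)] p by blast
    then obtain e where e: "q = p * e" by (auto simp: dvd_def)
    have "\<not> p dvd 1" using p(1) by (auto simp: is_unit_iff_degree)
    then have "e dvd 1" using irreducibleD[OF q(1) e] by blast
    then have "q dvd p" using e by (metis dvd_mult_unit_iff' dvd_refl mult.commute mult_unit_dvd_iff')
    then show False using \<open>p dvd c k\<close> k(2) dvd_trans by blast
  qed
  then have ck: "\<phi> (c k) \<notin> max_ideal (f k)" using p by blast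
  have wP: "w i j \<in> f k" if "i \<le> n" "j \<le> n" "i \<noteq> j" for i j
    using w[OF that] P.integral_subset by blast
  have zk: "z k \<in> f k \<and> z k \<notin> max_ideal (f k)"
    unfolding z_def using k(1) w wP by (intro P.notin_max_prod) auto
  have zi: "z i \<in> max_ideal (f k)" if i: "i \<le> n" "i \<noteq> k" for i
  proof -
    have "z i = w i k * (\<Prod>j\<in>{..n} - {i} - {k}. w i j)"
      unfolding z_def using i k(1) by (intro prod.remove) auto
    moreover have "(\<Prod>j\<in>{..n} - {i} - {k}. w i j) \<in> f k"
      using i by (intro P.prod_mem wP) auto
    ultimately show ?thesis using w[OF i(1) k(1) i(2)] P.max_mult by metis
  qed
  have "(\<Sum>i\<le>n. \<phi> (c i) * z i) = \<phi> (c k) * z k + (\<Sum>i\<in>{..n} - {k}. \<phi> (c i) * z i)"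
    using k(1) by (intro sum.remove) auto
  moreover have "(\<Sum>i\<in>{..n} - {k}. \<phi> (c i) * z i) \<in> max_ideal (f k)"
    using zi by (intro P.max_sum P.max_mult') auto
  ultimately have "\<phi> (c k) * z k \<in> max_ideal (f k)"
    using c(2) P.max_uminus by (metis eq_neg_iff_add_eq_0)
  then show False using P.max_prime zk ck by blast
qed

lemma finite_places_above_poly:
  assumes "a \<noteq> 0"
  shows "finite {P. chart_place \<iota> \<phi> P \<and> \<phi> a \<in> max_ideal P}"
  using assms
proof (induction "degree a" arbitrary: a rule: less_induct)
  case less
  show ?case
  proof (cases "degree a = 0")
    case True
    then obtain c where c: "a = [:c:]" by (metis degree_eq_zeroE)
    have "\<phi> a \<notin> max_ideal P" if "chart_place \<iota> \<phi> P" for P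
    proof
      interpret chart_place \<iota> \<phi> P by fact
      assume "\<phi> a \<in> max_ideal P"
      then have "\<phi> a * \<phi> [:inverse c:] \<in> max_ideal P" using max_mult by blast
      moreover have "\<phi> a * \<phi> [:inverse c:] = 1"
        using less.prems c by (simp flip: phi.hom_mult add: pCons_one)
      ultimately show False by simp
    qed
    then have empty: "{P. chart_place \<iota> \<phi> P \<and> \<phi> a \<in> max_ideal P} = {}" by blast
    show ?thesis unfolding empty by simp
  next
    case False
    show ?thesis
    proof (cases "irreducible a")
      case True
      then show ?thesis using finite_places_above_irreducible False by blast
    next
      case nirr: False
      obtain b c where bc: "a = b * c" "\<not> b dvd 1" "\<not> c dvd 1"
        using nirr less.prems False unfolding irreducible_def by (auto simp: is_unit_iff_degree)
      then have nz: "b \<noteq> 0" "c \<noteq> 0" using less.prems by auto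
      then have "degree b > 0" "degree c > 0" using bc by (auto simp: is_unit_iff_degree)
      then have "degree b < degree a" "degree c < degree a" using nz by (auto simp: bc degree_mult_eq)
      then have "finite ({P. chart_place \<iota> \<phi> P \<and> \<phi> b \<in> max_ideal P} \<union>
          {P. chart_place \<iota> \<phi> P \<and> \<phi> c \<in> max_ideal P})" using less.hyps nz by blast
      moreover have "{P. chart_place \<iota> \<phi> P \<and> \<phi> a \<in> max_ideal P} \<subseteq>
          {P. chart_place \<iota> \<phi> P \<and> \<phi> b \<in> max_ideal P} \<union>
          {P. chart_place \<iota> \<phi> P \<and> \<phi> c \<in> max_ideal P}"
      proof (intro subsetI)
        fix P assume "P \<in> {P. chart_place \<iota> \<phi> P \<and> \<phi> a \<in> max_ideal P}"
        then interpret chart_place \<iota> \<phi> P by simp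
        show "P \<in> {P. chart_place \<iota> \<phi> P \<and> \<phi> b \<in> max_ideal P} \<union>
          {P. chart_place \<iota> \<phi> P \<and> \<phi> c \<in> max_ideal P}"
          using \<open>P \<in> _\<close> max_prime[of "\<phi> b" "\<phi> c"] by (auto simp: bc phi.hom_mult)
      qed
      ultimately show ?thesis by (rule finite_subset[rotated])
    qed
  qed
qed

lemma finite_places_above:
  assumes "w \<noteq> 0"
  shows "finite {P. chart_place \<iota> \<phi> P \<and> w \<in> max_ideal P}"
proof -
  obtain a n d where a: "a \<noteq> 0" "\<phi> a = w * (\<Sum>i\<le>n. \<phi> (d i) * w ^ i)"
    using nonzero_multiple[OF assms] by blast
  have "\<phi> a \<in> max_ideal P" if "chart_place \<iota> \<phi> P" "w \<in> max_ideal P" for P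
  proof -
    interpret chart_place \<iota> \<phi> P by fact
    have "w \<in> P" using that max_ideal_subset by blast
    then have "(\<Sum>i\<le>n. \<phi> (d i) * w ^ i) \<in> P" by (intro sum_mem mult_mem power_mem phi_mem)
    then show ?thesis using a that max_mult by metis
  qed
  then show ?thesis by (intro finite_subset[OF _ finite_places_above_poly[OF a(1)]]) auto
qed

end

section \<open>Ideals of a subring of a field\<close>

context field_subring
begin

lemma cring_ring_on: "cring (ring_on R)"
proof -
  have "subring R class_ring" using field_subring_axioms field_subring_iff by blast
  then have "subcring R class_ring" by (rule cring.subcringI'[OF class_cring.cring_axioms])
  then show ?thesis using ring.subcring_iff[OF class_ring.ring_axioms, of R] by simp
qed

lemma a_inv_ring_on: "a \<in> R \<Longrightarrow> \<ominus>\<^bsub>ring_on R\<^esub> a = - a"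
proof -
  assume a: "a \<in> R"
  interpret S: cring "ring_on R" by (rule cring_ring_on)
  show ?thesis using a by (intro S.minus_equality) auto
qed

lemma ideal_ring_on_iff:
  "ideal J (ring_on R) \<longleftrightarrow> J \<subseteq> R \<and> 0 \<in> J \<and> (\<forall>a\<in>J. \<forall>b\<in>J. a + b \<in> J) \<and> (\<forall>c\<in>R. \<forall>a\<in>J. c * a \<in> J)"
  (is "?L \<longleftrightarrow> ?R")
proof
  assume ?L
  then interpret ideal J "ring_on R" .
  show ?R
    using a_subset additive_subgroup.zero_closed[OF is_additive_subgroup]
      additive_subgroup.a_closed[OF is_additive_subgroup] I_l_closed by auto
next
  assume J: ?R
  interpret S: cring "ring_on R" by (rule cring_ring_on)
  show ?L
  proof (rule idealI)
    show "ring (ring_on R)" by (rule S.ring_axioms)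
    show "subgroup J (add_monoid (ring_on R))"
    proof (rule S.add.subgroupI)
      show "J \<subseteq> carrier (ring_on R)" "J \<noteq> {}" using J by auto
      show "\<ominus>\<^bsub>ring_on R\<^esub> a \<in> J" if "a \<in> J" for a
      proof -
        have "- 1 * a \<in> J" using J that by blast
        moreover have "\<ominus>\<^bsub>ring_on R\<^esub> a = - a" using J that by (intro a_inv_ring_on) auto
        ultimately show ?thesis by simp
      qed
      show "a \<oplus>\<^bsub>ring_on R\<^esub> b \<in> J" if "a \<in> J" "b \<in> J" for a b using J that by auto
    qed
    show "x \<otimes>\<^bsub>ring_on R\<^esub> a \<in> J" "a \<otimes>\<^bsub>ring_on R\<^esub> x \<in> J"
      if "a \<in> J" "x \<in> carrier (ring_on R)" for a x using J that by (auto simp: mult.commute)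
  qed
qed

lemma ideal_one_iff: 
  assumes "ideal J (ring_on R)" shows "1 \<in> J \<longleftrightarrow> J = R"
  using assms unfolding ideal_ring_on_iff by (metis mult.right_neutral one_mem subsetI subset_antisym)

lemma maximalideal_ring_on:
  assumes "maximalideal p (ring_on R)"
  shows "p \<subseteq> R" "0 \<in> p" "1 \<notin> p" "\<And>a b. a \<in> p \<Longrightarrow> b \<in> p \<Longrightarrow> a + b \<in> p"
    "\<And>c a. c \<in> R \<Longrightarrow> a \<in> p \<Longrightarrow> c * a \<in> p"
    "\<And>a b. a \<in> R \<Longrightarrow> b \<in> R \<Longrightarrow> a * b \<in> p \<Longrightarrow> a \<in> p \<or> b \<in> p"
proof -
  interpret S: cring "ring_on R" by (rule cring_ring_on)
  interpret p: maximalideal p "ring_on R" by fact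
  have id: "ideal p (ring_on R)" by (rule p.is_ideal)
  then show "p \<subseteq> R" "0 \<in> p" "\<And>a b. a \<in> p \<Longrightarrow> b \<in> p \<Longrightarrow> a + b \<in> p"
    "\<And>c a. c \<in> R \<Longrightarrow> a \<in> p \<Longrightarrow> c * a \<in> p" unfolding ideal_ring_on_iff by blast+
  show "1 \<notin> p" using ideal_one_iff[OF id] p.I_notcarr by auto
  interpret q: primeideal p "ring_on R" by (rule S.maximalideal_prime) fact
  show "a \<in> p \<or> b \<in> p" if "a \<in> R" "b \<in> R" "a * b \<in> p" for a b
    using q.I_prime[of a b] that by simp
qed

lemma exists_maximalideal:
  assumes J: "ideal J (ring_on R)" "1 \<notin> J"
  obtains p where "maximalideal p (ring_on R)" "J \<subseteq> p"
proof -
  define F where "F = {I. ideal I (ring_on R) \<and> 1 \<notin> I \<and> J \<subseteq> I}"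
  have "\<exists>p\<in>F. \<forall>X\<in>F. p \<subseteq> X \<longrightarrow> X = p"
  proof (rule subset_Zorn_nonempty)
    show "F \<noteq> {}" using J by (auto simp: F_def)
    fix C assume C: "C \<noteq> {}" "subset.chain F C"
    have CF: "C \<subseteq> F" and tot: "\<And>X Y. X \<in> C \<Longrightarrow> Y \<in> C \<Longrightarrow> X \<subseteq> Y \<or> Y \<subseteq> X"
      using C by (auto simp: subset_chain_def)
    have "ideal (\<Union>C) (ring_on R)"
      unfolding ideal_ring_on_iff
    proof (intro conjI ballI)
      have *: "X \<subseteq> R \<and> 0 \<in> X" if "X \<in> C" for X
      proof -
        have "ideal X (ring_on R)" using CF that by (auto simp: F_def)
        then show ?thesis unfolding ideal_ring_on_iff by blast
      qed
      then show "\<Union>C \<subseteq> R" by blast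
      show "0 \<in> \<Union>C" using * C(1) by blast
      show "c * a \<in> \<Union>C" if ca: "c \<in> R" "a \<in> \<Union>C" for c a
      proof -
        obtain X where X: "X \<in> C" "a \<in> X" using ca(2) by blast
        then have "ideal X (ring_on R)" using CF by (auto simp: F_def)
        then have "c * a \<in> X" using ca X unfolding ideal_ring_on_iff by blast
        then show ?thesis using X by blast
      qed
      fix a b assume "a \<in> \<Union>C" "b \<in> \<Union>C"
      then obtain X Y where XY: "X \<in> C" "a \<in> X" "Y \<in> C" "b \<in> Y" by blast
      then obtain Z where "Z \<in> C" "a \<in> Z" "b \<in> Z" using tot[of X Y] by blast
      moreover from this have "ideal Z (ring_on R)" using CF by (auto simp: F_def)
      ultimately have "a + b \<in> Z" unfolding ideal_ring_on_iff by blast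
      then show "a + b \<in> \<Union>C" using \<open>Z \<in> C\<close> by blast
    qed
    then show "\<Union>C \<in> F" using CF C(1) by (auto simp: F_def)
  qed
  then obtain p where p: "p \<in> F" "\<And>X. X \<in> F \<Longrightarrow> p \<subseteq> X \<Longrightarrow> X = p" by blast
  have "maximalideal p (ring_on R)"
  proof (rule maximalidealI)
    show "ideal p (ring_on R)" "carrier (ring_on R) \<noteq> p" using p(1) by (auto simp: F_def)
    fix X assume X: "ideal X (ring_on R)" "p \<subseteq> X" "X \<subseteq> carrier (ring_on R)"
    show "X = p \<or> X = carrier (ring_on R)"
    proof (cases "1 \<in> X")
      case True
      then show ?thesis using ideal_one_iff[OF X(1)] by simp
    next
      case False
      then have "X \<in> F" using X p(1) by (auto simp: F_def)
      then show ?thesis using p(2) X by blast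
    qed
  qed
  then show ?thesis using that p(1) by (auto simp: F_def)
qed

end

section \<open>Centres of places and approximation\<close>

context chart_place
begin

lemma mem_iff: "z \<in> P \<longleftrightarrow> z = 0 \<or> 0 \<le> val P z"
  using normalized_valuation_val unfolding normalized_valuation_def by blast

lemma val_mult: "a \<noteq> 0 \<Longrightarrow> b \<noteq> 0 \<Longrightarrow> val P (a * b) = val P a + val P b"
  using normalized_valuation_val unfolding normalized_valuation_def by blast

lemma val_add_ge:
  assumes "a = 0 \<or> n \<le> val P a" "b = 0 \<or> n \<le> val P b"
  shows "a + b = 0 \<or> n \<le> val P (a + b)"
proof (cases "a = 0 \<or> b = 0 \<or> a + b = 0")
  case False
  then have "min (val P a) (val P b) \<le> val P (a + b)"
    using normalized_valuation_val unfolding normalized_valuation_def by simp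
  then show ?thesis using assms False by auto
qed (use assms in auto)

lemma val_surj: "\<exists>z. z \<noteq> 0 \<and> val P z = n"
proof -
  have "val P ` (UNIV - {0}) = UNIV"
    using normalized_valuation_val unfolding normalized_valuation_def by blast
  then have "n \<in> val P ` (UNIV - {0})" by blast
  then show ?thesis by auto
qed

lemma val_one [simp]: "val P 1 = 0"
  using val_mult[of 1 1] by simp

lemma val_inverse: "a \<noteq> 0 \<Longrightarrow> val P (inverse a) = - val P a"
  using val_mult[of a "inverse a"] by simp

lemma val_power: "a \<noteq> 0 \<Longrightarrow> val P (a ^ n) = int n * val P a"
  by (induction n) (auto simp: val_mult algebra_simps)

lemma val_powi: "a \<noteq> 0 \<Longrightarrow> val P (a powi k) = k * val P a"
  by (auto simp: power_int_def val_power val_inverse)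

lemma val_prod: "finite I \<Longrightarrow> (\<And>i. i \<in> I \<Longrightarrow> f i \<noteq> 0) \<Longrightarrow> val P (prod f I) = (\<Sum>i\<in>I. val P (f i))"
  by (induction I rule: finite_induct) (auto simp: val_mult)

lemma max_iff: "z \<in> max_ideal P \<longleftrightarrow> z = 0 \<or> 0 < val P z"
  using val_inverse[of z] by (auto simp: max_ideal_def mem_iff)

end

context affine_chart
begin

text \<open>The integral closure of \<open>k[y]\<close>, and the set of places at which \<open>k[y]\<close> is regular.\<close>

abbreviation "IC \<equiv> integral_closure (range \<phi>)"

abbreviation "Pl \<equiv> {P. chart_place \<iota> \<phi> P}"

sublocale R: field_subring "range \<phi>" by (rule field_subring_range)

sublocale IC: field_subring IC by (rule R.field_subring_integral_closure)

lemma phi_mem_IC: "\<phi> a \<in> IC"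
  using R.subset_integral_closure by blast

text \<open>
  If \<open>1/y\<close> were integral over \<open>k[y]\<close>, then \<open>y\<close> would divide \<open>1\<close> in \<open>k[y]\<close>.
\<close>

lemma IC_not_field: "inverse (\<phi> [:0, 1:]) \<notin> IC"
proof
  let ?y = "\<phi> [:0, 1:]"
  assume "inverse ?y \<in> IC"
  from R.integral_power_reduce[OF this]
  obtain n a where a: "0 < n" "\<And>i. a i \<in> range \<phi>" "inverse ?y ^ n = (\<Sum>i<n. a i * inverse ?y ^ i)"
    by blast
  have "\<forall>i. \<exists>c. a i = \<phi> c" using a(2) by blast
  then obtain c where c: "\<And>i. a i = \<phi> (c i)" by metis
  have y0: "?y \<noteq> 0" by simp
  have "\<phi> 1 = ?y ^ n * inverse ?y ^ n" using y0 by (simp add: power_inverse flip: power_mult_distrib)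
  also have "\<dots> = (\<Sum>i<n. ?y ^ n * (a i * inverse ?y ^ i))" by (simp add: a(3) sum_distrib_left)
  also have "\<dots> = (\<Sum>i<n. \<phi> ([:0, 1:] * (c i * [:0, 1:] ^ (n - Suc i))))"
  proof (rule sum.cong)
    fix i assume "i \<in> {..<n}"
    then have "n = Suc (n - Suc i) + i" by auto
    then have "?y ^ n = ?y * ?y ^ (n - Suc i) * ?y ^ i" by (metis power_Suc power_add)
    then have "?y ^ n * (a i * inverse ?y ^ i) = ?y * ?y ^ (n - Suc i) * a i * (?y * inverse ?y) ^ i"
      by (simp only: power_mult_distrib mult_ac)
    then show "?y ^ n * (a i * inverse ?y ^ i) = \<phi> ([:0, 1:] * (c i * [:0, 1:] ^ (n - Suc i)))"
      using y0 by (simp add: c phi.hom_mult phi.hom_power mult_ac del: mult_pCons_left mult_pCons_right)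
  qed simp
  also have "\<dots> = \<phi> ([:0, 1:] * (\<Sum>i<n. c i * [:0, 1:] ^ (n - Suc i)))"
    by (simp only: phi.hom_sum sum_distrib_left)
  finally have "1 = [:0, 1:] * (\<Sum>i<n. c i * [:0, 1:] ^ (n - Suc i))" by (simp only: phi.eq_iff)
  then have "poly 1 0 = poly ([:0, 1:] * (\<Sum>i<n. c i * [:0, 1:] ^ (n - Suc i))) 0" by simp
  then show False by simp
qed

text \<open>Every element of the extension satisfies a relation with a coefficient outside a given
  maximal ideal.\<close>

lemma relation_outside_maximalideal:
  assumes p: "maximalideal p (ring_on IC)"
  obtains n c where "\<exists>i\<le>n. \<phi> (c i) \<notin> p" "(\<Sum>i\<le>n. \<phi> (c i) * u ^ i) = 0"
proof (cases "\<exists>a. a \<noteq> 0 \<and> \<phi> a \<in> p")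
  case False
  obtain n where n: "\<And>z :: nat \<Rightarrow> 'K. \<exists>c. (\<exists>i\<le>n. c i \<noteq> 0) \<and> (\<Sum>i\<le>n. \<phi> (c i) * z i) = 0"
    using dependence by blast
  obtain c where "\<exists>i\<le>n. c i \<noteq> 0" "(\<Sum>i\<le>n. \<phi> (c i) * u ^ i) = 0" using n[of "\<lambda>i. u ^ i"] by blast
  then show ?thesis using that False by blast
next
  case True
  note pp = IC.maximalideal_ring_on[OF p]
  from True obtain a where "a \<noteq> 0 \<and> \<phi> a \<in> p" by blast
  from ex_has_least_nat[of "\<lambda>a. a \<noteq> 0 \<and> \<phi> a \<in> p", OF this, of degree]
  obtain q where q: "q \<noteq> 0" "\<phi> q \<in> p" "\<And>a. a \<noteq> 0 \<Longrightarrow> \<phi> a \<in> p \<Longrightarrow> degree q \<le> degree a" by auto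
  have deg: "degree q > 0"
  proof (rule ccontr)
    assume "\<not> degree q > 0"
    then obtain c where c: "q = [:c:]" by (metis degree_eq_zeroE gr0I)
    then have "\<phi> [:inverse c:] * \<phi> q = 1"
      using q(1) by (simp flip: phi.hom_mult add: pCons_one)
    then show False using pp(3) pp(5)[OF phi_mem_IC q(2)] by metis
  qed
  have dvd: "q dvd a" if a: "\<phi> a \<in> p" for a
  proof -
    have "a mod q = a + (- (a div q)) * q" by (simp add: minus_mult_div_eq_mod mult.commute)
    then have "\<phi> (a mod q) = \<phi> a + \<phi> (- (a div q)) * \<phi> q"
      by (metis phi.hom_add phi.hom_mult)
    then have "\<phi> (a mod q) \<in> p" using a q(2) pp(4) pp(5)[OF phi_mem_IC q(2)] by metis
    then have "a mod q = 0" using q(3) degree_mod_less[OF q(1), of a] by force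
    then show "q dvd a" by (simp add: dvd_eq_mod_eq_0)
  qed
  obtain n where n: "\<And>(q :: 'k poly) (z :: nat \<Rightarrow> 'K). degree q > 0 \<Longrightarrow>
    \<exists>c. (\<exists>i\<le>n. \<not> q dvd c i) \<and> (\<Sum>i\<le>n. \<phi> (c i) * z i) = 0"
    using reduced_dependence by blast
  obtain c where "\<exists>i\<le>n. \<not> q dvd c i" "(\<Sum>i\<le>n. \<phi> (c i) * u ^ i) = 0"
    using n[OF deg, of "\<lambda>i. u ^ i"] by blast
  then show ?thesis using that dvd by blast
qed

text \<open>
  The localization \<open>L\<close> of the integral closure at a maximal ideal is the valuation ring of a place
  with this ideal as its centre. Beyond primeness, maximality only serves to
  exclude the zero ideal.
\<close>

lemma place_of_maximalideal:
  assumes p: "maximalideal p (ring_on IC)"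
  shows "\<exists>P. chart_place \<iota> \<phi> P \<and> max_ideal P \<inter> IC = p"
proof -
  note pp = IC.maximalideal_ring_on[OF p]
  define L where "L = {b / s | b s. b \<in> IC \<and> s \<in> IC \<and> s \<notin> p}"
  have LI: "b / s \<in> L" if "b \<in> IC" "s \<in> IC" "s \<notin> p" for b s using that by (auto simp: L_def)
  have IC_L: "b \<in> L" if "b \<in> IC" for b using LI[OF that, of 1] pp(3) by auto
  interpret L: field_subring L
  proof
    show "0 \<in> L" "1 \<in> L" by (auto intro: IC_L)
    fix x y assume "x \<in> L" "y \<in> L"
    then obtain b s c t where st: "x = b / s" "y = c / t" "b \<in> IC" "s \<in> IC" "s \<notin> p"
      "c \<in> IC" "t \<in> IC" "t \<notin> p" by (auto simp: L_def)
    then have nz: "s \<noteq> 0" "t \<noteq> 0" using pp(2) by auto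
    have stp: "s * t \<notin> p" using pp(6) st by blast
    have "x + y = (b * t + c * s) / (s * t)" using nz st by (simp add: field_simps)
    then show "x + y \<in> L" using LI[OF _ _ stp] st by (metis IC.add_mem IC.mult_mem)
    have "x * y = (b * c) / (s * t)" using st by simp
    then show "x * y \<in> L" using LI[OF _ _ stp] st by (metis IC.mult_mem)
  next
    fix x assume "x \<in> L"
    then obtain b s where "x = b / s" "b \<in> IC" "s \<in> IC" "s \<notin> p" by (auto simp: L_def)
    then show "- x \<in> L" using LI[of "- b" s] by auto
  qed
  have tot: "u \<in> L \<or> inverse u \<in> L" for u
  proof -
    obtain n c where c: "\<exists>i\<le>n. \<phi> (c i) \<notin> p" "(\<Sum>i\<le>n. \<phi> (c i) * u ^ i) = 0"
      using relation_outside_maximalideal[OF p] by blast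
    then obtain k where k: "k \<le> n" "\<phi> (c k) \<notin> p" by blast
    obtain b where b: "\<And>i. b i \<in> IC" "\<And>i. u * b i \<in> IC"
        "\<And>i. i \<le> n \<Longrightarrow> \<phi> (c i) = b i - u * b (Suc i)"
      using R.integral_quotient_coeffs[of n "\<lambda>i. \<phi> (c i)" u] c(2) by blast
    have "b k \<notin> p \<or> u * b (Suc k) \<notin> p"
    proof (rule ccontr)
      assume "\<not> ?thesis"
      then have k': "b k \<in> p" "u * b (Suc k) \<in> p" by blast+
      have "- 1 \<in> IC" by auto
      then have "b k + (- 1) * (u * b (Suc k)) \<in> p" using pp(4)[OF k'(1) pp(5)[OF _ k'(2)]] by blast
      then show False using b(3)[OF k(1)] k(2) by simp
    qed
    then show ?thesis
    proof
      assume "b k \<notin> p"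
      moreover from this have "b k \<noteq> 0" using pp(2) by auto
      ultimately show ?thesis using LI[OF b(2) b(1), of k k] by simp
    next
      assume n: "u * b (Suc k) \<notin> p"
      then have "u * b (Suc k) \<noteq> 0" using pp(2) by auto
      then have "b (Suc k) / (u * b (Suc k)) = inverse u" by (simp add: field_simps)
      then show ?thesis using LI[OF b(1) b(2) n, of "Suc k"] by metis
    qed
  qed
  have inv_L: "inverse z \<notin> L" if z: "z \<in> p" "z \<noteq> 0" for z
  proof
    assume "inverse z \<in> L"
    then obtain b s where bs: "inverse z = b / s" "b \<in> IC" "s \<in> IC" "s \<notin> p" by (auto simp: L_def)
    then have "s \<noteq> 0" using pp(2) by auto
    then have "s = b * z" using bs(1) z(2) by (simp add: field_simps)
    then show False using pp(5)[OF bs(2) z(1)] bs(4) by simp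
  qed
  have "\<exists>z\<in>p. z \<noteq> 0"
  proof (rule ccontr)
    assume z: "\<not> ?thesis"
    let ?y = "\<phi> [:0, 1:]"
    have y0: "?y \<noteq> 0" by simp
    have "\<exists>b\<in>IC. ?y * b = 1"
    proof -
      let ?J = "(\<lambda>b. ?y * b) ` IC"
      have J: "ideal ?J (ring_on IC)"
        unfolding IC.ideal_ring_on_iff
      proof (intro conjI ballI)
        show "?J \<subseteq> IC" using phi_mem_IC by blast
        show "0 \<in> ?J" by (intro image_eqI[of _ _ 0]) auto
        show "a + b \<in> ?J" if "a \<in> ?J" "b \<in> ?J" for a b
          using that by (auto simp: image_iff simp flip: distrib_left)
        show "c * a \<in> ?J" if ca: "c \<in> IC" "a \<in> ?J" for c a
        proof -
          obtain b where "b \<in> IC" "a = ?y * b" using ca by blast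
          then show ?thesis using ca by (intro image_eqI[of _ _ "c * b"]) auto
        qed
      qed
      have "p \<subseteq> ?J" using z J unfolding IC.ideal_ring_on_iff by auto
      moreover have "?J \<subseteq> carrier (ring_on IC)" using J unfolding IC.ideal_ring_on_iff by auto
      moreover have "?J \<noteq> p"
      proof -
        have "?y \<in> ?J" by (intro image_eqI[of _ _ 1]) auto
        then show ?thesis using z y0 by blast
      qed
      ultimately have "?J = IC" using maximalideal.I_maximal[OF p J] by simp
      then have "1 \<in> ?J" by blast
      then show ?thesis by auto
    qed
    then have "inverse ?y \<in> IC" using inverse_unique by metis
    then show False using IC_not_field by blast
  qed
  then have "L \<noteq> UNIV" using inv_L by blast
  then have "L \<in> places \<iota>"
    using tot L.field_subring_axioms phi_mem_IC IC_L
    by (auto simp: places_def const_field_def field_subring_iff simp flip: phi_const)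
  then have fp: "chart_place \<iota> \<phi> L" using phi_mem_IC IC_L by (intro chart_placeI) auto
  moreover have "max_ideal L \<inter> IC = p"
  proof (intro equalityI subsetI)
    fix z assume "z \<in> p"
    then show "z \<in> max_ideal L \<inter> IC" using inv_L pp(1) IC_L by (auto simp: max_ideal_def)
  next
    fix z assume z: "z \<in> max_ideal L \<inter> IC"
    show "z \<in> p"
    proof (rule ccontr)
      assume n: "z \<notin> p"
      then have "1 / z \<in> L" "z \<noteq> 0" using z pp(2) by (auto intro!: LI)
      then show False using z by (auto simp: max_ideal_def divide_inverse)
    qed
  qed
  ultimately show ?thesis by blast
qed

lemma centre_maximal:
  assumes P: "chart_place \<iota> \<phi> P"
  shows "maximalideal (max_ideal P \<inter> IC) (ring_on IC)"
proof -
  interpret P: chart_place \<iota> \<phi> P by fact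
  have id: "ideal (max_ideal P \<inter> IC) (ring_on IC)"
    unfolding IC.ideal_ring_on_iff
    using P.max_add P.max_mult' P.integral_subset by auto
  then obtain p where p: "maximalideal p (ring_on IC)" "max_ideal P \<inter> IC \<subseteq> p"
    using IC.exists_maximalideal[OF id] by auto
  then obtain Q where Q: "chart_place \<iota> \<phi> Q" "max_ideal Q \<inter> IC = p"
    using place_of_maximalideal by blast
  have "P = Q"
  proof (rule ccontr)
    assume "P \<noteq> Q"
    then obtain b where "b \<in> IC" "b \<in> max_ideal P" "b \<notin> max_ideal Q"
      using separating_element[OF Q(1) P] by blast
    then show False using p Q by blast
  qed
  with p Q show ?thesis by simp
qed

lemma centre_inject:
  assumes "chart_place \<iota> \<phi> P" "chart_place \<iota> \<phi> Q" "max_ideal P \<inter> IC = max_ideal Q \<inter> IC"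
  shows "P = Q"
  using separating_element[OF assms(1,2)] assms(3) by blast

lemma finite_val_nonzero:
  assumes "z \<noteq> 0"
  shows "finite {P \<in> Pl. val P z \<noteq> 0}"
proof -
  have "{P \<in> Pl. val P z \<noteq> 0} \<subseteq> {P. chart_place \<iota> \<phi> P \<and> z \<in> max_ideal P} \<union>
      {P. chart_place \<iota> \<phi> P \<and> inverse z \<in> max_ideal P}"
  proof
    fix P assume "P \<in> {P \<in> Pl. val P z \<noteq> 0}"
    then interpret chart_place \<iota> \<phi> P by simp
    show "P \<in> {P. chart_place \<iota> \<phi> P \<and> z \<in> max_ideal P} \<union>
      {P. chart_place \<iota> \<phi> P \<and> inverse z \<in> max_ideal P}"
      using \<open>P \<in> _\<close> val_inverse[OF assms] by (auto simp: max_iff assms)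
  qed
  then show ?thesis
    using finite_places_above assms by (rule_tac finite_subset) auto
qed

text \<open>
  An element with prescribed valuation at \<open>P\<close> and given lower bounds elsewhere: an element \<open>w\<close> of the
  right valuation at \<open>P\<close> is corrected at the finitely many places where it is too small by a high
  power of a product of separating elements, which are units at \<open>P\<close>.
\<close>

lemma approximation:
  assumes fin: "finite {Q \<in> Pl. e Q \<noteq> (0::int)}" and P: "P \<in> Pl"
  shows "\<exists>z. z \<noteq> 0 \<and> val P z = e P \<and> (\<forall>Q\<in>Pl. e Q \<le> val Q z)"
proof -
  interpret P: chart_place \<iota> \<phi> P using P by simp
  obtain w where w: "w \<noteq> 0" "val P w = e P" using P.val_surj by blast
  define S where "S = {Q \<in> Pl. Q \<noteq> P \<and> val Q w < e Q}"
  have "finite ({Q \<in> Pl. e Q \<noteq> 0} \<union> {Q \<in> Pl. val Q w \<noteq> 0})" using fin finite_val_nonzero[OF w(1)] by blast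
  then have finS: "finite S" by (rule finite_subset[rotated]) (auto simp: S_def)
  have "\<forall>Q\<in>S. \<exists>b\<in>IC. b \<in> max_ideal Q \<and> b \<notin> max_ideal P"
    using separating_element[of P] P by (auto simp: S_def)
  then obtain b where b: "\<And>Q. Q \<in> S \<Longrightarrow> b Q \<in> IC \<and> b Q \<in> max_ideal Q \<and> b Q \<notin> max_ideal P" by metis
  \<comment> \<open>Each factor \<open>c\<close> gains at least \<open>1\<close> at every place of \<open>S\<close>, so \<open>c\<^sup>N\<close> makes up for all deficits.\<close>
  define N where "N = (\<Sum>Q\<in>S. nat (e Q - val Q w))"
  define c where "c = prod b S"
  have b0: "b Q \<noteq> 0" if "Q \<in> S" for Q using b[OF that] by auto
  have c0: "c \<noteq> 0" using finS b0 by (simp add: c_def)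
  have vb: "0 \<le> val Q (b T)" if "Q \<in> Pl" "T \<in> S" for Q T
  proof -
    interpret Q: chart_place \<iota> \<phi> Q using that by simp
    show ?thesis using b[OF that(2)] b0[OF that(2)] Q.integral_subset Q.mem_iff by blast
  qed
  have vc: "val Q c = (\<Sum>T\<in>S. val Q (b T))" if "Q \<in> Pl" for Q
  proof -
    interpret Q: chart_place \<iota> \<phi> Q using that by simp
    show ?thesis unfolding c_def using finS b0 by (intro Q.val_prod)
  qed
  have "val P c = 0"
  proof -
    have "val P (b T) = 0" if "T \<in> S" for T
      using vb[OF P that] b[OF that] P.max_iff[of "b T"] by auto
    then show ?thesis by (simp add: vc[OF P])
  qed
  have vz: "val Q (w * c ^ N) = val Q w + int N * val Q c" if "Q \<in> Pl" for Q
  proof -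
    interpret Q: chart_place \<iota> \<phi> Q using that by simp
    show ?thesis using w(1) c0 by (simp add: Q.val_mult Q.val_power)
  qed
  have "e Q \<le> val Q (w * c ^ N)" if Q: "Q \<in> Pl" for Q
  proof (cases "Q \<in> S")
    case True
    interpret Q: chart_place \<iota> \<phi> Q using Q by simp
    have "val Q (b Q) \<le> val Q c"
      unfolding vc[OF Q] using vb[OF Q] finS True by (intro member_le_sum) auto
    moreover have "1 \<le> val Q (b Q)" using b[OF True] b0[OF True] Q.max_iff[of "b Q"] by simp
    ultimately have "1 \<le> val Q c" by simp
    then have "int N \<le> int N * val Q c" by (simp add: mult_le_cancel_left1)
    moreover have "nat (e Q - val Q w) \<le> N"
      unfolding N_def using finS True by (intro member_le_sum) auto
    ultimately show ?thesis unfolding vz[OF Q] by linarith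
  next
    case False
    have "0 \<le> val Q c" unfolding vc[OF Q] using vb[OF Q] by (intro sum_nonneg)
    moreover have "e Q \<le> val Q w" using False Q w(2) by (cases "Q = P") (auto simp: S_def)
    ultimately show ?thesis unfolding vz[OF Q] by (simp add: add_increasing2)
  qed
  moreover have "val P (w * c ^ N) = e P" using vz[OF P] \<open>val P c = 0\<close> w by simp
  ultimately show ?thesis using w(1) c0 by (intro exI[of _ "w * c ^ N"]) auto
qed

section \<open>Fractional ideals\<close>

text \<open>
  The order of a fractional ideal at a place: the least valuation of its nonzero elements.
\<close>

definition frac_ord :: "'K set \<Rightarrow> 'K set \<Rightarrow> int" where
  "frac_ord P I = (THE n. (\<exists>a\<in>I. a \<noteq> 0 \<and> val P a = n) \<and> (\<forall>a\<in>I. a \<noteq> 0 \<longrightarrow> n \<le> val P a))"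

lemma frac_ord_eqI:
  assumes "a \<in> I" "a \<noteq> 0" "\<And>b. b \<in> I \<Longrightarrow> b \<noteq> 0 \<Longrightarrow> val P a \<le> val P b"
  shows "frac_ord P I = val P a"
  unfolding frac_ord_def using assms by (intro the_equality) (auto intro: antisym)

lemma frac_ord_attained:
  assumes I: "fractional_ideal IC I" and P: "P \<in> Pl"
  shows "\<exists>a\<in>I. a \<noteq> 0 \<and> val P a = frac_ord P I \<and> (\<forall>b\<in>I. b \<noteq> 0 \<longrightarrow> val P a \<le> val P b)"
proof -
  interpret P: chart_place \<iota> \<phi> P using P by simp
  obtain a0 where a0: "a0 \<in> I" "a0 \<noteq> 0" using I by (auto simp: fractional_ideal_def)
  obtain d where d: "d \<in> IC" "d \<noteq> 0" "\<And>a. a \<in> I \<Longrightarrow> d * a \<in> IC" using I by (auto simp: fractional_ideal_def)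
  have low: "- val P d \<le> val P a" if "a \<in> I" "a \<noteq> 0" for a
  proof -
    have "d * a \<in> P" using d that P.integral_subset by blast
    then show ?thesis using P.val_mult[of d a] d that by (auto simp: P.mem_iff)
  qed
  from a0 have "a0 \<in> I \<and> a0 \<noteq> 0" by blast
  from ex_has_least_nat[of "\<lambda>a. a \<in> I \<and> a \<noteq> 0", OF this, of "\<lambda>a. nat (val P a + val P d)"]
  obtain a where a: "a \<in> I" "a \<noteq> 0"
    "\<And>b. b \<in> I \<Longrightarrow> b \<noteq> 0 \<Longrightarrow> nat (val P a + val P d) \<le> nat (val P b + val P d)" by auto
  have "val P a \<le> val P b" if "b \<in> I" "b \<noteq> 0" for b
    using a(3)[OF that] low[OF that] low[OF a(1,2)] by linarith
  with a frac_ord_eqI[of a I P] show ?thesis by (intro bexI[of _ a]) auto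
qed

lemma frac_ord_le:
  assumes "fractional_ideal IC I" "P \<in> Pl" "b \<in> I" "b \<noteq> 0"
  shows "frac_ord P I \<le> val P b"
  using frac_ord_attained[OF assms(1,2)] assms(3,4) by metis

lemma zero_mem_fractional_ideal: "fractional_ideal IC I \<Longrightarrow> 0 \<in> I"
  unfolding fractional_ideal_def using IC.zero_mem by (metis mult_zero_left)

text \<open>
  A fractional ideal \<open>I\<close> is determined by local conditions. If \<open>z\<close> satisfies them, the ideal
  \<open>(I : z)\<close> lies in no maximal ideal, because \<open>z\<close> is at each place a multiple of an element of \<open>I\<close>
  of least valuation.
\<close>

lemma fractional_ideal_mem_iff:
  assumes I: "fractional_ideal IC I"
  shows "z \<in> I \<longleftrightarrow> z = 0 \<or> (\<forall>P\<in>Pl. frac_ord P I \<le> val P z)"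
proof
  assume "z \<in> I"
  then show "z = 0 \<or> (\<forall>P\<in>Pl. frac_ord P I \<le> val P z)" using frac_ord_le[OF I] by blast
next
  assume z: "z = 0 \<or> (\<forall>P\<in>Pl. frac_ord P I \<le> val P z)"
  show "z \<in> I"
  proof (cases "z = 0")
    case True
    then show ?thesis using zero_mem_fractional_ideal[OF I] by simp
  next
    case z0: False
    have Iadd: "a + b \<in> I" if "a \<in> I" "b \<in> I" for a b using I that by (auto simp: fractional_ideal_def)
    have Imul: "c * a \<in> I" if "c \<in> IC" "a \<in> I" for a c using I that by (auto simp: fractional_ideal_def)
    define J where "J = {b \<in> IC. b * z \<in> I}"
    have J: "ideal J (ring_on IC)"
      unfolding IC.ideal_ring_on_iff J_def
      using zero_mem_fractional_ideal[OF I] Iadd Imul by (auto simp: distrib_right mult.assoc)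
    have "1 \<in> J"
    proof (rule ccontr)
      assume "1 \<notin> J"
      then obtain p where p: "maximalideal p (ring_on IC)" "J \<subseteq> p"
        using IC.exists_maximalideal[OF J] by blast
      obtain P where P: "chart_place \<iota> \<phi> P" "max_ideal P \<inter> IC = p"
        using place_of_maximalideal[OF p(1)] by blast
      interpret P: chart_place \<iota> \<phi> P by fact
      obtain a where a: "a \<in> I" "a \<noteq> 0" "val P a = frac_ord P I"
        using frac_ord_attained[OF I] P by blast
      have "val P a \<le> val P z" using z z0 a P by auto
      then have "z / a \<in> P"
        using a(2) z0 P.val_mult[of "z / a" a] by (auto simp: P.mem_iff)
      then obtain b where b: "b \<in> IC" "b \<notin> max_ideal P" "z / a * b \<in> IC" using P.localization by blast
      have "z / a * b * a \<in> I" using Imul b(3) a(1) by blast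
      moreover have "z / a * b * a = b * z" using a(2) by simp
      ultimately have "b \<in> J" using b(1) by (simp add: J_def)
      then show False using p(2) P(2) b(2) by blast
    qed
    then show ?thesis by (simp add: J_def)
  qed
qed

lemma fractional_ideal_eqI:
  assumes "fractional_ideal IC I" "fractional_ideal IC J"
    "\<And>P. P \<in> Pl \<Longrightarrow> frac_ord P I = frac_ord P J"
  shows "I = J"
proof (rule Set.set_eqI)
  fix z
  show "z \<in> I \<longleftrightarrow> z \<in> J"
    unfolding fractional_ideal_mem_iff[OF assms(1)] fractional_ideal_mem_iff[OF assms(2)]
    using assms(3) by simp
qed

lemma fractional_ideal_IC: "fractional_ideal IC IC"
  unfolding fractional_ideal_def by (auto intro!: bexI[of _ 1])

lemma frac_ord_IC:
  assumes "P \<in> Pl" shows "frac_ord P IC = 0"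
proof -
  interpret P: chart_place \<iota> \<phi> P using assms by simp
  have "0 \<le> val P b" if "b \<in> IC" "b \<noteq> 0" for b
    using P.integral_subset that P.mem_iff by blast
  then show ?thesis using frac_ord_eqI[of 1 IC P] by auto
qed

lemma IC_mem_iff: "z \<in> IC \<longleftrightarrow> z = 0 \<or> (\<forall>P\<in>Pl. 0 \<le> val P z)"
  using fractional_ideal_mem_iff[OF fractional_ideal_IC] frac_ord_IC by simp

lemma finite_frac_ord:
  assumes I: "fractional_ideal IC I"
  shows "finite {P \<in> Pl. frac_ord P I \<noteq> 0}"
proof -
  obtain a where a: "a \<in> I" "a \<noteq> 0" using I by (auto simp: fractional_ideal_def)
  obtain d where d: "d \<in> IC" "d \<noteq> 0" "\<And>a. a \<in> I \<Longrightarrow> d * a \<in> IC" using I by (auto simp: fractional_ideal_def)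
  have "finite ({P \<in> Pl. val P a \<noteq> 0} \<union> {P \<in> Pl. val P d \<noteq> 0})"
    using finite_val_nonzero a d by blast
  moreover have "{P \<in> Pl. frac_ord P I \<noteq> 0} \<subseteq> {P \<in> Pl. val P a \<noteq> 0} \<union> {P \<in> Pl. val P d \<noteq> 0}"
  proof
    fix P assume P: "P \<in> {P \<in> Pl. frac_ord P I \<noteq> 0}"
    interpret P: chart_place \<iota> \<phi> P using P by simp
    obtain b where b: "b \<in> I" "b \<noteq> 0" "val P b = frac_ord P I" using frac_ord_attained[OF I] P by blast
    have "d * b \<in> P" using d(3) b P.integral_subset by blast
    then have "0 \<le> val P d + val P b" using P.val_mult[of d b] d(2) b(2) by (auto simp: P.mem_iff)
    moreover have "val P b \<le> val P a" using frac_ord_le[OF I _ a] P b by auto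
    ultimately show "P \<in> {P \<in> Pl. val P a \<noteq> 0} \<union> {P \<in> Pl. val P d \<noteq> 0}" using P b by auto
  qed
  ultimately show ?thesis by (rule finite_subset[rotated])
qed

lemma ideal_prod_fractional:
  assumes I: "fractional_ideal IC I" and J: "fractional_ideal IC J"
  shows "fractional_ideal IC (ideal_prod class_ring I J)"
proof -
  let ?IJ = "ideal_prod class_ring I J"
  obtain a b where ab: "a \<in> I" "a \<noteq> 0" "b \<in> J" "b \<noteq> 0" using I J by (auto simp: fractional_ideal_def)
  obtain d where d: "d \<in> IC" "d \<noteq> 0" "\<And>a. a \<in> I \<Longrightarrow> d * a \<in> IC" using I by (auto simp: fractional_ideal_def)
  obtain e where e: "e \<in> IC" "e \<noteq> 0" "\<And>a. a \<in> J \<Longrightarrow> e * a \<in> IC" using J by (auto simp: fractional_ideal_def)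
  have "d * e * s \<in> IC" if "s \<in> ?IJ" for s
    using that
  proof induction
    case (prod i j)
    then have "(d * i) * (e * j) \<in> IC" using d e by blast
    then show ?case by (simp add: mult_ac)
  next
    case (sum s t)
    then show ?case by (auto simp: distrib_left)
  qed
  moreover have "c * s \<in> ?IJ" if "c \<in> IC" "s \<in> ?IJ" for c s
    using that(2)
  proof induction
    case (prod i j)
    have "c * i \<in> I" using I that(1) prod by (auto simp: fractional_ideal_def)
    then have "(c * i) \<otimes>\<^bsub>class_ring\<^esub> j \<in> ?IJ" using prod by (intro ideal_prod.prod)
    then show ?case by (simp add: mult.assoc)
  next
    case (sum s t)
    then have "(c * s) \<oplus>\<^bsub>class_ring\<^esub> (c * t) \<in> ?IJ" by (intro ideal_prod.sum)
    then show ?case by (simp add: distrib_left)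
  qed
  moreover have "s + t \<in> ?IJ" if "s \<in> ?IJ" "t \<in> ?IJ" for s t
    using ideal_prod.sum[OF that] by simp
  moreover have "a * b \<in> ?IJ" using ideal_prod.prod[OF ab(1,3), of class_ring] by simp
  moreover have "a * b \<noteq> 0" using ab by simp
  moreover have "d * e \<in> IC" "d * e \<noteq> 0" using d e by auto
  ultimately show ?thesis unfolding fractional_ideal_def by blast
qed

lemma frac_ord_ideal_prod:
  assumes I: "fractional_ideal IC I" and J: "fractional_ideal IC J" and P: "P \<in> Pl"
  shows "frac_ord P (ideal_prod class_ring I J) = frac_ord P I + frac_ord P J"
proof -
  interpret P: chart_place \<iota> \<phi> P using P by simp
  obtain a where a: "a \<in> I" "a \<noteq> 0" "val P a = frac_ord P I" using frac_ord_attained[OF I P] by blast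
  obtain b where b: "b \<in> J" "b \<noteq> 0" "val P b = frac_ord P J" using frac_ord_attained[OF J P] by blast
  have "s = 0 \<or> frac_ord P I + frac_ord P J \<le> val P s" if "s \<in> ideal_prod class_ring I J" for s
    using that
  proof induction
    case (prod i j)
    show ?case
    proof (cases "i = 0 \<or> j = 0")
      case False
      then show ?thesis
        using frac_ord_le[OF I P, of i] frac_ord_le[OF J P, of j] prod P.val_mult[of i j] by auto
    qed auto
  next
    case (sum s t)
    then show ?case using P.val_add_ge by simp
  qed
  moreover have "a * b \<in> ideal_prod class_ring I J"
    using ideal_prod.prod[OF a(1) b(1), of class_ring] by simp
  ultimately have "frac_ord P (ideal_prod class_ring I J) = val P (a * b)"
    using a b by (intro frac_ord_eqI) (auto simp: P.val_mult)
  then show ?thesis using a b by (simp add: P.val_mult)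
qed

text \<open>
  The ideal with prescribed orders, which is fractional when \<open>e\<close> has finite support.
\<close>

definition ideal_of_ords :: "('K set \<Rightarrow> int) \<Rightarrow> 'K set" where
  "ideal_of_ords e = {z. z = 0 \<or> (\<forall>P\<in>Pl. e P \<le> val P z)}"

lemma ideal_of_ords_nonzero:
  assumes "finite {Q \<in> Pl. e Q \<noteq> (0::int)}"
  shows "\<exists>z. z \<noteq> 0 \<and> (\<forall>Q\<in>Pl. e Q \<le> val Q z)"
proof (cases "Pl = {}")
  case True
  show ?thesis unfolding True by (intro exI[of _ 1]) simp
next
  case False
  then show ?thesis using approximation[OF assms] by blast
qed

lemma fractional_ideal_of_ords:
  assumes fin: "finite {Q \<in> Pl. e Q \<noteq> (0::int)}"
  shows "fractional_ideal IC (ideal_of_ords e)"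
  unfolding fractional_ideal_def
proof (intro conjI ballI)
  fix a b assume ab: "a \<in> ideal_of_ords e" "b \<in> ideal_of_ords e"
  have "a + b = 0 \<or> e P \<le> val P (a + b)" if "P \<in> Pl" for P
  proof -
    interpret P: chart_place \<iota> \<phi> P using that by simp
    show ?thesis using ab that by (intro P.val_add_ge) (auto simp: ideal_of_ords_def)
  qed
  then show "a + b \<in> ideal_of_ords e" by (auto simp: ideal_of_ords_def)
next
  fix c a assume c: "c \<in> IC" and a: "a \<in> ideal_of_ords e"
  have "c * a = 0 \<or> e P \<le> val P (c * a)" if "P \<in> Pl" for P
  proof (cases "c = 0 \<or> a = 0")
    case False
    interpret P: chart_place \<iota> \<phi> P using that by simp
    have "0 \<le> val P c" using c False that by (simp add: IC_mem_iff)
    moreover have "e P \<le> val P a" using a False that by (simp add: ideal_of_ords_def)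
    ultimately show ?thesis using False P.val_mult[of c a] by simp
  qed auto
  then show "c * a \<in> ideal_of_ords e" by (auto simp: ideal_of_ords_def)
next
  show "\<exists>a\<in>ideal_of_ords e. a \<noteq> 0"
    using ideal_of_ords_nonzero[OF fin] by (auto simp: ideal_of_ords_def)
next
  have "finite {Q \<in> Pl. max 0 (- e Q) \<noteq> 0}"
    by (rule finite_subset[OF _ fin]) (auto simp: max_def)
  then obtain d where d: "d \<noteq> 0" "\<And>Q. Q \<in> Pl \<Longrightarrow> max 0 (- e Q) \<le> val Q d"
    using ideal_of_ords_nonzero[of "\<lambda>Q. max 0 (- e Q)"] by blast
  have "d \<in> IC" using d by (auto simp: IC_mem_iff)
  moreover have "d * a \<in> IC" if "a \<in> ideal_of_ords e" for a
  proof (cases "a = 0")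
    case False
    have "0 \<le> val P (d * a)" if P: "P \<in> Pl" for P
    proof -
      interpret P: chart_place \<iota> \<phi> P using P by simp
      have "e P \<le> val P a" using \<open>a \<in> _\<close> False P by (simp add: ideal_of_ords_def)
      then show ?thesis using d(2)[OF P] P.val_mult[OF d(1) False] by simp
    qed
    then show ?thesis by (auto simp: IC_mem_iff)
  qed auto
  ultimately show "\<exists>d\<in>IC. d \<noteq> 0 \<and> (\<forall>a\<in>ideal_of_ords e. d * a \<in> IC)" using d(1) by blast
qed

lemma frac_ord_ideal_of_ords:
  assumes fin: "finite {Q \<in> Pl. e Q \<noteq> (0::int)}" and P: "P \<in> Pl"
  shows "frac_ord P (ideal_of_ords e) = e P"
proof -
  obtain z where z: "z \<noteq> 0" "val P z = e P" "\<forall>Q\<in>Pl. e Q \<le> val Q z"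
    using approximation[OF fin P] by blast
  have "frac_ord P (ideal_of_ords e) = val P z"
    using z P by (intro frac_ord_eqI) (auto simp: ideal_of_ords_def)
  then show ?thesis using z by simp
qed

text \<open>
  The group laws hold because they hold for the orders, which are additive.
\<close>

lemma comm_group_frac_ideals: "comm_group (frac_ideals IC)"
proof (rule comm_groupI)
  let ?G = "frac_ideals IC"
  show "x \<otimes>\<^bsub>?G\<^esub> y \<in> carrier ?G" if "x \<in> carrier ?G" "y \<in> carrier ?G" for x y
    using that ideal_prod_fractional by (simp add: frac_ideals_def)
  show "\<one>\<^bsub>?G\<^esub> \<in> carrier ?G" using fractional_ideal_IC by (simp add: frac_ideals_def)
  show "x \<otimes>\<^bsub>?G\<^esub> y \<otimes>\<^bsub>?G\<^esub> z = x \<otimes>\<^bsub>?G\<^esub> (y \<otimes>\<^bsub>?G\<^esub> z)"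
    if "x \<in> carrier ?G" "y \<in> carrier ?G" "z \<in> carrier ?G" for x y z
    using that unfolding frac_ideals_def monoid.simps partial_object.simps mem_Collect_eq
    by (intro fractional_ideal_eqI) (simp_all add: ideal_prod_fractional frac_ord_ideal_prod)
  show "x \<otimes>\<^bsub>?G\<^esub> y = y \<otimes>\<^bsub>?G\<^esub> x" if "x \<in> carrier ?G" "y \<in> carrier ?G" for x y
    using that unfolding frac_ideals_def monoid.simps partial_object.simps mem_Collect_eq
    by (intro fractional_ideal_eqI) (simp_all add: ideal_prod_fractional frac_ord_ideal_prod)
  show "\<one>\<^bsub>?G\<^esub> \<otimes>\<^bsub>?G\<^esub> x = x" if "x \<in> carrier ?G" for x
    using that unfolding frac_ideals_def monoid.simps partial_object.simps mem_Collect_eq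
    by (intro fractional_ideal_eqI)
      (simp_all add: ideal_prod_fractional frac_ord_ideal_prod fractional_ideal_IC frac_ord_IC)
  show "\<exists>y\<in>carrier ?G. y \<otimes>\<^bsub>?G\<^esub> x = \<one>\<^bsub>?G\<^esub>" if "x \<in> carrier ?G" for x
  proof -
    have x: "fractional_ideal IC x" using that by (simp add: frac_ideals_def)
    let ?y = "ideal_of_ords (\<lambda>P. - frac_ord P x)"
    have fin: "finite {Q \<in> Pl. - frac_ord Q x \<noteq> 0}" using finite_frac_ord[OF x] by simp
    have y: "fractional_ideal IC ?y" by (rule fractional_ideal_of_ords[OF fin])
    have "ideal_prod class_ring ?y x = IC"
      using x y frac_ord_ideal_of_ords[OF fin]
      by (intro fractional_ideal_eqI)
        (auto simp: ideal_prod_fractional frac_ord_ideal_prod fractional_ideal_IC frac_ord_IC)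
    then show ?thesis using y by (intro bexI[of _ ?y]) (auto simp: frac_ideals_def)
  qed
qed

sublocale G: comm_group "frac_ideals IC" by (rule comm_group_frac_ideals)

lemma carrier_frac_ideals: "I \<in> carrier (frac_ideals IC) \<longleftrightarrow> fractional_ideal IC I"
  by (simp add: frac_ideals_def)

lemma frac_ord_mult:
  assumes "I \<in> carrier (frac_ideals IC)" "J \<in> carrier (frac_ideals IC)" "P \<in> Pl"
  shows "frac_ord P (I \<otimes>\<^bsub>frac_ideals IC\<^esub> J) = frac_ord P I + frac_ord P J"
  using frac_ord_ideal_prod assms by (simp add: frac_ideals_def)

lemma frac_ord_unit: "P \<in> Pl \<Longrightarrow> frac_ord P \<one>\<^bsub>frac_ideals IC\<^esub> = 0"
  using frac_ord_IC by (simp add: frac_ideals_def)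

lemma frac_ord_inv:
  assumes "I \<in> carrier (frac_ideals IC)" "P \<in> Pl"
  shows "frac_ord P (inv\<^bsub>frac_ideals IC\<^esub> I) = - frac_ord P I"
  using frac_ord_mult[of I "inv\<^bsub>frac_ideals IC\<^esub> I" P] frac_ord_unit[of P] assms by simp

lemma frac_ord_nat_pow:
  assumes "I \<in> carrier (frac_ideals IC)" "P \<in> Pl"
  shows "frac_ord P (I [^]\<^bsub>frac_ideals IC\<^esub> (n::nat)) = int n * frac_ord P I"
  using assms by (induction n) (auto simp: frac_ord_mult frac_ord_unit algebra_simps)

lemma frac_ord_int_pow:
  assumes "I \<in> carrier (frac_ideals IC)" "P \<in> Pl"
  shows "frac_ord P (I [^]\<^bsub>frac_ideals IC\<^esub> (k::int)) = k * frac_ord P I"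
proof (cases "k < 0")
  case True
  have "frac_ord P (I [^]\<^bsub>frac_ideals IC\<^esub> k) = - frac_ord P (I [^]\<^bsub>frac_ideals IC\<^esub> nat (- k))"
    unfolding int_pow_def2 if_P[OF True] by (rule frac_ord_inv[OF G.nat_pow_closed[OF assms(1)] assms(2)])
  then show ?thesis using True frac_ord_nat_pow[OF assms, of "nat (- k)"] by simp
next
  case False
  then have "I [^]\<^bsub>frac_ideals IC\<^esub> k = I [^]\<^bsub>frac_ideals IC\<^esub> nat k" by (simp only: int_pow_def2 if_False)
  then show ?thesis using False frac_ord_nat_pow[OF assms, of "nat k"] by simp
qed

lemma frac_ord_finprod:
  assumes "finite A" "f \<in> A \<rightarrow> carrier (frac_ideals IC)" "P \<in> Pl"
  shows "frac_ord P (finprod (frac_ideals IC) f A) = (\<Sum>i\<in>A. frac_ord P (f i))"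
  using assms(1,2)
  by (induction A rule: finite_induct) (auto simp: frac_ord_mult[OF _ _ assms(3)] frac_ord_unit[OF assms(3)] G.finprod_closed)

lemma centre_fractional:
  assumes P: "P \<in> Pl"
  shows "fractional_ideal IC (max_ideal P \<inter> IC)"
    and "Q \<in> Pl \<Longrightarrow> frac_ord Q (max_ideal P \<inter> IC) = (if Q = P then 1 else 0)"
proof -
  let ?e = "\<lambda>Q. if Q = P then 1 else (0::int)"
  have fin: "finite {Q \<in> Pl. ?e Q \<noteq> 0}" by (rule finite_subset[of _ "{P}"]) auto
  interpret P: chart_place \<iota> \<phi> P using P by simp
  have "max_ideal P \<inter> IC = ideal_of_ords ?e"
  proof (rule Set.set_eqI)
    fix z
    have "(\<forall>Q\<in>Pl. ?e Q \<le> val Q z) \<longleftrightarrow> 1 \<le> val P z \<and> (\<forall>Q\<in>Pl. 0 \<le> val Q z)"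
    proof safe
      assume *: "\<forall>Q\<in>Pl. ?e Q \<le> val Q z"
      show "1 \<le> val P z" using bspec[OF * P] by simp
      fix Q assume "chart_place \<iota> \<phi> Q"
      then have "?e Q \<le> val Q z" using * by simp
      moreover have "0 \<le> ?e Q" by simp
      ultimately show "0 \<le> val Q z" by (rule order_trans[rotated])
    qed auto
    then show "z \<in> max_ideal P \<inter> IC \<longleftrightarrow> z \<in> ideal_of_ords ?e"
      unfolding ideal_of_ords_def by (auto simp: P.max_iff IC_mem_iff)
  qed
  then show "fractional_ideal IC (max_ideal P \<inter> IC)"
    "Q \<in> Pl \<Longrightarrow> frac_ord Q (max_ideal P \<inter> IC) = (if Q = P then 1 else 0)"
    using fractional_ideal_of_ords[OF fin] frac_ord_ideal_of_ords[OF fin] by simp_all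
qed

text \<open>
  The order of a product of powers of maximal ideals at a place is the exponent of its centre.
\<close>

lemma frac_ord_prime_powers:
  assumes e: "\<forall>p. e p \<noteq> 0 \<longrightarrow> maximalideal p (ring_on IC)" "finite {p. e p \<noteq> (0::int)}"
  shows "finprod (frac_ideals IC) (\<lambda>p. p [^]\<^bsub>frac_ideals IC\<^esub> e p) {p. e p \<noteq> 0} \<in> carrier (frac_ideals IC)"
    and "Q \<in> Pl \<Longrightarrow> frac_ord Q (finprod (frac_ideals IC) (\<lambda>p. p [^]\<^bsub>frac_ideals IC\<^esub> e p) {p. e p \<noteq> 0})
      = e (max_ideal Q \<inter> IC)"
proof -
  have car: "p \<in> carrier (frac_ideals IC)" if "e p \<noteq> 0" for p
    using e(1) place_of_maximalideal[of p] centre_fractional(1) that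
    by (auto simp: carrier_frac_ideals)
  then have fc: "(\<lambda>p. p [^]\<^bsub>frac_ideals IC\<^esub> e p) \<in> {p. e p \<noteq> 0} \<rightarrow> carrier (frac_ideals IC)" by auto
  then show "finprod (frac_ideals IC) (\<lambda>p. p [^]\<^bsub>frac_ideals IC\<^esub> e p) {p. e p \<noteq> 0} \<in> carrier (frac_ideals IC)"
    by (rule G.finprod_closed)
  assume Q: "Q \<in> Pl"
  have "frac_ord Q (finprod (frac_ideals IC) (\<lambda>p. p [^]\<^bsub>frac_ideals IC\<^esub> e p) {p. e p \<noteq> 0})
      = (\<Sum>p | e p \<noteq> 0. frac_ord Q (p [^]\<^bsub>frac_ideals IC\<^esub> e p))"
    by (rule frac_ord_finprod[OF e(2) fc Q])
  also have "\<dots> = (\<Sum>p | e p \<noteq> 0. if p = max_ideal Q \<inter> IC then e p else 0)"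
  proof (rule sum.cong)
    fix p assume "p \<in> {p. e p \<noteq> 0}"
    then have p: "e p \<noteq> 0" by simp
    obtain P where P: "P \<in> Pl" "max_ideal P \<inter> IC = p" using place_of_maximalideal[of p] e(1) p by auto
    have "frac_ord Q (p [^]\<^bsub>frac_ideals IC\<^esub> e p) = e p * frac_ord Q p"
      by (rule frac_ord_int_pow[OF car[OF p] Q])
    also have "frac_ord Q p = (if Q = P then 1 else 0)"
      using centre_fractional(2)[OF P(1) Q] P(2) by simp
    also have "Q = P \<longleftrightarrow> p = max_ideal Q \<inter> IC" using centre_inject P Q by auto
    finally show "frac_ord Q (p [^]\<^bsub>frac_ideals IC\<^esub> e p) = (if p = max_ideal Q \<inter> IC then e p else 0)" by simp
  qed simp
  also have "\<dots> = e (max_ideal Q \<inter> IC)" using e(2) by simp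
  finally show "frac_ord Q (finprod (frac_ideals IC) (\<lambda>p. p [^]\<^bsub>frac_ideals IC\<^esub> e p) {p. e p \<noteq> 0})
      = e (max_ideal Q \<inter> IC)" .
qed

lemma ideal_factorization_exponent:
  assumes "ideal_factorization IC I e" "P \<in> Pl"
  shows "e (max_ideal P \<inter> IC) = frac_ord P I"
  using assms frac_ord_prime_powers(2)[of e P] by (simp add: ideal_factorization_def)

lemma ideal_factorization_unique:
  assumes "ideal_factorization IC I e" "ideal_factorization IC I e'"
  shows "e = e'"
proof
  fix p
  show "e p = e' p"
  proof (cases "maximalideal p (ring_on IC)")
    case True
    then obtain P where "P \<in> Pl" "max_ideal P \<inter> IC = p" using place_of_maximalideal[of p] by auto
    then show ?thesis using ideal_factorization_exponent assms by metis
  next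
    case False
    then show ?thesis using assms unfolding ideal_factorization_def by metis
  qed
qed

lemma ideal_factorization_exists:
  assumes I: "fractional_ideal IC I"
  shows "\<exists>e. ideal_factorization IC I e"
proof -
  define c where "c P = max_ideal P \<inter> IC" for P
  have inj: "inj_on c Pl" using centre_inject by (auto simp: inj_on_def c_def)
  define e where "e p = (if p \<in> c ` Pl then frac_ord (the_inv_into Pl c p) I else 0)" for p
  have ec: "e (c P) = frac_ord P I" if "P \<in> Pl" for P
    using that the_inv_into_f_f[OF inj that] by (auto simp: e_def)
  have max: "\<forall>p. e p \<noteq> 0 \<longrightarrow> maximalideal p (ring_on IC)"
    using centre_maximal by (auto simp: e_def c_def split: if_splits)
  have "{p. e p \<noteq> 0} \<subseteq> c ` {P \<in> Pl. frac_ord P I \<noteq> 0}"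
  proof
    fix p assume p: "p \<in> {p. e p \<noteq> 0}"
    then have "p \<in> c ` Pl" by (auto simp: e_def split: if_splits)
    then obtain P where P: "P \<in> Pl" "p = c P" by blast
    then show "p \<in> c ` {P \<in> Pl. frac_ord P I \<noteq> 0}" using p ec by auto
  qed
  then have fin: "finite {p. e p \<noteq> 0}" using finite_frac_ord[OF I] finite_surj by blast
  have "I = finprod (frac_ideals IC) (\<lambda>p. p [^]\<^bsub>frac_ideals IC\<^esub> e p) {p. e p \<noteq> 0}"
  proof (rule fractional_ideal_eqI[OF I])
    show "fractional_ideal IC (finprod (frac_ideals IC) (\<lambda>p. p [^]\<^bsub>frac_ideals IC\<^esub> e p) {p. e p \<noteq> 0})"
      using frac_ord_prime_powers(1)[OF max fin] by (simp only: carrier_frac_ideals)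
    show "frac_ord P I = frac_ord P (finprod (frac_ideals IC) (\<lambda>p. p [^]\<^bsub>frac_ideals IC\<^esub> e p) {p. e p \<noteq> 0})"
      if "P \<in> Pl" for P
      using frac_ord_prime_powers(2)[OF max fin that] ec[OF that] by (simp add: c_def)
  qed
  then have "ideal_factorization IC I e" unfolding ideal_factorization_def using max fin by blast
  then show ?thesis by blast
qed

lemma factorization_exponent:
  assumes "fractional_ideal IC I" "P \<in> Pl"
  shows "(THE e. ideal_factorization IC I e) (max_ideal P \<inter> IC) = frac_ord P I"
proof -
  obtain e where e: "ideal_factorization IC I e" using ideal_factorization_exists assms by blast
  then have "(THE e. ideal_factorization IC I e) = e" using ideal_factorization_unique by blast
  then show ?thesis using ideal_factorization_exponent[OF e assms(2)] by simp
qed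

lemma fractional_principal:
  assumes "a \<noteq> 0" shows "fractional_ideal IC ((\<lambda>y. a * y) ` IC)"
    and "P \<in> Pl \<Longrightarrow> frac_ord P ((\<lambda>y. a * y) ` IC) = val P a"
proof -
  let ?e = "\<lambda>P. val P a"
  have fin: "finite {Q \<in> Pl. ?e Q \<noteq> 0}" by (rule finite_val_nonzero[OF assms])
  have "(\<lambda>y. a * y) ` IC = ideal_of_ords ?e"
  proof (rule Set.set_eqI)
    fix z
    have "z \<in> (\<lambda>y. a * y) ` IC \<longleftrightarrow> z / a \<in> IC"
      using assms by (auto simp: image_iff) (metis nonzero_mult_div_cancel_left times_divide_eq_right)
    also have "\<dots> \<longleftrightarrow> z = 0 \<or> (\<forall>P\<in>Pl. 0 \<le> val P (z / a))"
      using assms by (simp add: IC_mem_iff)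
    also have "\<dots> \<longleftrightarrow> z = 0 \<or> (\<forall>P\<in>Pl. val P a \<le> val P z)"
    proof (cases "z = 0")
      case False
      have "val P (z / a) = val P z - val P a" if "P \<in> Pl" for P
      proof -
        interpret P: chart_place \<iota> \<phi> P using that by simp
        show ?thesis using P.val_mult[of "z / a" a] False assms by simp
      qed
      then show ?thesis by simp
    qed simp
    finally show "z \<in> (\<lambda>y. a * y) ` IC \<longleftrightarrow> z \<in> ideal_of_ords ?e" by (simp add: ideal_of_ords_def)
  qed
  then show "fractional_ideal IC ((\<lambda>y. a * y) ` IC)"
    "P \<in> Pl \<Longrightarrow> frac_ord P ((\<lambda>y. a * y) ` IC) = val P a"
    using fractional_ideal_of_ords[OF fin] frac_ord_ideal_of_ords[OF fin] by simp_all
qed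

end

section \<open>Matrices\<close>

text \<open>
  The matrix \<open>A\<close> with its \<open>j\<close>-th column multiplied by \<open>f j\<close>.
\<close>

definition scale_cols :: "'a::field mat \<Rightarrow> (nat \<Rightarrow> 'a) \<Rightarrow> 'a mat" where
  "scale_cols A f = mat (dim_row A) (dim_col A) (\<lambda>(i,j). f j * A $$ (i,j))"

lemma scale_cols_mat_diag:
  assumes "A \<in> carrier_mat m n"
  shows "scale_cols A f = A * mat_diag n f"
  using assms by (auto simp: scale_cols_def mat_diag_mult_right[OF assms] intro!: eq_matI)

lemma scale_cols_carrier [simp]: "A \<in> carrier_mat m n \<Longrightarrow> scale_cols A f \<in> carrier_mat m n"
  by (auto simp: scale_cols_def)

lemma det_mat_diag: "det (mat_diag n f) = (\<Prod>i<n. f i)"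
proof -
  have "det (mat_diag n f) = prod_list (diag_mat (mat_diag n f))"
    by (rule det_upper_triangular[of _ n]) (auto simp: mat_diag_def)
  also have "diag_mat (mat_diag n f) = map f [0..<n]"
    by (auto simp: diag_mat_def mat_diag_def)
  finally show ?thesis by (simp add: prod.list_conv_set_nth atLeast0LessThan)
qed

lemma det_scale_cols:
  assumes "A \<in> carrier_mat n n"
  shows "det (scale_cols A f) = det A * (\<Prod>i<n. f i)"
  by (simp add: scale_cols_mat_diag[OF assms] det_mult[OF assms] det_mat_diag)

lemma kronecker_scale_cols:
  "kronecker (scale_cols A f) (scale_cols B g)
    = scale_cols (kronecker A B) (\<lambda>j. f (j div dim_col B) * g (j mod dim_col B))"
proof (rule eq_matI)
  fix i j
  assume "i < dim_row (scale_cols (kronecker A B) (\<lambda>j. f (j div dim_col B) * g (j mod dim_col B)))"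
    "j < dim_col (scale_cols (kronecker A B) (\<lambda>j. f (j div dim_col B) * g (j mod dim_col B)))"
  then have ij: "i < dim_row A * dim_row B" "j < dim_col A * dim_col B"
    by (auto simp: scale_cols_def kronecker_def)
  then have pos: "0 < dim_row B" "0 < dim_col B" by (auto intro: gr0I)
  have lt: "i div dim_row B < dim_row A" "j div dim_col B < dim_col A"
    "i mod dim_row B < dim_row B" "j mod dim_col B < dim_col B"
    using ij pos by (auto simp: less_mult_imp_div_less)
  show "kronecker (scale_cols A f) (scale_cols B g) $$ (i, j)
      = scale_cols (kronecker A B) (\<lambda>j. f (j div dim_col B) * g (j mod dim_col B)) $$ (i, j)"
    using ij lt by (simp add: scale_cols_def kronecker_def mult_ac)
qed (auto simp: scale_cols_def kronecker_def)

lemma index_direct_sum_mat: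
  "dim_row (direct_sum_mat A B) = dim_row A + dim_row B"
  "dim_col (direct_sum_mat A B) = dim_col A + dim_col B"
  "i < dim_row A + dim_row B \<Longrightarrow> j < dim_col A + dim_col B \<Longrightarrow>
    direct_sum_mat A B $$ (i, j) =
      (if i < dim_row A then if j < dim_col A then A $$ (i, j) else 0
       else if j < dim_col A then 0 else B $$ (i - dim_row A, j - dim_col A))"
  by (auto simp: direct_sum_mat_def Let_def)

lemma direct_sum_scale_cols:
  "direct_sum_mat (scale_cols A f) (scale_cols B g)
    = scale_cols (direct_sum_mat A B) (\<lambda>j. if j < dim_col A then f j else g (j - dim_col A))"
  by (rule eq_matI) (auto simp: index_direct_sum_mat scale_cols_def)

lemma inverse_mat_unique:
  assumes "A \<in> carrier_mat n n" "B \<in> carrier_mat n n" "C \<in> carrier_mat n n"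
    "(B :: 'a::field mat) * A = 1\<^sub>m n" "A * C = 1\<^sub>m n"
  shows "B = C"
proof -
  have "B * (A * C) = (B * A) * C" by (rule assoc_mult_mat[OF assms(2,1,3), symmetric])
  then show ?thesis
    using assms(4,5) right_mult_one_mat[OF assms(2)] left_mult_one_mat[OF assms(3)] by metis
qed

lemma invertible_mat_det:
  assumes A: "(A :: 'a::field mat) \<in> carrier_mat n n"
  shows "invertible_mat A \<longleftrightarrow> det A \<noteq> 0"
proof
  assume "invertible_mat A"
  then obtain B where B: "A * B = 1\<^sub>m (dim_row A)" "B * A = 1\<^sub>m (dim_row B)"
    by (auto simp: invertible_mat_def inverts_mat_def)
  have "dim_col B = n" using arg_cong[OF B(1), of dim_col] A by simp
  moreover have "dim_row B = n" using arg_cong[OF B(2), of dim_col] A by simp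
  ultimately have "B \<in> carrier_mat n n" by auto
  then have "det A * det B = 1" using det_mult[OF A, of B] B A by simp
  then show "det A \<noteq> 0" by auto
next
  assume "det A \<noteq> 0"
  then obtain B where "B \<in> carrier_mat n n" "A * B = 1\<^sub>m n" "B * A = 1\<^sub>m n"
    using det_non_zero_imp_unit[OF A] by (auto simp: Units_def ring_mat_def)
  then show "invertible_mat A"
    using A unfolding invertible_mat_def inverts_mat_def by (intro conjI exI[of _ B]) auto
qed

lemma dual_mat_works:
  assumes A: "(A :: 'a::field mat) \<in> carrier_mat n n" and d: "det A \<noteq> 0"
  shows "dual_mat A \<in> carrier_mat n n" "dual_mat A * transpose_mat A = 1\<^sub>m n"
    "transpose_mat A * dual_mat A = 1\<^sub>m n"
proof -
  have tA: "transpose_mat A \<in> carrier_mat n n" using A by simp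
  have "det (transpose_mat A) \<noteq> 0" using d det_transpose[OF A] by simp
  then have "transpose_mat A \<in> Units (ring_mat TYPE('a) n ())" by (rule det_non_zero_imp_unit[OF tA])
  then obtain B where "mat_inverse (transpose_mat A) = Some B"
    using mat_inverse(1)[OF tA] by fastforce
  then show "dual_mat A \<in> carrier_mat n n" "dual_mat A * transpose_mat A = 1\<^sub>m n"
    "transpose_mat A * dual_mat A = 1\<^sub>m n"
    using mat_inverse(2)[OF tA, of B] by (simp_all add: dual_mat_def)
qed

lemma transpose_mat_diag: "transpose_mat (mat_diag n f) = mat_diag n f"
  by (auto simp: mat_diag_def intro!: eq_matI)

lemma dual_scale_cols:
  assumes A: "(A :: 'a::field mat) \<in> carrier_mat n n" and d: "det A \<noteq> 0"
    and f: "\<And>i. i < n \<Longrightarrow> f i \<noteq> 0"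
  shows "dual_mat (scale_cols A f) = scale_cols (dual_mat A) (\<lambda>i. inverse (f i))"
proof (rule inverse_mat_unique)
  note D = dual_mat_works[OF A d]
  have sA: "scale_cols A f \<in> carrier_mat n n" using A by simp
  have "det (scale_cols A f) \<noteq> 0" using d f by (simp add: det_scale_cols[OF A])
  note E = dual_mat_works[OF sA this]
  show "transpose_mat (scale_cols A f) \<in> carrier_mat n n" using sA by simp
  show "dual_mat (scale_cols A f) \<in> carrier_mat n n"
    "dual_mat (scale_cols A f) * transpose_mat (scale_cols A f) = 1\<^sub>m n" by (rule E)+
  show "scale_cols (dual_mat A) (\<lambda>i. inverse (f i)) \<in> carrier_mat n n" using D by simp
  have tA: "transpose_mat A \<in> carrier_mat n n" using A by simp
  have di: "mat_diag n g \<in> carrier_mat n n" for g :: "nat \<Rightarrow> 'a" by simp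
  have "transpose_mat (scale_cols A f) = mat_diag n f * transpose_mat A"
    by (simp add: scale_cols_mat_diag[OF A] transpose_mult[OF A di] transpose_mat_diag)
  then have "transpose_mat (scale_cols A f) * scale_cols (dual_mat A) (\<lambda>i. inverse (f i))
      = (mat_diag n f * transpose_mat A) * (dual_mat A * mat_diag n (\<lambda>i. inverse (f i)))"
    by (simp add: scale_cols_mat_diag[OF D(1)])
  also have "\<dots> = mat_diag n f * (transpose_mat A * (dual_mat A * mat_diag n (\<lambda>i. inverse (f i))))"
    by (rule assoc_mult_mat[OF di tA mult_carrier_mat[OF D(1) di]])
  also have "transpose_mat A * (dual_mat A * mat_diag n (\<lambda>i. inverse (f i)))
      = (transpose_mat A * dual_mat A) * mat_diag n (\<lambda>i. inverse (f i))"
    by (rule assoc_mult_mat[OF tA D(1) di, symmetric])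
  also have "mat_diag n f * (transpose_mat A * dual_mat A * mat_diag n (\<lambda>i. inverse (f i)))
      = mat_diag n (\<lambda>i. f i * inverse (f i))"
    by (simp add: D(3) left_mult_one_mat[OF di])
  also have "\<dots> = 1\<^sub>m n" using f by (auto simp: mat_diag_def intro!: eq_matI)
  finally show "transpose_mat (scale_cols A f) * scale_cols (dual_mat A) (\<lambda>i. inverse (f i)) = 1\<^sub>m n" .
qed

lemma mat_of_cols_scale:
  assumes "length c = dim_col A" "n = dim_row A"
  shows "mat_of_cols n (map2 (\<lambda>c x. h c \<cdot>\<^sub>v x) c (cols A)) = scale_cols A (\<lambda>j. h (c ! j))"
  using assms by (intro eq_matI) (auto simp: scale_cols_def mat_of_cols_def)

lemma length_concat_product: "length [f x y. x \<leftarrow> xs, y \<leftarrow> ys] = length xs * length ys"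
  by (induction xs) auto

lemma nth_concat_product:
  assumes "j < length xs * length ys"
  shows "[f x y. x \<leftarrow> xs, y \<leftarrow> ys] ! j = f (xs ! (j div length ys)) (ys ! (j mod length ys))"
  using assms
proof (induction xs arbitrary: j)
  case (Cons x xs)
  have pos: "0 < length ys" using Cons.prems by (auto intro: gr0I)
  show ?case
  proof (cases "j < length ys")
    case True
    then show ?thesis by (simp add: nth_append)
  next
    case False
    then have "j - length ys < length xs * length ys" using Cons.prems by auto
    then show ?thesis
      using Cons.IH False pos by (simp add: nth_append le_div_geq le_mod_geq)
  qed
qed simp

section \<open>Finite and infinite places\<close>

text \<open>
  A finite extension of the rational function field, with the restriction \<open>\<kappa>\<close> of its embedding to
  constants and the image \<open>X\<close> of the variable. There are two charts: \<open>y = x\<close>, and \<open>y = 1/x\<close>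
  with the evaluation map \<open>eval_inf\<close>.
\<close>

locale finite_function_field = hom_i: field_hom \<iota>
  for \<iota> :: "'k::field poly fract \<Rightarrow> 'K::field" +
  assumes finite_ext: "finite_extension \<iota>"
begin

definition \<kappa> :: "'k \<Rightarrow> 'K" where "\<kappa> c = \<iota> (to_fract [:c:])"

definition X :: 'K where "X = \<iota> (to_fract [:0, 1:])"

lemma X_nonzero: "X \<noteq> 0"
  by (simp add: X_def)

lemma Fract_quotient: "\<exists>a b. b \<noteq> 0 \<and> f = to_fract a / to_fract b"
  by (cases f) (auto simp: Fract_conv_to_fract)

sublocale fin: affine_chart \<iota> "\<lambda>p. \<iota> (to_fract p)"
proof
  show "finite_extension \<iota>" by (rule finite_ext)
  fix f :: "'k poly fract"
  obtain a b where "b \<noteq> 0" "f = to_fract a / to_fract b" using Fract_quotient by blast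
  then show "\<exists>a b. b \<noteq> 0 \<and> \<iota> (to_fract b) * \<iota> f = \<iota> (to_fract a)"
    by (intro exI[of _ a] exI[of _ b]) (simp flip: hom_i.hom_mult)
qed (auto simp: hom_i.hom_add hom_i.hom_mult)

sublocale kappa: field_hom \<kappa>
proof
  show "\<kappa> 1 = 1" by (simp add: \<kappa>_def flip: one_pCons)
qed (auto simp: \<kappa>_def simp flip: hom_i.hom_add hom_i.hom_mult to_fract_add to_fract_mult)

sublocale kappa_poly: map_poly_idom_hom \<kappa> ..

lemma eval_X: "\<iota> (to_fract p) = poly (map_poly \<kappa> p) X"
proof (induction p)
  case (pCons a p)
  have "pCons a p = [:a:] + [:0, 1:] * p" by simp
  then have "\<iota> (to_fract (pCons a p)) = \<kappa> a + X * \<iota> (to_fract p)"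
    by (metis \<kappa>_def X_def hom_i.hom_add hom_i.hom_mult to_fract_add to_fract_mult)
  then show ?case by (simp add: pCons.IH kappa.map_poly_pCons_hom)
qed simp

text \<open>The value of a polynomial at \<open>1/x\<close>.\<close>

definition eval_inf :: "'k poly \<Rightarrow> 'K" where
  "eval_inf p = poly (map_poly \<kappa> p) (inverse X)"

lemma reflect_eval: "\<iota> (to_fract p) = X ^ degree p * eval_inf (reflect_poly p)"
proof -
  have "map_poly \<kappa> (reflect_poly p) = reflect_poly (map_poly \<kappa> p)"
    by (intro poly_eqI) (simp add: coeff_reflect_poly coeff_map_poly)
  then show ?thesis
    unfolding eval_X eval_inf_def
    using poly_reflect_poly_nz[of "inverse X" "map_poly \<kappa> p"] X_nonzero
    by (simp add: power_inverse field_simps)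
qed

lemma eval_inf_eq_0: "eval_inf p = 0 \<longleftrightarrow> p = 0"
proof
  assume p: "eval_inf p = 0"
  have "map_poly \<kappa> (reflect_poly p) = reflect_poly (map_poly \<kappa> p)"
    by (intro poly_eqI) (simp add: coeff_reflect_poly coeff_map_poly)
  then have "\<iota> (to_fract (reflect_poly p)) = 0"
    unfolding eval_X using p poly_reflect_poly_nz[of X "map_poly \<kappa> p"] X_nonzero by (simp add: eval_inf_def)
  then show "p = 0" by simp
qed (simp add: eval_inf_def)

lemma eval_inf_X: "eval_inf [:0, 1:] = inverse X"
  by (simp add: eval_inf_def)

sublocale inf: affine_chart \<iota> eval_inf
proof
  show "finite_extension \<iota>" by (rule finite_ext)
  show "eval_inf [:c:] = \<iota> (to_fract [:c:])" for c by (simp add: eval_inf_def kappa.map_poly_pCons_hom) (simp add: \<kappa>_def)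
  show "eval_inf x = 0 \<Longrightarrow> x = 0" for x by (simp add: eval_inf_eq_0)
  fix f :: "'k poly fract"
  obtain a b where ab: "b \<noteq> 0" "f = to_fract a / to_fract b" using Fract_quotient by blast
  let ?x = "[:0, 1:] :: 'k poly"
  have m: "eval_inf (p * q) = eval_inf p * eval_inf q" for p q
    by (simp add: eval_inf_def kappa_poly.hom_mult)
  have pw: "eval_inf (?x ^ n) = inverse X ^ n" for n
    by (induction n) (simp_all only: power_Suc m eval_inf_X power_0, simp add: eval_inf_def)
  have "eval_inf (reflect_poly b * ?x ^ degree a) * \<iota> f = eval_inf (reflect_poly a * ?x ^ degree b)"
    using ab(1) X_nonzero unfolding ab(2) hom_i.hom_div m pw reflect_eval
    by (simp add: eval_inf_eq_0 field_simps)
  moreover have "reflect_poly b * ?x ^ degree a \<noteq> 0" using ab(1) by simp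
  ultimately show "\<exists>a b. b \<noteq> 0 \<and> eval_inf b * \<iota> f = eval_inf a" by blast
qed (simp_all add: eval_inf_def kappa_poly.hom_mult kappa_poly.hom_add)

lemma A_fin_eq: "A_fin \<iota> = fin.IC"
  by (simp add: A_fin_def image_image)

lemma fin_places_eq: "fin_places \<iota> = fin.Pl"
proof (intro Set.set_eqI iffI)
  fix P assume "P \<in> fin_places \<iota>"
  then have "P \<in> places \<iota>" "fin.IC \<subseteq> P" by (auto simp: fin_places_def A_fin_eq)
  then show "P \<in> fin.Pl" using fin.chart_placeI fin.R.subset_integral_closure by blast
next
  fix P assume "P \<in> fin.Pl"
  then interpret P: chart_place \<iota> "\<lambda>p. \<iota> (to_fract p)" P by simp
  show "P \<in> fin_places \<iota>" using P.place P.integral_subset by (auto simp: fin_places_def A_fin_eq)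
qed

lemma fin_place_if_X:
  assumes P: "P \<in> places \<iota>" and X: "X \<in> P"
  shows "P \<in> fin_places \<iota>"
proof -
  interpret P: valuation_subring P by (rule place_valuation_subring[OF P])
  have c: "\<kappa> c \<in> P" for c using P by (auto simp: places_def const_field_def \<kappa>_def)
  have "\<iota> (to_fract p) \<in> P" for p
    unfolding eval_X poly_altdef using c X
    by (intro P.sum_mem P.mult_mem P.power_mem) (auto simp: coeff_map_poly)
  then show ?thesis unfolding fin_places_eq using fin.chart_placeI[OF P] by auto
qed

text \<open>
  A fraction \<open>f/h\<close> of nonpositive degree is, up to a nonnegative power of \<open>1/x\<close>, the quotient of the
  reflected polynomials evaluated at \<open>1/x\<close>; the denominator is a unit at \<open>P\<close>, since its constant
  coefficient is the leading coefficient of \<open>h\<close>.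
\<close>

lemma inf_place_if_not_X:
  assumes P: "P \<in> places \<iota>" and X: "X \<notin> P"
  shows "P \<in> inf_places \<iota>"
proof -
  interpret P: valuation_subring P by (rule place_valuation_subring[OF P])
  have iX: "inverse X \<in> max_ideal P" using P.inverse_mem_max[OF X] .
  then have iXP: "inverse X \<in> P" by (rule P.max_ideal_subset)
  have c: "\<kappa> c \<in> P" for c using P by (auto simp: places_def const_field_def \<kappa>_def)
  have e: "eval_inf p \<in> P" for p
    unfolding eval_inf_def poly_altdef using c iXP
    by (intro P.sum_mem P.mult_mem P.power_mem) (auto simp: coeff_map_poly)
  have u: "eval_inf p \<notin> max_ideal P" if "coeff p 0 \<noteq> 0" for p
  proof
    assume m: "eval_inf p \<in> max_ideal P"
    obtain a q where p: "p = pCons a q" by (cases p)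
    have "eval_inf p = \<kappa> a + inverse X * eval_inf q" by (simp add: p eval_inf_def kappa.map_poly_pCons_hom)
    moreover have "inverse X * eval_inf q \<in> max_ideal P" by (rule P.max_mult[OF iX e])
    ultimately have "\<kappa> a \<in> max_ideal P" using m P.max_diff by (metis add_diff_cancel_right')
    then have "\<kappa> a * \<kappa> (inverse a) \<in> max_ideal P" using c by (rule P.max_mult)
    then show False using that p by (simp flip: kappa.hom_mult)
  qed
  have "\<iota> ` infinite_valuation_ring \<subseteq> P"
  proof
    fix z assume "z \<in> \<iota> ` infinite_valuation_ring"
    then obtain f h where fh: "h \<noteq> 0" "degree f \<le> degree h" "z = \<iota> (Fract f h)"
      by (auto simp: infinite_valuation_ring_def)
    have r: "eval_inf (reflect_poly h) \<noteq> 0" using fh(1) by simp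
    have "inverse (eval_inf (reflect_poly h)) \<in> P"
      using fh(1) by (intro P.unit_inverse_mem e u) simp
    moreover have "z = inverse X ^ (degree h - degree f) * eval_inf (reflect_poly f)
        * inverse (eval_inf (reflect_poly h))"
    proof -
      have "X ^ degree h = X ^ (degree h - degree f) * X ^ degree f"
        using fh(2) by (simp flip: power_add)
      moreover have "z = \<iota> (to_fract f) / \<iota> (to_fract h)"
        by (simp add: fh(3) Fract_conv_to_fract hom_i.hom_div)
      ultimately show ?thesis
        using X_nonzero r by (simp add: reflect_eval field_simps)
    qed
    ultimately show "z \<in> P" using e P.power_mem[OF iXP] P.mult_mem by metis
  qed
  then have "A_inf \<iota> \<subseteq> P" unfolding A_inf_def by (rule P.integral_closure_subset)
  then show ?thesis using P by (simp add: inf_places_def)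
qed

lemma infinite_valuation_ring_A_inf:
  assumes "z \<in> \<iota> ` infinite_valuation_ring"
  shows "z \<in> A_inf \<iota>"
proof -
  obtain f h where fh: "h \<noteq> 0" "degree f \<le> degree h" "z = \<iota> (Fract f h)"
    using assms by (auto simp: infinite_valuation_ring_def)
  have "Fract (- f) h \<in> infinite_valuation_ring" "Fract 1 1 \<in> (infinite_valuation_ring :: 'k poly fract set)"
    "Fract 0 1 \<in> (infinite_valuation_ring :: 'k poly fract set)"
    using fh unfolding infinite_valuation_ring_def by force+
  then have "\<iota> (Fract (- f) h) \<in> \<iota> ` infinite_valuation_ring" "\<iota> (Fract 1 1) \<in> \<iota> ` infinite_valuation_ring"
    "\<iota> (Fract 0 1) \<in> \<iota> ` infinite_valuation_ring" by blast+
  then have "- z \<in> \<iota> ` infinite_valuation_ring" "1 \<in> \<iota> ` infinite_valuation_ring"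
    "0 \<in> \<iota> ` infinite_valuation_ring"
    by (simp_all add: fh(3) hom_i.hom_uminus One_fract_def[symmetric] Zero_fract_def[symmetric] minus_fract[symmetric] del: minus_fract)
  then show ?thesis
    unfolding A_inf_def integral_closure_def
    by (intro CollectI exI[of _ "[:- z, 1:]"]) (auto simp: coeff_pCons split: nat.splits)
qed

text \<open>
  At a finite place some nonconstant polynomial \<open>q\<close> is not a unit, but \<open>1/q\<close> is regular at all
  infinite places.
\<close>

lemma fin_inf_disjoint: "fin_places \<iota> \<inter> inf_places \<iota> = {}"
proof (rule ccontr)
  assume "fin_places \<iota> \<inter> inf_places \<iota> \<noteq> {}"
  then obtain P where P: "P \<in> fin_places \<iota>" "P \<in> inf_places \<iota>" by blast
  interpret P: chart_place \<iota> "\<lambda>p. \<iota> (to_fract p)" P using P(1) by (simp add: fin_places_eq)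
  obtain q where q: "degree q > 0" "\<And>a. \<iota> (to_fract a) \<in> max_ideal P \<longleftrightarrow> q dvd a"
    using P.max_generator by blast
  then have q0: "q \<noteq> 0" by auto
  have "inverse (\<iota> (to_fract q)) \<in> A_inf \<iota>"
  proof (rule infinite_valuation_ring_A_inf)
    have "inverse (to_fract q) = Fract 1 q" by (simp add: to_fract_def)
    moreover have "Fract 1 q \<in> infinite_valuation_ring"
      unfolding infinite_valuation_ring_def
      by (intro CollectI exI[of _ "1 :: 'k poly"] exI[of _ q]) (simp add: q0)
    ultimately show "inverse (\<iota> (to_fract q)) \<in> \<iota> ` infinite_valuation_ring"
      by (metis hom_i.hom_inverse imageI)
  qed
  then have "inverse (\<iota> (to_fract q)) \<in> P" using P(2) by (auto simp: inf_places_def)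
  moreover have "\<iota> (to_fract q) \<in> max_ideal P" by (simp add: q(2))
  ultimately show False using P.max_inverse_notin q0 by auto
qed

lemma places_eq: "places \<iota> = fin_places \<iota> \<union> inf_places \<iota>"
  using fin_place_if_X inf_place_if_not_X by (auto simp: fin_places_def inf_places_def)

lemma finite_inf_places: "finite (inf_places \<iota>)"
proof (rule finite_subset)
  show "finite {P. chart_place \<iota> eval_inf P \<and> inverse X \<in> max_ideal P}"
    using X_nonzero by (intro inf.finite_places_above) simp
  show "inf_places \<iota> \<subseteq> {P. chart_place \<iota> eval_inf P \<and> inverse X \<in> max_ideal P}"
  proof
    fix P assume P: "P \<in> inf_places \<iota>"
    then have pl: "P \<in> places \<iota>" by (simp add: inf_places_def)
    interpret P: valuation_subring P by (rule place_valuation_subring[OF pl])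
    have "X \<notin> P" using fin_place_if_X[OF pl] P fin_inf_disjoint by blast
    then have iX: "inverse X \<in> max_ideal P" by (rule P.inverse_mem_max)
    then have iXP: "inverse X \<in> P" by (rule P.max_ideal_subset)
    have "\<kappa> c \<in> P" for c using pl by (auto simp: places_def const_field_def \<kappa>_def)
    then have "eval_inf p \<in> P" for p
      unfolding eval_inf_def poly_altdef using iXP
      by (intro P.sum_mem P.mult_mem P.power_mem) (auto simp: coeff_map_poly)
    then show "P \<in> {P. chart_place \<iota> eval_inf P \<and> inverse X \<in> max_ideal P}"
      using iX inf.chart_placeI[OF pl] by auto
  qed
qed

lemma ideal_val_eq:
  assumes "fractional_ideal (A_fin \<iota>) I" "P \<in> fin_places \<iota>"
  shows "ideal_val \<iota> P I = fin.frac_ord P I"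
  using fin.factorization_exponent assms by (simp add: ideal_val_def A_fin_eq fin_places_eq)

text \<open>
  The degree of the pair \<open>(I, a, b)\<close> of rank one is the degree of any repartition \<open>s\<close> that is \<open>b\<close>
  at the infinite places and has valuation \<open>v\<^sub>P(I) + v\<^sub>P(a)\<close> at the finite ones.
  All sums are taken over a finite set \<open>S\<close> of finite places, and over the finite set of infinite
  places.
\<close>

lemma degree_sum:
  assumes I: "fractional_ideal (A_fin \<iota>) I" and a: "a \<noteq> 0"
    and s_inf: "\<And>P. P \<in> inf_places \<iota> \<Longrightarrow> s P = b"
    and s_fin: "\<And>P. P \<in> fin_places \<iota> \<Longrightarrow> val P (s P) = ideal_val \<iota> P I + val P a"
  shows "ideal_deg \<iota> I + deg_fin \<iota> a + deg_inf \<iota> b = rep_deg \<iota> s"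
proof -
  let ?d = "\<lambda>P. int (place_degree \<iota> P)"
  note I' = I[unfolded A_fin_eq]
  define S where "S = {P \<in> fin_places \<iota>. ideal_val \<iota> P I \<noteq> 0} \<union> {P \<in> fin_places \<iota>. val P a \<noteq> 0}"
  have "{P \<in> fin_places \<iota>. ideal_val \<iota> P I \<noteq> 0} = {P \<in> fin.Pl. fin.frac_ord P I \<noteq> 0}"
    using ideal_val_eq[OF I] by (auto simp: fin_places_eq)
  then have S: "finite S" "S \<subseteq> fin_places \<iota>"
    using fin.finite_frac_ord[OF I'] fin.finite_val_nonzero[OF a] by (auto simp: S_def fin_places_eq)
  have principal: "ideal_val \<iota> P ((\<lambda>y. a * y) ` A_fin \<iota>) = val P a" if "P \<in> fin_places \<iota>" for P
    using fin.fractional_principal[OF a] ideal_val_eq that by (simp add: A_fin_eq fin_places_eq)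
  have 1: "ideal_deg \<iota> I = (\<Sum>P\<in>S. ideal_val \<iota> P I * ?d P)"
    unfolding ideal_deg_def using S by (intro sum.mono_neutral_left) (auto simp: S_def)
  have "deg_fin \<iota> a = (\<Sum>P | P \<in> fin_places \<iota> \<and> val P a \<noteq> 0. val P a * ?d P)"
    unfolding deg_fin_def ideal_deg_def by (intro sum.cong) (auto simp: principal)
  also have "\<dots> = (\<Sum>P\<in>S. val P a * ?d P)"
    using S by (intro sum.mono_neutral_left) (auto simp: S_def)
  finally have 2: "deg_fin \<iota> a = (\<Sum>P\<in>S. val P a * ?d P)" .
  have 3: "deg_inf \<iota> b = (\<Sum>P\<in>inf_places \<iota>. val P b * ?d P)"
    unfolding deg_inf_def using finite_inf_places by (intro sum.mono_neutral_left) auto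
  have "rep_deg \<iota> s = (\<Sum>P\<in>S \<union> inf_places \<iota>. val P (s P) * ?d P)"
    unfolding rep_deg_def
  proof (rule sum.mono_neutral_left)
    show "finite (S \<union> inf_places \<iota>)" using S finite_inf_places by simp
    show "{P. P \<in> places \<iota> \<and> val P (s P) \<noteq> 0} \<subseteq> S \<union> inf_places \<iota>"
      using s_fin by (auto simp: places_eq S_def)
    show "\<forall>P\<in>S \<union> inf_places \<iota> - {P. P \<in> places \<iota> \<and> val P (s P) \<noteq> 0}. val P (s P) * ?d P = 0"
      using S by (auto simp: places_eq)
  qed
  also have "\<dots> = (\<Sum>P\<in>S. val P (s P) * ?d P) + (\<Sum>P\<in>inf_places \<iota>. val P (s P) * ?d P)"
    using S finite_inf_places fin_inf_disjoint by (intro sum.union_disjoint) auto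
  also have "(\<Sum>P\<in>S. val P (s P) * ?d P) = (\<Sum>P\<in>S. ideal_val \<iota> P I * ?d P + val P a * ?d P)"
    using S by (intro sum.cong) (auto simp: s_fin distrib_right)
  also have "(\<Sum>P\<in>inf_places \<iota>. val P (s P) * ?d P) = (\<Sum>P\<in>inf_places \<iota>. val P b * ?d P)"
    by (intro sum.cong) (auto simp: s_inf)
  finally show ?thesis unfolding 1 2 3 by (simp add: sum.distrib)
qed

end

context finite_function_field
begin

text \<open>
  Only the number of columns matters here, so that this also applies to tensor products and sums
  before their matrices are known to be invertible.
\<close>

lemma rep_eq:
  assumes "length (ideals g) = dim_col (fin_mat g)"
  shows "rep \<iota> \<pi> g = (\<lambda>P\<in>places \<iota>. if P \<in> inf_places \<iota> then inf_mat g
    else scale_cols (fin_mat g) (\<lambda>j. \<pi> P powi ideal_val \<iota> P (ideals g ! j)))"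
  unfolding rep_def using assms by (intro restrict_ext if_cong mat_of_cols_scale refl)

lemma matrix_pair_length:
  "matrix_pair_of_rank \<iota> r g \<Longrightarrow> length (ideals g) = dim_col (fin_mat g)"
  by (auto simp: matrix_pair_of_rank_def)

lemmas rep_matrix_pair = rep_eq[OF matrix_pair_length]

lemma restrict_places_eqI:
  assumes "\<And>P. P \<in> inf_places \<iota> \<Longrightarrow> f P = h P" "\<And>P. P \<in> fin_places \<iota> \<Longrightarrow> f P = h P"
  shows "(\<lambda>P\<in>places \<iota>. f P) = (\<lambda>P\<in>places \<iota>. h P)"
  using assms by (auto simp: places_eq restrict_def)

end

section \<open>Matrix pairs and repartitions\<close>

text \<open>A finite extension with a chosen uniformizer at each place.\<close>

locale uniformized_function_field = finite_function_field \<iota>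
  for \<iota> :: "'k::field poly fract \<Rightarrow> 'K::field" +
  fixes \<pi> :: "'K set \<Rightarrow> 'K"
  assumes unif: "\<forall>P\<in>places \<iota>. \<pi> P \<noteq> 0 \<and> val P (\<pi> P) = 1"
begin

lemma unif_fin: "P \<in> fin_places \<iota> \<Longrightarrow> \<pi> P \<noteq> 0 \<and> val P (\<pi> P) = 1"
  using unif by (simp add: places_eq)

lemma fin_not_inf: "P \<in> fin_places \<iota> \<Longrightarrow> P \<notin> inf_places \<iota>"
  using fin_inf_disjoint by blast

lemma ideal_val_prod:
  assumes "fractional_ideal (A_fin \<iota>) I" "fractional_ideal (A_fin \<iota>) J" "P \<in> fin_places \<iota>"
  shows "fractional_ideal (A_fin \<iota>) (ideal_prod class_ring I J)"
    "ideal_val \<iota> P (ideal_prod class_ring I J) = ideal_val \<iota> P I + ideal_val \<iota> P J"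
  using assms fin.ideal_prod_fractional fin.frac_ord_ideal_prod
  by (simp_all add: ideal_val_eq A_fin_eq fin_places_eq)

lemma ideal_val_inv:
  assumes "fractional_ideal (A_fin \<iota>) I" "P \<in> fin_places \<iota>"
  shows "fractional_ideal (A_fin \<iota>) (inv\<^bsub>frac_ideals (A_fin \<iota>)\<^esub> I)"
    "ideal_val \<iota> P (inv\<^bsub>frac_ideals (A_fin \<iota>)\<^esub> I) = - ideal_val \<iota> P I"
proof -
  have I: "I \<in> carrier (frac_ideals fin.IC)" using assms by (simp add: fin.carrier_frac_ideals A_fin_eq)
  then have "inv\<^bsub>frac_ideals fin.IC\<^esub> I \<in> carrier (frac_ideals fin.IC)" by (rule fin.G.inv_closed)
  then show *: "fractional_ideal (A_fin \<iota>) (inv\<^bsub>frac_ideals (A_fin \<iota>)\<^esub> I)"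
    unfolding fin.carrier_frac_ideals A_fin_eq .
  show "ideal_val \<iota> P (inv\<^bsub>frac_ideals (A_fin \<iota>)\<^esub> I) = - ideal_val \<iota> P I"
    using ideal_val_eq[OF * assms(2)] ideal_val_eq[OF assms] fin.frac_ord_inv[OF I, of P] assms(2)
    by (simp add: A_fin_eq fin_places_eq)
qed

lemma ideal_val_finprod:
  assumes "\<forall>I\<in>set Is. fractional_ideal (A_fin \<iota>) I"
  shows "fractional_ideal (A_fin \<iota>) (finprod (frac_ideals (A_fin \<iota>)) (\<lambda>i. Is ! i) {..<length Is})"
    "P \<in> fin_places \<iota> \<Longrightarrow> ideal_val \<iota> P (finprod (frac_ideals (A_fin \<iota>)) (\<lambda>i. Is ! i) {..<length Is})
      = (\<Sum>i<length Is. ideal_val \<iota> P (Is ! i))"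
proof -
  have c: "(\<lambda>i. Is ! i) \<in> {..<length Is} \<rightarrow> carrier (frac_ideals fin.IC)"
    using assms by (auto simp: fin.carrier_frac_ideals A_fin_eq)
  have "finprod (frac_ideals fin.IC) (\<lambda>i. Is ! i) {..<length Is} \<in> carrier (frac_ideals fin.IC)"
    by (rule fin.G.finprod_closed[OF c])
  then show *: "fractional_ideal (A_fin \<iota>) (finprod (frac_ideals (A_fin \<iota>)) (\<lambda>i. Is ! i) {..<length Is})"
    unfolding fin.carrier_frac_ideals A_fin_eq .
  assume P: "P \<in> fin_places \<iota>"
  have "(\<Sum>i<length Is. ideal_val \<iota> P (Is ! i)) = (\<Sum>i<length Is. fin.frac_ord P (Is ! i))"
    using ideal_val_eq[OF _ P] assms by (intro sum.cong) auto
  then show "ideal_val \<iota> P (finprod (frac_ideals (A_fin \<iota>)) (\<lambda>i. Is ! i) {..<length Is})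
      = (\<Sum>i<length Is. ideal_val \<iota> P (Is ! i))"
    using ideal_val_eq[OF * P] fin.frac_ord_finprod[OF _ c, of P] P
    by (simp add: A_fin_eq fin_places_eq)
qed

lemma powi_sum: "(x::'K) \<noteq> 0 \<Longrightarrow> x powi (\<Sum>i\<in>A. k i) = (\<Prod>i\<in>A. x powi k i)"
  by (induction A rule: infinite_finite_induct) (auto simp: power_int_add)

context
  fixes g r
  assumes g: "matrix_pair_of_rank \<iota> r g"
begin

lemma pair_facts:
  "length (ideals g) = r" "\<And>I. I \<in> set (ideals g) \<Longrightarrow> fractional_ideal (A_fin \<iota>) I"
  "fin_mat g \<in> carrier_mat r r" "det (fin_mat g) \<noteq> 0" "inf_mat g \<in> carrier_mat r r" "det (inf_mat g) \<noteq> 0"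
  using g invertible_mat_det[of "fin_mat g" r] invertible_mat_det[of "inf_mat g" r]
  by (auto simp: matrix_pair_of_rank_def)

lemma nth_fractional: "j < r \<Longrightarrow> fractional_ideal (A_fin \<iota>) (ideals g ! j)"
  using pair_facts by auto

lemma matrix_pair_det: "matrix_pair_of_rank \<iota> 1 (mp_det \<iota> g)"
  using pair_facts ideal_val_finprod(1)[of "ideals g"]
  by (auto simp: matrix_pair_of_rank_def mp_det_def scalar_mat_def invertible_mat_det[of _ 1] det_single)

lemma matrix_pair_dual: "matrix_pair_of_rank \<iota> r (mp_dual \<iota> g)"
proof -
  note D = dual_mat_works[OF pair_facts(3,4)] and E = dual_mat_works[OF pair_facts(5,6)]
  have "fractional_ideal (A_fin \<iota>) (inv\<^bsub>frac_ideals (A_fin \<iota>)\<^esub> I)" if "I \<in> set (ideals g)" for I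
  proof -
    have "I \<in> carrier (frac_ideals fin.IC)"
      using pair_facts(2)[OF that] by (simp add: fin.carrier_frac_ideals A_fin_eq)
    from fin.G.inv_closed[OF this] show ?thesis unfolding fin.carrier_frac_ideals A_fin_eq .
  qed
  then show ?thesis
    using pair_facts D E
    by (auto simp: matrix_pair_of_rank_def mp_dual_def invertible_mat_def inverts_mat_def)
qed

lemma rep_det_eq:
  "rep_det \<iota> (rep \<iota> \<pi> g) = (\<lambda>P\<in>places \<iota>. if P \<in> inf_places \<iota> then det (inf_mat g)
    else det (fin_mat g) * \<pi> P powi ideal_val \<iota> P (ideals (mp_det \<iota> g) ! 0))"
  unfolding rep_det_def rep_matrix_pair[OF g]
proof (rule restrict_places_eqI)
  fix P assume P: "P \<in> fin_places \<iota>"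
  show "det ((\<lambda>P\<in>places \<iota>. if P \<in> inf_places \<iota> then inf_mat g
    else scale_cols (fin_mat g) (\<lambda>j. \<pi> P powi ideal_val \<iota> P (ideals g ! j))) P)
    = (if P \<in> inf_places \<iota> then det (inf_mat g)
    else det (fin_mat g) * \<pi> P powi ideal_val \<iota> P (ideals (mp_det \<iota> g) ! 0))"
    using P unif_fin[OF P] fin_not_inf[OF P] pair_facts(1,2) ideal_val_finprod(2)[of "ideals g" P]
    by (simp add: places_eq det_scale_cols[OF pair_facts(3)] mp_det_def powi_sum)
qed (simp add: places_eq)

lemma rep_mp_det: "rep \<iota> \<pi> (mp_det \<iota> g) = rep_scalar_mat \<iota> (rep_det \<iota> (rep \<iota> \<pi> g))"
  unfolding rep_scalar_mat_def rep_det_eq rep_matrix_pair[OF matrix_pair_det]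
  by (rule restrict_places_eqI)
    (auto simp: places_eq fin_not_inf mp_det_def scalar_mat_def scale_cols_def intro!: eq_matI)

lemma mp_deg_eq: "mp_deg \<iota> g = rep_mat_deg \<iota> (rep \<iota> \<pi> g)"
proof -
  let ?I = "ideals (mp_det \<iota> g) ! 0"
  have I: "fractional_ideal (A_fin \<iota>) ?I"
    using matrix_pair_det by (auto simp: matrix_pair_of_rank_def)
  have "mp_deg \<iota> g = mp_deg1 \<iota> (mp_det \<iota> g)"
  proof (cases "length (ideals g) = 1")
    case True
    then have r: "r = 1" using pair_facts by simp
    have "ideals g ! 0 \<in> carrier (frac_ideals fin.IC)"
      using nth_fractional[of 0] r by (simp add: fin.carrier_frac_ideals A_fin_eq)
    then have "finprod (frac_ideals fin.IC) (\<lambda>i. ideals g ! i) {..<1} = ideals g ! 0"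
      by (simp add: lessThan_Suc)
    then show ?thesis
      using True pair_facts r
      by (simp add: mp_deg_def mp_deg1_def mp_det_def A_fin_eq scalar_mat_def det_single)
  next
    case False
    then show ?thesis by (simp add: mp_deg_def)
  qed
  also have "\<dots> = ideal_deg \<iota> ?I + deg_fin \<iota> (det (fin_mat g)) + deg_inf \<iota> (det (inf_mat g))"
    by (simp add: mp_deg1_def mp_det_def scalar_mat_def)
  also have "\<dots> = rep_deg \<iota> (rep_det \<iota> (rep \<iota> \<pi> g))"
  proof (rule degree_sum[OF I pair_facts(4)])
    show "rep_det \<iota> (rep \<iota> \<pi> g) P = det (inf_mat g)" if "P \<in> inf_places \<iota>" for P
      using that by (simp add: rep_det_eq places_eq)
    fix P assume P: "P \<in> fin_places \<iota>"
    interpret P: chart_place \<iota> "\<lambda>p. \<iota> (to_fract p)" P using P by (simp add: fin_places_eq)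
    have "val P (det (fin_mat g) * \<pi> P powi ideal_val \<iota> P ?I) = val P (det (fin_mat g)) + ideal_val \<iota> P ?I"
      using unif_fin[OF P] pair_facts(4) by (simp add: P.val_mult P.val_powi)
    then show "val P (rep_det \<iota> (rep \<iota> \<pi> g) P) = ideal_val \<iota> P ?I + val P (det (fin_mat g))"
      using P fin_not_inf[OF P] by (simp add: rep_det_eq places_eq)
  qed
  finally show ?thesis by (simp add: rep_mat_deg_def)
qed

lemma rep_mp_dual: "rep \<iota> \<pi> (mp_dual \<iota> g) = rep_dual \<iota> (rep \<iota> \<pi> g)"
  unfolding rep_dual_def rep_matrix_pair[OF matrix_pair_dual] rep_matrix_pair[OF g]
proof (rule restrict_places_eqI, goal_cases)
  case (1 P)
  then show ?case by (simp add: places_eq mp_dual_def)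
next
  case (2 P)
  have "scale_cols (dual_mat (fin_mat g)) (\<lambda>j. \<pi> P powi ideal_val \<iota> P (map (\<lambda>I. inv\<^bsub>frac_ideals (A_fin \<iota>)\<^esub> I) (ideals g) ! j))
      = scale_cols (dual_mat (fin_mat g)) (\<lambda>j. inverse (\<pi> P powi ideal_val \<iota> P (ideals g ! j)))"
    using dual_mat_works(1)[OF pair_facts(3,4)] pair_facts(1) ideal_val_inv(2)[OF nth_fractional 2]
    by (auto simp: scale_cols_def power_int_minus intro!: eq_matI)
  then show ?case
    using 2 fin_not_inf[OF 2] unif_fin[OF 2] dual_scale_cols[OF pair_facts(3,4)]
    by (simp add: places_eq mp_dual_def)
qed

end

context
  fixes g g' r r'
  assumes g: "matrix_pair_of_rank \<iota> r g" and g': "matrix_pair_of_rank \<iota> r' g'"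
begin

lemma tensor_length: "length (ideals (mp_tensor g g')) = dim_col (fin_mat (mp_tensor g g'))"
  using pair_facts(1,3)[OF g] pair_facts(1,3)[OF g']
  by (simp add: mp_tensor_def length_concat_product kronecker_def)

lemma rep_mp_tensor: "rep \<iota> \<pi> (mp_tensor g g') = rep_tensor \<iota> (rep \<iota> \<pi> g) (rep \<iota> \<pi> g')"
  unfolding rep_tensor_def rep_matrix_pair[OF g] rep_matrix_pair[OF g'] rep_eq[OF tensor_length]
proof (rule restrict_places_eqI, goal_cases)
  case (1 P)
  then show ?case by (simp add: places_eq mp_tensor_def)
next
  case (2 P)
  note f = pair_facts[OF g] and f' = pair_facts[OF g']
  let ?K = "kronecker (fin_mat g) (fin_mat g')"
  have dim: "dim_col ?K = r * r'" "dim_col (fin_mat g') = r'"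
    using f(3) f'(3) by (auto simp: kronecker_def)
  have "\<pi> P powi ideal_val \<iota> P (ideals (mp_tensor g g') ! j) =
      \<pi> P powi ideal_val \<iota> P (ideals g ! (j div r')) * \<pi> P powi ideal_val \<iota> P (ideals g' ! (j mod r'))"
    if j: "j < r * r'" for j
  proof -
    have "0 < r'" using j by (auto intro: gr0I)
    then have lt: "j div r' < r" "j mod r' < r'" using j by (auto simp: less_mult_imp_div_less)
    have "ideals (mp_tensor g g') ! j = ideal_prod class_ring (ideals g ! (j div r')) (ideals g' ! (j mod r'))"
      using nth_concat_product[of j "ideals g" "ideals g'"] j f(1) f'(1) by (simp add: mp_tensor_def)
    then show ?thesis
      using ideal_val_prod(2)[OF nth_fractional[OF g lt(1)] nth_fractional[OF g' lt(2)] 2] unif_fin[OF 2]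
      by (simp add: power_int_add)
  qed
  then have "scale_cols ?K (\<lambda>j. \<pi> P powi ideal_val \<iota> P (ideals (mp_tensor g g') ! j))
    = scale_cols ?K (\<lambda>j. \<pi> P powi ideal_val \<iota> P (ideals g ! (j div r')) *
      \<pi> P powi ideal_val \<iota> P (ideals g' ! (j mod r')))"
    using dim by (auto simp: scale_cols_def intro!: eq_matI)
  moreover have "fin_mat (mp_tensor g g') = ?K" by (simp add: mp_tensor_def)
  ultimately show ?case
    using 2 fin_not_inf[OF 2] dim by (simp add: places_eq kronecker_scale_cols)
qed

lemma sum_length: "length (ideals (mp_sum g g')) = dim_col (fin_mat (mp_sum g g'))"
  using matrix_pair_length[OF g] matrix_pair_length[OF g']
  by (simp add: mp_sum_def index_direct_sum_mat)

lemma rep_mp_sum: "rep \<iota> \<pi> (mp_sum g g') = rep_sum \<iota> (rep \<iota> \<pi> g) (rep \<iota> \<pi> g')"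
  unfolding rep_sum_def rep_matrix_pair[OF g] rep_matrix_pair[OF g'] rep_eq[OF sum_length]
proof (rule restrict_places_eqI, goal_cases)
  case (1 P)
  then show ?case by (simp add: places_eq mp_sum_def)
next
  case (2 P)
  have "scale_cols A (\<lambda>j. \<pi> P powi ideal_val \<iota> P ((ideals g @ ideals g') ! j))
    = scale_cols A (\<lambda>j. if j < dim_col (fin_mat g) then \<pi> P powi ideal_val \<iota> P (ideals g ! j)
      else \<pi> P powi ideal_val \<iota> P (ideals g' ! (j - dim_col (fin_mat g))))" for A
    using matrix_pair_length[OF g] by (auto simp: scale_cols_def nth_append intro!: eq_matI)
  then show ?case
    using 2 fin_not_inf[OF 2] by (simp add: places_eq direct_sum_scale_cols mp_sum_def)
qed

end

end

theorem theorem4p1p6: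
  fixes \<iota> :: "'k::field poly fract \<Rightarrow> 'K::field"
    and \<pi> :: "'K set \<Rightarrow> 'K"
    and g g' :: "'K matrix_pair"
    and r r' :: nat
  assumes "perfect_field TYPE('k)"
    and "field_hom \<iota>"
    and "finite_extension \<iota>"
    and "separable_extension \<iota>"
    and "\<forall>P\<in>places \<iota>. \<pi> P \<noteq> 0 \<and> val P (\<pi> P) = 1"
    and "matrix_pair_of_rank \<iota> r g"
    and "matrix_pair_of_rank \<iota> r' g'"
  shows "rep \<iota> \<pi> (mp_det \<iota> g) = rep_scalar_mat \<iota> (rep_det \<iota> (rep \<iota> \<pi> g))
    \<and> mp_deg \<iota> g = rep_mat_deg \<iota> (rep \<iota> \<pi> g)
    \<and> rep \<iota> \<pi> (mp_tensor g g') = rep_tensor \<iota> (rep \<iota> \<pi> g) (rep \<iota> \<pi> g')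
    \<and> rep \<iota> \<pi> (mp_sum g g') = rep_sum \<iota> (rep \<iota> \<pi> g) (rep \<iota> \<pi> g')
    \<and> rep \<iota> \<pi> (mp_dual \<iota> g) = rep_dual \<iota> (rep \<iota> \<pi> g)"
proof -
  interpret uniformized_function_field \<iota> \<pi>
    using assms(2,3,5)
    by (intro uniformized_function_field.intro finite_function_field.intro
        finite_function_field_axioms.intro uniformized_function_field_axioms.intro)
  show ?thesis
    using rep_mp_det[OF assms(6)] mp_deg_eq[OF assms(6)] rep_mp_tensor[OF assms(6,7)]
      rep_mp_sum[OF assms(6,7)] rep_mp_dual[OF assms(6)] by blast
qed

end
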